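(* Let $V_*\otimes V\to\mathbb{C}$ be a non-degenerate pairing between countably infinite-dimensional complex vector spaces, with associated Mackey Lie algebra $\mathfrak{g}^M$. Let $\lambda,\mu$ be partitions, put $m=|\lambda|$, $n=|\mu|$, and let $W_{\lambda,\mu}$ be the space of traceless tensors in $(V^* )_\lambda\otimes V_\mu\subseteq (V^* )^{\otimes m}\otimes V^{\otimes n}$. For $0\le k\le m$ set $$W_{\lambda,\mu}^k=W_{\lambda,\mu}\cap\Big(\sum_{|\mathbf{r}|\le k}V^{\mathbf{r}}\otimes V^{\otimes n}\Big),$$ the sum being over binary words $\mathbf{r}=(r_1,\dots,r_m)\in\{0,1\}^m$ with $|\mathbf{r}|\le k$. Then $W_{\lambda,\mu}^0\subseteq W_{\lambda,\mu}^1\subseteq\dots\subseteq W_{\lambda,\mu}^m=W_{\lambda,\mu}$ is the socle filtration of $W_{\lambda,\mu}$ as a $\mathfrak{g}^M$-module.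
   Context: The pairing realizes $V_*$ as a subspace of the full algebraic dual $V^*$. The Mackey Lie algebra $\mathfrak{g}^M$ of the pair $(V,V_* )$ is the Lie algebra (under commutator) of all linear endomorphisms of $V$ whose dual endomorphism of $V^*$ maps $V_*$ into $V_*$. It acts on $V$, and on $V^*$ by $(af)(v)=-f(av)$, preserving $V_*$. For a binary word $\mathbf{r}=(r_1,\dots,r_m)$, $r_i\in\{0,1\}$, $V^{\mathbf{r}}=\bigotimes_{i=1}^m V^{r_i}\subseteq (V^* )^{\otimes m}$ where $V^0=V_*$ and $V^1=V^*$, and $|\mathbf{r}|=\sum_i r_i$. For a vector space $U$ and a partition $\lambda$, $U_\lambda$ is the Schur functor of $\lambda$ applied to $U$, realized inside $U^{\otimes|\lambda|}$ as the image $c_\lambda(U^{\otimes |\lambda|})$ of a Young symmetrizer $c_\lambda$. A tensor in $(V^* )^{\otimes m}\otimes V^{\otimes n}$ is traceless if it lies in the kernel of all $mn$ evaluation maps $(V^* )^{\otimes m}\otimes V^{\otimes n}\to (V^* )^{\otimes(m-1)}\otimes V^{\otimes(n-1)}$ pairing one factor $V^*$ with one factor $V$. (The modules $W_{\lambda,\mu}$ are the simple objects of the category $\mathbb{T}_{\mathrm{End}(V)}$ of finite length subquotients of finite direct sums of copies of $T(V^*\oplus V)$ over $\mathrm{End}(V)$.) The socle filtration of a module $M$ is $\mathrm{soc}^0M\subseteq \mathrm{soc}^1M\subseteq\cdots$, where $\mathrm{soc}^0M$ is the socle (sum of all simple submodules) of $M$ and $\mathrm{soc}^{k}M/\mathrm{soc}^{k-1}M$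 is the socle of $M/\mathrm{soc}^{k-1}M$; the claim is that $W^k_{\lambda,\mu}=\mathrm{soc}^k W_{\lambda,\mu}$ for $0\le k\le m$. *)

theory Defs
  imports
    Complex_Main
    "HOL-Library.Function_Algebras"
    "HOL-Library.Countable_Set"
    "HOL-Combinatorics.Permutations"
begin

section \<open>Vector spaces, pairings and the Mackey Lie algebra\<close>

text \<open>Complex vector spaces are types of class \<open>ab_group_add\<close> with a scalar multiplication satisfying
  the locale \<^locale>\<open>vector_space\<close>.  Spaces of complex-valued functions carry the pointwise
  operations.\<close>

definition fscale :: "complex \<Rightarrow> ('x \<Rightarrow> complex) \<Rightarrow> 'x \<Rightarrow> complex" where
  "fscale c t = (\<lambda>x. c * t x)"

interpretation fn: vector_space "fscale :: complex \<Rightarrow> ('x \<Rightarrow> complex) \<Rightarrow> 'x \<Rightarrow> complex"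
  by unfold_locales (auto simp: fscale_def fun_eq_iff algebra_simps)

definition countably_infinite_dim :: "(complex \<Rightarrow> 'v::ab_group_add \<Rightarrow> 'v) \<Rightarrow> bool" where
  "countably_infinite_dim s \<longleftrightarrow>
     (\<exists>B. \<not> module.dependent s B \<and> module.span s B = UNIV \<and> infinite B \<and> countable B)"

definition alg_dual :: "(complex \<Rightarrow> 'v::ab_group_add \<Rightarrow> 'v) \<Rightarrow> ('v \<Rightarrow> complex) set" where
  "alg_dual sV = {f. Vector_Spaces.linear sV (*) f}"

definition nondegenerate_pairing ::
    "(complex \<Rightarrow> 'w::ab_group_add \<Rightarrow> 'w) \<Rightarrow> (complex \<Rightarrow> 'v::ab_group_add \<Rightarrow> 'v) \<Rightarrow>
     ('w \<Rightarrow> 'v \<Rightarrow> complex) \<Rightarrow> bool" where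
  "nondegenerate_pairing sW sV p \<longleftrightarrow>
     (\<forall>w. Vector_Spaces.linear sV (*) (p w)) \<and>
     (\<forall>v. Vector_Spaces.linear sW (*) (\<lambda>w. p w v)) \<and>
     (\<forall>w. (\<forall>v. p w v = 0) \<longrightarrow> w = 0) \<and>
     (\<forall>v. (\<forall>w. p w v = 0) \<longrightarrow> v = 0)"

text \<open>Below, \<open>Vs\<close> is always the realization \<open>range p\<close> of \<open>V\<^sub>*\<close> inside the full algebraic dual.
  The dual endomorphism of \<open>a\<close> is \<open>f \<mapsto> f \<circ> a\<close>.\<close>

definition mackey_algebra ::
    "(complex \<Rightarrow> 'v::ab_group_add \<Rightarrow> 'v) \<Rightarrow> ('v \<Rightarrow> complex) set \<Rightarrow> ('v \<Rightarrow> 'v) set" where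
  "mackey_algebra sV Vs = {a. Vector_Spaces.linear sV sV a \<and> (\<forall>f\<in>Vs. f \<circ> a \<in> Vs)}"


section \<open>Tensors\<close>

text \<open>Tensors are realized as multilinear forms.  If the space \<open>U\<close> is evaluated against a separating set
  \<open>E\<close> through \<open>ev\<close>, then \<open>u\<^sub>1 \<otimes> \<dots> \<otimes> u\<^sub>n\<close> is the form
  \<open>(e\<^sub>1, \<dots>, e\<^sub>n) \<mapsto> ev u\<^sub>1 e\<^sub>1 \<cdots> ev u\<^sub>n e\<^sub>n\<close> on \<open>E\<^sup>n\<close> (extended by zero), and \<open>U\<^bsup>\<otimes>n\<^esup>\<close> is the span of
  these.  Covectors are evaluated on \<open>V\<close>, vectors on the full algebraic dual of \<open>V\<close>.  The lemma
  \<open>tensor_lift_pure\<close> below shows that the resulting space of mixed tensors does have the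
  universal property of the tensor product.\<close>

definition decomposable :: "('u \<Rightarrow> 'e \<Rightarrow> complex) \<Rightarrow> 'e set \<Rightarrow> 'u list \<Rightarrow> 'e list \<Rightarrow> complex" where
  "decomposable ev E us = (\<lambda>es. if length es = length us \<and> set es \<subseteq> E
     then \<Prod>i<length us. ev (us ! i) (es ! i) else 0)"

definition tensor_power ::
    "('u \<Rightarrow> 'e \<Rightarrow> complex) \<Rightarrow> 'e set \<Rightarrow> 'u set \<Rightarrow> nat \<Rightarrow> ('e list \<Rightarrow> complex) set" where
  "tensor_power ev E U n = fn.span {decomposable ev E us | us. length us = n \<and> set us \<subseteq> U}"

abbreviation (input) ev_covector :: "('v \<Rightarrow> complex) \<Rightarrow> 'v \<Rightarrow> complex" where
  "ev_covector f x \<equiv> f x"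

abbreviation (input) ev_vector :: "'v \<Rightarrow> ('v \<Rightarrow> complex) \<Rightarrow> complex" where
  "ev_vector v g \<equiv> g v"

definition outer :: "('x \<Rightarrow> complex) \<Rightarrow> ('y \<Rightarrow> complex) \<Rightarrow> 'x \<times> 'y \<Rightarrow> complex" where
  "outer s t = (\<lambda>(x, y). s x * t y)"

type_synonym 'v mixed = "'v list \<times> ('v \<Rightarrow> complex) list \<Rightarrow> complex"

definition pure_tensor ::
    "(complex \<Rightarrow> 'v::ab_group_add \<Rightarrow> 'v) \<Rightarrow> ('v \<Rightarrow> complex) list \<Rightarrow> 'v list \<Rightarrow> 'v mixed" where
  "pure_tensor sV fs vs =
     outer (decomposable ev_covector UNIV fs) (decomposable ev_vector (alg_dual sV) vs)"

definition mixed_tensors :: "(complex \<Rightarrow> 'v::ab_group_add \<Rightarrow> 'v) \<Rightarrow> nat \<Rightarrow> nat \<Rightarrow> 'v mixed set" where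
  "mixed_tensors sV m n = fn.span {pure_tensor sV fs vs | fs vs.
     length fs = m \<and> set fs \<subseteq> alg_dual sV \<and> length vs = n}"

text \<open>The linear map on mixed tensors prescribed on pure tensors by a multilinear map \<open>\<phi>\<close>; outside
  \<open>mixed_tensors sV m n\<close> its values are irrelevant.\<close>

definition tensor_lift :: "(complex \<Rightarrow> 'v::ab_group_add \<Rightarrow> 'v) \<Rightarrow> nat \<Rightarrow> nat \<Rightarrow>
    (('v \<Rightarrow> complex) list \<Rightarrow> 'v list \<Rightarrow> 'x \<Rightarrow> complex) \<Rightarrow> 'v mixed \<Rightarrow> 'x \<Rightarrow> complex" where
  "tensor_lift sV m n \<phi> = (SOME \<Phi>. Vector_Spaces.linear fscale fscale \<Phi> \<and>
     (\<forall>fs vs. length fs = m \<and> set fs \<subseteq> alg_dual sV \<and> length vs = n \<longrightarrow>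
        \<Phi> (pure_tensor sV fs vs) = \<phi> fs vs))"

definition mixed_action :: "(complex \<Rightarrow> 'v::ab_group_add \<Rightarrow> 'v) \<Rightarrow> nat \<Rightarrow> nat \<Rightarrow>
    ('v \<Rightarrow> 'v) \<Rightarrow> 'v mixed \<Rightarrow> 'v mixed" where
  "mixed_action sV m n a = tensor_lift sV m n (\<lambda>fs vs.
     (\<Sum>i<m. pure_tensor sV (fs[i := (\<lambda>x. - (fs ! i) (a x))]) vs) +
     (\<Sum>j<n. pure_tensor sV fs (vs[j := a (vs ! j)])))"

definition delete_nth :: "nat \<Rightarrow> 'a list \<Rightarrow> 'a list" where
  "delete_nth i xs = take i xs @ drop (Suc i) xs"

definition contraction :: "(complex \<Rightarrow> 'v::ab_group_add \<Rightarrow> 'v) \<Rightarrow> nat \<Rightarrow> nat \<Rightarrow>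
    nat \<Rightarrow> nat \<Rightarrow> 'v mixed \<Rightarrow> 'v mixed" where
  "contraction sV m n i j = tensor_lift sV m n (\<lambda>fs vs.
     fscale ((fs ! i) (vs ! j)) (pure_tensor sV (delete_nth i fs) (delete_nth j vs)))"

definition traceless :: "(complex \<Rightarrow> 'v::ab_group_add \<Rightarrow> 'v) \<Rightarrow> nat \<Rightarrow> nat \<Rightarrow> 'v mixed set" where
  "traceless sV m n = {t \<in> mixed_tensors sV m n. \<forall>i<m. \<forall>j<n. contraction sV m n i j t = 0}"


section \<open>Schur functors\<close>

definition is_partition :: "nat list \<Rightarrow> bool" where
  "is_partition lam \<longleftrightarrow> sorted_wrt (\<ge>) lam \<and> 0 \<notin> set lam"

definition boxes :: "nat list \<Rightarrow> (nat \<times> nat) set" where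
  "boxes lam = {(i, j). i < length lam \<and> j < lam ! i}"

text \<open>Young tableaux as bijective numberings of the boxes; the entries are tensor positions and hence
  start from 0.\<close>

definition is_tableau :: "nat list \<Rightarrow> (nat \<times> nat \<Rightarrow> nat) \<Rightarrow> bool" where
  "is_tableau lam T \<longleftrightarrow> bij_betw T (boxes lam) {..<sum_list lam}"

definition row_group :: "nat list \<Rightarrow> (nat \<times> nat \<Rightarrow> nat) \<Rightarrow> (nat \<Rightarrow> nat) set" where
  "row_group lam T = {\<sigma>. \<sigma> permutes {..<sum_list lam} \<and>
     (\<forall>i j. (i, j) \<in> boxes lam \<longrightarrow> (\<exists>j'. (i, j') \<in> boxes lam \<and> \<sigma> (T (i, j)) = T (i, j')))}"

definition column_group :: "nat list \<Rightarrow> (nat \<times> nat \<Rightarrow> nat) \<Rightarrow> (nat \<Rightarrow> nat) set" where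
  "column_group lam T = {\<sigma>. \<sigma> permutes {..<sum_list lam} \<and>
     (\<forall>i j. (i, j) \<in> boxes lam \<longrightarrow> (\<exists>i'. (i', j) \<in> boxes lam \<and> \<sigma> (T (i, j)) = T (i', j)))}"

text \<open>On decomposable tensors this is \<open>u\<^sub>1 \<otimes> \<dots> \<otimes> u\<^sub>n \<mapsto> u\<^bsub>\<sigma>\<inverse>(1)\<^esub> \<otimes> \<dots> \<otimes> u\<^bsub>\<sigma>\<inverse>(n)\<^esub>\<close>, a left action.\<close>

definition permute_tensor :: "(nat \<Rightarrow> nat) \<Rightarrow> ('e list \<Rightarrow> complex) \<Rightarrow> 'e list \<Rightarrow> complex" where
  "permute_tensor \<sigma> t = (\<lambda>es. t (permute_list \<sigma> es))"

definition young_symmetrizer ::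
    "nat list \<Rightarrow> (nat \<times> nat \<Rightarrow> nat) \<Rightarrow> ('e list \<Rightarrow> complex) \<Rightarrow> 'e list \<Rightarrow> complex" where
  "young_symmetrizer lam T t = (\<Sum>\<sigma>\<in>row_group lam T. \<Sum>\<tau>\<in>column_group lam T.
     fscale (of_int (sign \<tau>)) (permute_tensor \<sigma> (permute_tensor \<tau> t)))"

definition schur :: "nat list \<Rightarrow> (nat \<times> nat \<Rightarrow> nat) \<Rightarrow>
    ('u \<Rightarrow> 'e \<Rightarrow> complex) \<Rightarrow> 'e set \<Rightarrow> 'u set \<Rightarrow> ('e list \<Rightarrow> complex) set" where
  "schur lam T ev E U = young_symmetrizer lam T ` tensor_power ev E U (sum_list lam)"


section \<open>The spaces \<open>W\<^bsub>\<lambda>,\<mu>\<^esub>\<close> and their filtration\<close>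

definition W_space :: "(complex \<Rightarrow> 'v::ab_group_add \<Rightarrow> 'v) \<Rightarrow>
    nat list \<Rightarrow> (nat \<times> nat \<Rightarrow> nat) \<Rightarrow> nat list \<Rightarrow> (nat \<times> nat \<Rightarrow> nat) \<Rightarrow> 'v mixed set" where
  "W_space sV lam S mu T =
     fn.span {outer s t | s t. s \<in> schur lam S ev_covector UNIV (alg_dual sV) \<and>
                               t \<in> schur mu T ev_vector (alg_dual sV) UNIV}
     \<inter> traceless sV (sum_list lam) (sum_list mu)"

definition word_tensors :: "(complex \<Rightarrow> 'v::ab_group_add \<Rightarrow> 'v) \<Rightarrow> ('v \<Rightarrow> complex) set \<Rightarrow>
    nat list \<Rightarrow> nat \<Rightarrow> 'v mixed set" where
  "word_tensors sV Vs r n = fn.span {pure_tensor sV fs vs | fs vs. length fs = length r \<and>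
     (\<forall>i<length r. fs ! i \<in> (if r ! i = 0 then Vs else alg_dual sV)) \<and> length vs = n}"

definition W_filtration :: "(complex \<Rightarrow> 'v::ab_group_add \<Rightarrow> 'v) \<Rightarrow> ('v \<Rightarrow> complex) set \<Rightarrow>
    nat list \<Rightarrow> (nat \<times> nat \<Rightarrow> nat) \<Rightarrow> nat list \<Rightarrow> (nat \<times> nat \<Rightarrow> nat) \<Rightarrow> nat \<Rightarrow> 'v mixed set" where
  "W_filtration sV Vs lam S mu T k = W_space sV lam S mu T \<inter>
     fn.span (\<Union>r \<in> {r. length r = sum_list lam \<and> set r \<subseteq> {0, 1} \<and> sum_list r \<le> k}.
       word_tensors sV Vs r (sum_list mu))"


section \<open>Socle filtrations\<close>

text \<open>A module over a set \<open>g\<close> of operators is given by its carrier and operations, so that quotients,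
  whose elements are cosets, are again of this form.\<close>

record ('g, 'x) lmod =
  lm_carrier :: "'x set"
  lm_zero :: 'x
  lm_add :: "'x \<Rightarrow> 'x \<Rightarrow> 'x"
  lm_scale :: "complex \<Rightarrow> 'x \<Rightarrow> 'x"
  lm_act :: "'g \<Rightarrow> 'x \<Rightarrow> 'x"

definition lm_submodule :: "'g set \<Rightarrow> ('g, 'x) lmod \<Rightarrow> 'x set \<Rightarrow> bool" where
  "lm_submodule g M N \<longleftrightarrow> N \<subseteq> lm_carrier M \<and> lm_zero M \<in> N \<and>
     (\<forall>x\<in>N. \<forall>y\<in>N. lm_add M x y \<in> N) \<and>
     (\<forall>c. \<forall>x\<in>N. lm_scale M c x \<in> N) \<and>
     (\<forall>a\<in>g. \<forall>x\<in>N. lm_act M a x \<in> N)"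

definition simple_submodule :: "'g set \<Rightarrow> ('g, 'x) lmod \<Rightarrow> 'x set \<Rightarrow> bool" where
  "simple_submodule g M N \<longleftrightarrow> lm_submodule g M N \<and> N \<noteq> {lm_zero M} \<and>
     (\<forall>N'. lm_submodule g M N' \<and> N' \<subseteq> N \<longrightarrow> N' = {lm_zero M} \<or> N' = N)"

text \<open>The sum of a family of submodules is the smallest submodule containing all of them.\<close>

definition socle :: "'g set \<Rightarrow> ('g, 'x) lmod \<Rightarrow> 'x set" where
  "socle g M = \<Inter> {S. lm_submodule g M S \<and> (\<forall>N. simple_submodule g M N \<longrightarrow> N \<subseteq> S)}"

definition lm_coset :: "('g, 'x) lmod \<Rightarrow> 'x set \<Rightarrow> 'x \<Rightarrow> 'x set" where
  "lm_coset M N x = lm_add M x ` N"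

definition lm_quotient :: "('g, 'x) lmod \<Rightarrow> 'x set \<Rightarrow> ('g, 'x set) lmod" where
  "lm_quotient M N = \<lparr>
     lm_carrier = lm_coset M N ` lm_carrier M,
     lm_zero = lm_coset M N (lm_zero M),
     lm_add = (\<lambda>X Y. \<Union>x\<in>X. \<Union>y\<in>Y. lm_coset M N (lm_add M x y)),
     lm_scale = (\<lambda>c X. \<Union>x\<in>X. lm_coset M N (lm_scale M c x)),
     lm_act = (\<lambda>a X. \<Union>x\<in>X. lm_coset M N (lm_act M a x))\<rparr>"

primrec soc_filtration :: "'g set \<Rightarrow> ('g, 'x) lmod \<Rightarrow> nat \<Rightarrow> 'x set" where
  "soc_filtration g M 0 = socle g M"
| "soc_filtration g M (Suc k) = {x \<in> lm_carrier M.
     lm_coset M (soc_filtration g M k) x \<in> socle g (lm_quotient M (soc_filtration g M k))}"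

definition mixed_module :: "(complex \<Rightarrow> 'v::ab_group_add \<Rightarrow> 'v) \<Rightarrow> nat \<Rightarrow> nat \<Rightarrow>
    'v mixed set \<Rightarrow> ('v \<Rightarrow> 'v, 'v mixed) lmod" where
  "mixed_module sV m n X = \<lparr>lm_carrier = X, lm_zero = 0, lm_add = (+), lm_scale = fscale,
     lm_act = mixed_action sV m n\<rparr>"


section \<open>Universal property of the mixed tensors\<close>

definition multilinear :: "(complex \<Rightarrow> 'u::ab_group_add \<Rightarrow> 'u) \<Rightarrow> 'u set \<Rightarrow>
    (complex \<Rightarrow> 'x::ab_group_add \<Rightarrow> 'x) \<Rightarrow> nat \<Rightarrow> ('u list \<Rightarrow> 'x) \<Rightarrow> bool" where
  "multilinear sU U s n \<psi> \<longleftrightarrow> (\<forall>us i x y c. length us = n \<and> set us \<subseteq> U \<and> i < n \<and> x \<in> U \<and> y \<in> U \<longrightarrow>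
     \<psi> (us[i := x + y]) = \<psi> (us[i := x]) + \<psi> (us[i := y]) \<and>
     \<psi> (us[i := sU c x]) = s c (\<psi> (us[i := x])))"

definition mixed_multilinear :: "(complex \<Rightarrow> 'v::ab_group_add \<Rightarrow> 'v) \<Rightarrow>
    (complex \<Rightarrow> 'x::ab_group_add \<Rightarrow> 'x) \<Rightarrow> nat \<Rightarrow> nat \<Rightarrow>
    (('v \<Rightarrow> complex) list \<Rightarrow> 'v list \<Rightarrow> 'x) \<Rightarrow> bool" where
  "mixed_multilinear sV s m n \<phi> \<longleftrightarrow>
     (\<forall>vs. length vs = n \<longrightarrow> multilinear fscale (alg_dual sV) s m (\<lambda>fs. \<phi> fs vs)) \<and>
     (\<forall>fs. length fs = m \<and> set fs \<subseteq> alg_dual sV \<longrightarrow> multilinear sV UNIV s n (\<phi> fs))"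

lemma multilinearI:
  assumes "\<And>us i x y. length us = n \<Longrightarrow> set us \<subseteq> U \<Longrightarrow> i < n \<Longrightarrow> x \<in> U \<Longrightarrow> y \<in> U \<Longrightarrow>
      \<psi> (us[i := x + y]) = \<psi> (us[i := x]) + \<psi> (us[i := y])"
    and "\<And>us i x c. length us = n \<Longrightarrow> set us \<subseteq> U \<Longrightarrow> i < n \<Longrightarrow> x \<in> U \<Longrightarrow>
      \<psi> (us[i := sU c x]) = s c (\<psi> (us[i := x]))"
  shows "multilinear sU U s n \<psi>"
  using assms unfolding multilinear_def by blast

lemma multilinear_add:
  assumes "multilinear sU U s n \<psi>" "length us = n" "set us \<subseteq> U" "i < n" "x \<in> U" "y \<in> U"
  shows "\<psi> (us[i := x + y]) = \<psi> (us[i := x]) + \<psi> (us[i := y])"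
  using assms unfolding multilinear_def by blast

lemma multilinear_scale:
  assumes "multilinear sU U s n \<psi>" "length us = n" "set us \<subseteq> U" "i < n" "x \<in> U"
  shows "\<psi> (us[i := sU c x]) = s c (\<psi> (us[i := x]))"
  using assms unfolding multilinear_def by blast

lemma multilinear_compose:
  assumes "multilinear sU U s n \<psi>" and "Vector_Spaces.linear s s' \<Phi>"
  shows "multilinear sU U s' n (\<lambda>us. \<Phi> (\<psi> us))"
proof -
  interpret Vector_Spaces.linear s s' \<Phi> by fact
  show ?thesis
    by (rule multilinearI) (simp_all add: multilinear_add[OF assms(1)] multilinear_scale[OF assms(1)] add scale)
qed

lemma multilinear_eqI:
  assumes sU: "vector_space sU" and s: "vector_space s"
    and ml: "multilinear sU U s n \<psi>" "multilinear sU U s n \<chi>"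
    and U: "module.span sU B = U"
    and eq: "\<And>us. length us = n \<Longrightarrow> set us \<subseteq> B \<Longrightarrow> \<psi> us = \<chi> us"
    and us: "length us = n" "set us \<subseteq> U"
  shows "\<psi> us = \<chi> us"
proof -
  interpret U: vector_space sU by fact
  interpret X: vector_space s by fact
  have "\<forall>us. length us = n \<and> set us \<subseteq> U \<and> (\<forall>i. k \<le> i \<and> i < n \<longrightarrow> us ! i \<in> B) \<longrightarrow> \<psi> us = \<chi> us" for k
  proof (induction k)
    case 0
    then show ?case using eq by (metis in_set_conv_nth le0 subsetI)
  next
    case (Suc k)
    show ?case
    proof (intro allI impI, elim conjE)
      fix us
      assume us: "length us = n" "set us \<subseteq> U" and B: "\<forall>i. Suc k \<le> i \<and> i < n \<longrightarrow> us ! i \<in> B"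
      show "\<psi> us = \<chi> us"
      proof (cases "k < n")
        case False
        then show ?thesis using Suc us by auto
      next
        case k: True
        have upd: "length (us[k := x]) = n \<and> set (us[k := x]) \<subseteq> U" if "x \<in> U" for x
          using us that set_update_subset_insert[of us k x] by auto
        have zero: "0 \<in> U" using U U.span_zero by blast
        let ?A = "{x. \<psi> (us[k := x]) = \<chi> (us[k := x]) \<and> x \<in> U}"
        have "U.span B \<subseteq> ?A"
        proof (rule U.span_minimal)
          show "B \<subseteq> ?A"
          proof
            fix x assume x: "x \<in> B"
            then have "x \<in> U" using U U.span_base by blast
            moreover have "(us[k := x]) ! i \<in> B" if "k \<le> i" "i < n" for i
              using that B x us by (cases "i = k") auto
            ultimately show "x \<in> ?A" using Suc upd by auto
          qed
        next
          show "U.subspace ?A"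
          proof (rule U.subspaceI, goal_cases)
            case 1
            have "\<psi> (us[k := sU 0 0]) = \<chi> (us[k := sU 0 0])"
              using multilinear_scale[OF ml(1) us k zero, of 0] multilinear_scale[OF ml(2) us k zero, of 0]
              by simp
            then show ?case using zero by simp
          next
            case (2 x y)
            then show ?case
              using multilinear_add[OF ml(1) us k] multilinear_add[OF ml(2) us k]
                U U.span_add[of x B y] by simp
          next
            case (3 c x)
            then show ?case
              using multilinear_scale[OF ml(1) us k] multilinear_scale[OF ml(2) us k]
                U U.span_scale[of x B c] by simp
          qed
        qed
        moreover have "us ! k \<in> U" using us k by auto
        ultimately have "us ! k \<in> ?A" using U by blast
        then show ?thesis by simp
      qed
    qed
  qed
  note this[of n, THEN spec, THEN mp, of us]
  moreover have "\<forall>i. n \<le> i \<and> i < n \<longrightarrow> us ! i \<in> B" by auto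
  ultimately show ?thesis using us by iprover
qed

lemma multilinear_decomposable:
  assumes "\<And>x y e. x \<in> U \<Longrightarrow> y \<in> U \<Longrightarrow> e \<in> E \<Longrightarrow> ev (x + y) e = ev x e + ev y e"
    and "\<And>c x e. x \<in> U \<Longrightarrow> e \<in> E \<Longrightarrow> ev (sU c x) e = c * ev x e"
  shows "multilinear sU U fscale n (decomposable ev E)"
proof -
  have *: "decomposable ev E (us[i := x]) = (\<lambda>es. if length es = n \<and> set es \<subseteq> E
      then ev x (es ! i) * (\<Prod>j\<in>{..<n} - {i}. ev (us ! j) (es ! j)) else 0)"
    if "length us = n" "i < n" for us i x
  proof -
    have p: "(\<Prod>j<n. ev (us[i := x] ! j) (es ! j)) =
        ev x (es ! i) * (\<Prod>j\<in>{..<n} - {i}. ev (us ! j) (es ! j))" for es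
    proof -
      have "(\<Prod>j<n. ev (us[i := x] ! j) (es ! j)) =
          ev (us[i := x] ! i) (es ! i) * (\<Prod>j\<in>{..<n} - {i}. ev (us[i := x] ! j) (es ! j))"
        by (rule prod.remove) (use that in simp_all)
      also have "(\<Prod>j\<in>{..<n} - {i}. ev (us[i := x] ! j) (es ! j)) =
          (\<Prod>j\<in>{..<n} - {i}. ev (us ! j) (es ! j))"
        by (rule prod.cong) simp_all
      finally show ?thesis using that by simp
    qed
    show ?thesis unfolding decomposable_def length_list_update that(1) p ..
  qed
  show ?thesis
  proof (rule multilinearI)
    fix us i x y
    assume us: "length us = n" "set us \<subseteq> U" "i < n" "x \<in> U" "y \<in> U"
    show "decomposable ev E (us[i := x + y]) =
        decomposable ev E (us[i := x]) + decomposable ev E (us[i := y])"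
    proof
      fix es
      have "es ! i \<in> E" if "length es = n" "set es \<subseteq> E" using that us by auto
      then show "decomposable ev E (us[i := x + y]) es =
          (decomposable ev E (us[i := x]) + decomposable ev E (us[i := y])) es"
        unfolding plus_fun_apply *[OF us(1,3)] by (simp add: assms(1) us distrib_right)
    qed
  next
    fix us i x c
    assume us: "length us = n" "set us \<subseteq> U" "i < n" "x \<in> U"
    show "decomposable ev E (us[i := sU c x]) = fscale c (decomposable ev E (us[i := x]))"
    proof
      fix es
      have "es ! i \<in> E" if "length es = n" "set es \<subseteq> E" using that us by auto
      then show "decomposable ev E (us[i := sU c x]) es =
          fscale c (decomposable ev E (us[i := x])) es"
        unfolding fscale_def *[OF us(1,3)] by (simp add: assms(2) us)
    qed
  qed
qed

lemma alg_dual_iff: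
  assumes "vector_space sV"
  shows "f \<in> alg_dual sV \<longleftrightarrow> (\<forall>x y. f (x + y) = f x + f y) \<and> (\<forall>c x. f (sV c x) = c * f x)"
proof -
  interpret V: vector_space sV by fact
  have "vector_space ((*) :: complex \<Rightarrow> _)" by unfold_locales (auto simp: algebra_simps)
  then show ?thesis
    unfolding alg_dual_def Vector_Spaces.linear_iff using assms by auto
qed

lemma subspace_alg_dual:
  assumes "vector_space sV"
  shows "fn.subspace (alg_dual sV)"
  by (rule fn.subspaceI) (auto simp: alg_dual_iff[OF assms] fscale_def algebra_simps)

lemma outer_add: "outer (s + s') t = outer s t + outer s' t" "outer s (t + t') = outer s t + outer s t'"
  by (auto simp: outer_def fun_eq_iff algebra_simps)

lemma outer_scale: "outer (fscale c s) t = fscale c (outer s t)" "outer s (fscale c t) = fscale c (outer s t)"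
  by (auto simp: outer_def fun_eq_iff fscale_def)

lemma mixed_multilinear_pure_tensor:
  assumes "vector_space sV"
  shows "mixed_multilinear sV fscale m n (pure_tensor sV)"
proof -
  have 1: "multilinear fscale (alg_dual sV) fscale m (decomposable ev_covector UNIV)"
    by (rule multilinear_decomposable) (auto simp: fscale_def)
  have 2: "multilinear sV UNIV fscale n (decomposable ev_vector (alg_dual sV))"
    by (rule multilinear_decomposable) (auto simp: alg_dual_iff[OF assms])
  show ?thesis
    unfolding mixed_multilinear_def pure_tensor_def
    by (intro conjI allI impI multilinearI)
      (simp_all add: multilinear_add[OF 1] multilinear_scale[OF 1]
         multilinear_add[OF 2] multilinear_scale[OF 2] outer_add outer_scale)
qed

lemma dual_vectors:
  assumes V: "vector_space sV" and "finite B" "B \<subseteq> alg_dual sV" "\<not> fn.dependent B"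
  shows "\<exists>x. \<forall>b\<in>B. \<forall>b'\<in>B. b (x b') = (if b = b' then 1 else 0)"
  using assms(2-)
proof (induction B rule: finite_induct)
  case empty
  then show ?case by simp
next
  case (insert b B)
  interpret V: vector_space sV by fact
  note lin = alg_dual_iff[OF V, THEN iffD1]
  have "\<not> fn.dependent B" using insert.prems fn.independent_mono by blast
  with insert obtain x where x: "\<And>c c'. c \<in> B \<Longrightarrow> c' \<in> B \<Longrightarrow> c (x c') = (if c = c' then 1 else 0)"
    by auto
  have neg: "f (- v) = - f v" and diff: "f (v - w) = f v - f w" and zero: "f 0 = 0"
    and sc: "f (sV k v) = k * f v" if "f \<in> alg_dual sV" for f v w k
  proof -
    have a: "Modules.additive f" using lin[OF that] by unfold_locales auto
    show "f (- v) = - f v" "f (v - w) = f v - f w" "f 0 = 0"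
      using additive.minus[OF a] additive.diff[OF a] additive.zero[OF a] by auto
    show "f (sV k v) = k * f v" using lin[OF that] by auto
  qed
  have sm: "f (sum h A) = (\<Sum>a\<in>A. f (h a))" if "f \<in> alg_dual sV" for f h and A :: "('a \<Rightarrow> complex) set"
  proof -
    have a: "Modules.additive f" using lin[OF that] by unfold_locales auto
    show ?thesis by (rule additive.sum[OF a])
  qed
  have bD: "b \<in> alg_dual sV" and BD: "\<And>c. c \<in> B \<Longrightarrow> c \<in> alg_dual sV" using insert.prems by auto
  let ?b0 = "b - (\<Sum>c\<in>B. fscale (b (x c)) c)"
  have "?b0 \<noteq> 0"
  proof
    assume "?b0 = 0"
    then have "b = (\<Sum>c\<in>B. fscale (b (x c)) c)" by simp
    also have "\<dots> \<in> fn.span B" by (intro fn.span_sum fn.span_scale fn.span_base)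
    finally have "b \<in> fn.span (insert b B - {b})" using insert.hyps by simp
    then show False using insert.prems fn.dependent_def by blast
  qed
  then obtain y where "?b0 y \<noteq> 0" by (auto simp: fun_eq_iff)
  moreover have "?b0 y = b y - (\<Sum>c\<in>B. b (x c) * c y)"
  proof -
    have "(\<Sum>c\<in>A. fscale (b (x c)) c) y = (\<Sum>c\<in>A. b (x c) * c y)" if "finite A" for A
      using that by (induction A rule: finite_induct) (auto simp: fscale_def)
    then show ?thesis using insert.hyps by simp
  qed
  ultimately have y: "b y - (\<Sum>c\<in>B. b (x c) * c y) \<noteq> 0" by simp
  define z where "z = y - (\<Sum>c\<in>B. sV (c y) (x c))"
  have bz: "b z \<noteq> 0"
    using y by (simp add: z_def diff[OF bD] sm[OF bD] sc[OF bD] mult.commute)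
  have Bz: "c z = 0" if c: "c \<in> B" for c
  proof -
    have "(\<Sum>d\<in>B. d y * c (x d)) = (\<Sum>d\<in>B. if d = c then c y else 0)"
      by (rule sum.cong) (auto simp: x c)
    then show ?thesis
      using insert.hyps c by (simp add: z_def diff[OF BD] sm[OF BD] sc[OF BD])
  qed
  define x' where "x' = (\<lambda>c. if c = b then sV (1 / b z) z else x c - sV (b (x c) / b z) z)"
  have "c (x' d) = (if c = d then 1 else 0)" if "c \<in> insert b B" "d \<in> insert b B" for c d
  proof (cases "c = b")
    case True
    have "b (x' b) = 1"
      using bz by (simp add: x'_def sc[OF bD])
    moreover have "b (x' d) = 0" if "d \<noteq> b"
      using that bz by (simp add: x'_def diff[OF bD] sc[OF bD])
    ultimately show ?thesis using True by auto
  next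
    case False
    then have c: "c \<in> B" using that by simp
    have "c (x' b) = 0"
      using Bz[OF c] by (simp add: x'_def sc[OF BD[OF c]])
    moreover have "c (x' d) = c (x d)" if "d \<noteq> b"
      using that Bz[OF c] by (simp add: x'_def diff[OF BD[OF c]] sc[OF BD[OF c]])
    ultimately show ?thesis using that(2) False x[OF c, of d] by (cases "d = b") simp_all
  qed
  then show ?case by blast
qed

lemma coordinate_functionals:
  assumes V: "vector_space sV" and C: "\<not> module.dependent sV C"
  shows "\<exists>g. \<forall>c\<in>C. g c \<in> alg_dual sV \<and> (\<forall>d\<in>C. g c d = (if c = d then 1 else 0))"
proof -
  interpret V: vector_space sV by fact
  have vs: "vector_space ((*) :: complex \<Rightarrow> _)" by unfold_locales (auto simp: algebra_simps)
  interpret P: vector_space_pair sV "(*) :: complex \<Rightarrow> _"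
    by (simp add: vector_space_pair_def V vs)
  have "\<exists>f. f \<in> alg_dual sV \<and> (\<forall>d\<in>C. f d = (if c = d then 1 else 0))" for c
    using P.linear_independent_extend[OF C, of "\<lambda>d. if c = d then 1 else 0"]
    by (auto simp: alg_dual_def)
  then have "\<exists>g. \<forall>c. g c \<in> alg_dual sV \<and> (\<forall>d\<in>C. g c d = (if c = d then 1 else 0))"
    by (intro choice allI)
  then show ?thesis by blast
qed

lemma decomposable_dual:
  assumes "\<And>b b'. b \<in> B \<Longrightarrow> b' \<in> B \<Longrightarrow> ev b (e b') = (if b = b' then 1 else 0)"
    and "set bs \<subseteq> B" "set cs \<subseteq> B" "e ` B \<subseteq> E"
  shows "decomposable ev E bs (map e cs) = (if bs = cs then 1 else 0)"
proof (cases "length bs = length cs")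
  case True
  have E: "set (map e cs) \<subseteq> E" using image_mono[OF assms(3), of e] assms(4) by simp
  have *: "ev (bs ! i) (e (cs ! i)) = (if bs ! i = cs ! i then 1 else 0)" if "i < length cs" for i
  proof -
    have "bs ! i \<in> B" "cs ! i \<in> B" using that True assms(2,3) by (metis nth_mem subsetD)+
    then show ?thesis by (rule assms(1))
  qed
  have "(\<Prod>i<length cs. ev (bs ! i) (e (cs ! i))) = (\<Prod>i<length cs. if bs ! i = cs ! i then 1 else 0)"
    by (rule prod.cong) (simp_all add: *)
  also have "\<dots> = (if bs = cs then 1 else 0)"
    using True by (auto simp: list_eq_iff_nth_eq)
  finally show ?thesis using True E by (simp add: decomposable_def)
qed (auto simp: decomposable_def)

lemma pure_tensors_of_basis_independent:
  assumes V: "vector_space sV"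
    and B: "B \<subseteq> alg_dual sV" "\<not> fn.dependent B" and C: "\<not> module.dependent sV C"
  shows "inj_on (\<lambda>(fs, vs). pure_tensor sV fs vs) (lists B \<times> lists C)" (is "inj_on ?p _")
    and "\<not> fn.dependent ((\<lambda>(fs, vs). pure_tensor sV fs vs) ` (lists B \<times> lists C))"
proof -
  have sep: "\<exists>z. \<forall>q\<in>F. ?p q z = (if q = r then 1 else 0)"
    if F: "finite F" "F \<subseteq> lists B \<times> lists C" and r: "r \<in> F" for F r
  proof -
    let ?B0 = "\<Union>(set ` fst ` F)"
    have "finite ?B0" "?B0 \<subseteq> B" using F by auto
    then obtain x where x: "\<And>b b'. b \<in> ?B0 \<Longrightarrow> b' \<in> ?B0 \<Longrightarrow> b (x b') = (if b = b' then 1 else 0)"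
      using dual_vectors[OF V, of ?B0] B fn.independent_mono by (metis (no_types, lifting) subset_trans)
    obtain g where g: "\<And>c. c \<in> C \<Longrightarrow> g c \<in> alg_dual sV"
      "\<And>c d. c \<in> C \<Longrightarrow> d \<in> C \<Longrightarrow> g c d = (if c = d then 1 else 0)"
      using coordinate_functionals[OF V C] by metis
    obtain fs0 vs0 where r0: "r = (fs0, vs0)" by (cases r)
    have "?p q (map x fs0, map g vs0) = (if q = r then 1 else 0)" if q: "q \<in> F" for q
    proof -
      obtain fs vs where q0: "q = (fs, vs)" by (cases q)
      have s: "set fs \<subseteq> ?B0" "set fs0 \<subseteq> ?B0" "set vs \<subseteq> C" "set vs0 \<subseteq> C"
        using q r F unfolding q0 r0 by force+
      have "decomposable ev_covector UNIV fs (map x fs0) = (if fs = fs0 then 1 else 0)"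
        by (rule decomposable_dual[of ?B0]) (use x s in auto)
      moreover have "decomposable ev_vector (alg_dual sV) vs (map g vs0) = (if vs = vs0 then 1 else 0)"
        by (rule decomposable_dual[of C]) (use g s in \<open>auto simp: eq_commute\<close>)
      ultimately show ?thesis unfolding q0 r0 by (simp add: pure_tensor_def outer_def)
    qed
    then show ?thesis by blast
  qed
  show inj: "inj_on ?p (lists B \<times> lists C)"
  proof (rule inj_onI)
    fix q r assume *: "q \<in> lists B \<times> lists C" "r \<in> lists B \<times> lists C" "?p q = ?p r"
    then obtain z where "\<forall>s\<in>{q, r}. ?p s z = (if s = r then 1 else 0)"
      using sep[of "{q, r}" r] by auto
    then show "q = r" using *(3) by (metis insertI1 insertI2 singletonI zero_neq_one)
  qed
  show "\<not> fn.dependent (?p ` (lists B \<times> lists C))"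
  proof
    assume "fn.dependent (?p ` (lists B \<times> lists C))"
    then obtain T u where T: "finite T" "T \<subseteq> ?p ` (lists B \<times> lists C)"
      "(\<Sum>v\<in>T. fscale (u v) v) = 0" "\<exists>v\<in>T. u v \<noteq> 0"
      unfolding fn.dependent_explicit by auto
    then obtain F where F: "F \<subseteq> lists B \<times> lists C" "finite F" "T = ?p ` F"
      using finite_subset_image[OF T(1,2)] by iprover
    obtain r where r: "r \<in> F" "u (?p r) \<noteq> 0" using T(4) unfolding F(3) by (elim bexE imageE) simp
    obtain z where z: "\<And>q. q \<in> F \<Longrightarrow> ?p q z = (if q = r then 1 else 0)"
      using sep[OF F(2,1) r(1)] by blast
    have ev: "(\<Sum>v\<in>A. fscale (u v) v) z = (\<Sum>v\<in>A. u v * v z)" if "finite A" for A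
      using that by (induction A rule: finite_induct) (auto simp: fscale_def)
    have "0 = (\<Sum>v\<in>T. u v * v z)" using ev[OF T(1)] T(3) by simp
    also have "\<dots> = (\<Sum>q\<in>F. u (?p q) * ?p q z)"
      unfolding F(3) sum.reindex[OF inj_on_subset[OF inj F(1)]] comp_def ..
    also have "\<dots> = (\<Sum>q\<in>F. if q = r then u (?p r) else 0)"
      by (rule sum.cong) (auto simp: z)
    also have "\<dots> = u (?p r)" using F r by simp
    finally show False using r by simp
  qed
qed

lemma tensor_universal_property:
  fixes sV :: "complex \<Rightarrow> 'v::ab_group_add \<Rightarrow> 'v" and s :: "complex \<Rightarrow> 'x::ab_group_add \<Rightarrow> 'x"
  assumes V: "vector_space sV" and X: "vector_space s" and \<phi>: "mixed_multilinear sV s m n \<phi>"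
  shows "\<exists>\<Phi>. Vector_Spaces.linear fscale s \<Phi> \<and>
    (\<forall>fs vs. length fs = m \<and> set fs \<subseteq> alg_dual sV \<and> length vs = n \<longrightarrow>
       \<Phi> (pure_tensor sV fs vs) = \<phi> fs vs)"
proof -
  interpret V: vector_space sV by fact
  interpret X: vector_space s by fact
  interpret P: vector_space_pair "fscale :: complex \<Rightarrow> 'v mixed \<Rightarrow> 'v mixed" s by unfold_locales
  obtain B where B: "B \<subseteq> alg_dual sV" "\<not> fn.dependent B" "alg_dual sV \<subseteq> fn.span B"
    using fn.maximal_independent_subset by blast
  have spanB: "fn.span B = alg_dual sV"
    using B fn.span_minimal[OF B(1) subspace_alg_dual[OF V]] by blast
  obtain C where C: "\<not> V.dependent C" "UNIV \<subseteq> V.span C"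
    using V.maximal_independent_subset by blast
  then have spanC: "V.span C = UNIV" by blast
  let ?p = "\<lambda>(fs, vs). pure_tensor sV fs vs" and ?L = "lists B \<times> lists C"
  obtain \<Phi> where lin: "Vector_Spaces.linear fscale s \<Phi>"
    and \<Phi>: "\<forall>t \<in> ?p ` ?L. \<Phi> t = (\<lambda>(fs, vs). \<phi> fs vs) (inv_into ?L ?p t)"
    using P.linear_independent_extend[OF pure_tensors_of_basis_independent(2)[OF V B(1,2) C(1)],
        of "\<lambda>t. (\<lambda>(fs, vs). \<phi> fs vs) (inv_into ?L ?p t)"] by iprover
  interpret \<Phi>: Vector_Spaces.linear fscale s \<Phi> by fact
  have basis: "\<Phi> (pure_tensor sV fs vs) = \<phi> fs vs" if "set fs \<subseteq> B" "set vs \<subseteq> C" for fs vs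
  proof -
    have L: "(fs, vs) \<in> ?L" using that by auto
    show ?thesis
      using bspec[OF \<Phi> imageI[OF L]] inv_into_f_f[OF pure_tensors_of_basis_independent(1)[OF V B(1,2) C(1)] L]
      by simp
  qed
  have "mixed_multilinear sV s m n (\<lambda>fs vs. \<Phi> (pure_tensor sV fs vs))"
    using mixed_multilinear_pure_tensor[OF V, of m n]
    unfolding mixed_multilinear_def by (intro conjI allI impI multilinear_compose[OF _ lin]) blast+
  note ml = this[unfolded mixed_multilinear_def] \<phi>[unfolded mixed_multilinear_def]
  have half: "\<Phi> (pure_tensor sV fs vs) = \<phi> fs vs"
    if fs: "length fs = m" "set fs \<subseteq> B" and vs: "length vs = n" for fs vs
  proof (rule multilinear_eqI[OF V X _ _ spanC])
    have "set fs \<subseteq> alg_dual sV" using fs B by blast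
    then show "multilinear sV UNIV s n (\<lambda>vs. \<Phi> (pure_tensor sV fs vs))" "multilinear sV UNIV s n (\<phi> fs)"
      using ml fs by blast+
  qed (use basis fs vs in auto)
  have "\<Phi> (pure_tensor sV fs vs) = \<phi> fs vs"
    if fs: "length fs = m" "set fs \<subseteq> alg_dual sV" and vs: "length vs = n" for fs vs
  proof (rule multilinear_eqI[OF fn.vector_space_axioms X _ _ spanB, where us = fs])
    show "multilinear fscale (alg_dual sV) s m (\<lambda>fs. \<Phi> (pure_tensor sV fs vs))"
      "multilinear fscale (alg_dual sV) s m (\<lambda>fs. \<phi> fs vs)"
      using ml vs by blast+
  qed (use half fs vs in auto)
  then show ?thesis by (intro exI[of _ \<Phi>] conjI lin) simp
qed

lemma tensor_lift_pure:
  assumes "vector_space sV" and "mixed_multilinear sV fscale m n \<phi>"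
  shows "Vector_Spaces.linear fscale fscale (tensor_lift sV m n \<phi>)"
    and "length fs = m \<Longrightarrow> set fs \<subseteq> alg_dual sV \<Longrightarrow> length vs = n \<Longrightarrow>
      tensor_lift sV m n \<phi> (pure_tensor sV fs vs) = \<phi> fs vs"
proof -
  note * = someI_ex[OF tensor_universal_property[OF assms(1) fn.vector_space_axioms assms(2)],
      folded tensor_lift_def]
  show "Vector_Spaces.linear fscale fscale (tensor_lift sV m n \<phi>)"
    by (rule conjunct1[OF *])
  show "tensor_lift sV m n \<phi> (pure_tensor sV fs vs) = \<phi> fs vs"
    if "length fs = m" "set fs \<subseteq> alg_dual sV" "length vs = n"
    using conjunct2[OF *] that by simp
qed

text \<open>The prescriptions defining \<open>mixed_action\<close> and \<open>contraction\<close> are multilinear, so both maps take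
  the prescribed values.\<close>

lemma multilinear_plus:
  assumes "vector_space s" "multilinear sU U s n \<psi>" "multilinear sU U s n \<chi>"
  shows "multilinear sU U s n (\<lambda>us. \<psi> us + \<chi> us)"
proof -
  interpret vector_space s by fact
  show ?thesis
    by (rule multilinearI) (simp_all add: multilinear_add[OF assms(2)] multilinear_add[OF assms(3)]
        multilinear_scale[OF assms(2)] multilinear_scale[OF assms(3)] scale_right_distrib)
qed

lemma multilinear_sum:
  assumes "vector_space s" "finite A" "\<And>a. a \<in> A \<Longrightarrow> multilinear sU U s n (\<psi> a)"
  shows "multilinear sU U s n (\<lambda>us. \<Sum>a\<in>A. \<psi> a us)"
  using assms(2,3)
proof (induction A rule: finite_induct)
  case empty
  interpret vector_space s by fact
  show ?case by (rule multilinearI) simp_all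
next
  case (insert a A)
  then have "multilinear sU U s n (\<lambda>us. \<psi> a us + (\<Sum>a\<in>A. \<psi> a us))"
    by (intro multilinear_plus[OF assms(1)]) simp_all
  with insert.hyps show ?case by simp
qed

lemma multilinear_apply_nth:
  assumes ml: "multilinear sU U s n \<psi>"
    and D: "\<And>x. x \<in> U \<Longrightarrow> D x \<in> U" "\<And>x y. x \<in> U \<Longrightarrow> y \<in> U \<Longrightarrow> D (x + y) = D x + D y"
      "\<And>c x. x \<in> U \<Longrightarrow> D (sU c x) = sU c (D x)"
    and i: "i < n"
  shows "multilinear sU U s n (\<lambda>us. \<psi> (us[i := D (us ! i)]))"
proof (rule multilinearI)
  fix us k x y
  assume us: "length us = n" "set us \<subseteq> U" and k: "k < n" and x: "x \<in> U" and y: "y \<in> U"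
  have "us ! i \<in> U" using us i by auto
  then have "D (us ! i) \<in> U" by (rule D(1))
  then have us': "length (us[i := D (us ! i)]) = n" "set (us[i := D (us ! i)]) \<subseteq> U"
    using us set_update_subset_insert[of us i "D (us ! i)"] by auto
  show "\<psi> (us[k := x + y, i := D (us[k := x + y] ! i)]) =
      \<psi> (us[k := x, i := D (us[k := x] ! i)]) + \<psi> (us[k := y, i := D (us[k := y] ! i)])"
  proof (cases "k = i")
    case True
    then show ?thesis using multilinear_add[OF ml us i D(1)[OF x] D(1)[OF y]] us i D(2)[OF x y] by simp
  next
    case False
    then show ?thesis
      using multilinear_add[OF ml us' k x y] by (simp add: list_update_swap[of k i])
  qed
next
  fix us k x c
  assume us: "length us = n" "set us \<subseteq> U" and k: "k < n" and x: "x \<in> U"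
  have "us ! i \<in> U" using us i by auto
  then have "D (us ! i) \<in> U" by (rule D(1))
  then have us': "length (us[i := D (us ! i)]) = n" "set (us[i := D (us ! i)]) \<subseteq> U"
    using us set_update_subset_insert[of us i "D (us ! i)"] by auto
  show "\<psi> (us[k := sU c x, i := D (us[k := sU c x] ! i)]) = s c (\<psi> (us[k := x, i := D (us[k := x] ! i)]))"
  proof (cases "k = i")
    case True
    then show ?thesis using multilinear_scale[OF ml us i D(1)[OF x]] us i D(3)[OF x] by simp
  next
    case False
    then show ?thesis
      using multilinear_scale[OF ml us' k x] by (simp add: list_update_swap[of k i])
  qed
qed

lemma length_delete_nth: "i < length xs \<Longrightarrow> length (delete_nth i xs) = length xs - 1"
  by (simp add: delete_nth_def)

lemma delete_nth_update_eq: "i < length xs \<Longrightarrow> delete_nth i (xs[i := x]) = delete_nth i xs"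
  by (simp add: delete_nth_def)

lemma delete_nth_update_neq:
  assumes "i < length xs" "k < length xs" "k \<noteq> i"
  shows "delete_nth i (xs[k := x]) = (delete_nth i xs)[(if k < i then k else k - 1) := x]"
  using assms by (intro nth_equalityI) (auto simp: delete_nth_def nth_append nth_list_update)

lemma multilinear_delete_nth:
  assumes ml: "multilinear sU U fscale (n - 1) \<psi>"
    and e: "\<And>x y. x \<in> U \<Longrightarrow> y \<in> U \<Longrightarrow> e (x + y) = e x + e y" "\<And>c x. x \<in> U \<Longrightarrow> e (sU c x) = c * e x"
    and i: "i < n"
  shows "multilinear sU U fscale n (\<lambda>us. fscale (e (us ! i)) (\<psi> (delete_nth i us)))"
proof -
  have del: "length (delete_nth i us) = n - 1" "set (delete_nth i us) \<subseteq> U"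
    if "length us = n" "set us \<subseteq> U" for us
    using that i set_take_subset[of i us] set_drop_subset[of "Suc i" us]
    by (auto simp: delete_nth_def)
  show ?thesis
  proof (rule multilinearI)
    fix us k x y
    assume us: "length us = n" "set us \<subseteq> U" and k: "k < n" and x: "x \<in> U" and y: "y \<in> U"
    show "fscale (e (us[k := x + y] ! i)) (\<psi> (delete_nth i (us[k := x + y]))) =
        fscale (e (us[k := x] ! i)) (\<psi> (delete_nth i (us[k := x]))) +
        fscale (e (us[k := y] ! i)) (\<psi> (delete_nth i (us[k := y])))"
    proof (cases "k = i")
      case True
      then show ?thesis using us i e(1)[OF x y] by (simp add: delete_nth_update_eq fn.scale_left_distrib)
    next
      case False
      let ?k = "if k < i then k else k - 1"
      have "?k < n - 1" using False i k by auto
      note ml' = multilinear_add[OF ml del[OF us] this x y]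
      have "delete_nth i (us[k := z]) = (delete_nth i us)[?k := z]" for z
        using us i k False by (intro delete_nth_update_neq) simp_all
      then show ?thesis
        using False ml' by (simp add: fn.scale_right_distrib mult.commute del: if_split)
    qed
  next
    fix us k x c
    assume us: "length us = n" "set us \<subseteq> U" and k: "k < n" and x: "x \<in> U"
    show "fscale (e (us[k := sU c x] ! i)) (\<psi> (delete_nth i (us[k := sU c x]))) =
        fscale c (fscale (e (us[k := x] ! i)) (\<psi> (delete_nth i (us[k := x]))))"
    proof (cases "k = i")
      case True
      then show ?thesis using us i e(2)[OF x] by (simp add: delete_nth_update_eq)
    next
      case False
      let ?k = "if k < i then k else k - 1"
      have "?k < n - 1" using False i k by auto
      note ml' = multilinear_scale[OF ml del[OF us] this x]
      have "delete_nth i (us[k := z]) = (delete_nth i us)[?k := z]" for z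
        using us i k False by (intro delete_nth_update_neq) simp_all
      then show ?thesis
        using False ml' by (simp add: fn.scale_right_distrib mult.commute del: if_split)
    qed
  qed
qed

lemma multilinear_pure_tensor:
  assumes "vector_space sV"
  shows "multilinear fscale (alg_dual sV) fscale m (\<lambda>fs. pure_tensor sV fs vs)"
    and "set fs \<subseteq> alg_dual sV \<Longrightarrow> multilinear sV UNIV fscale n (pure_tensor sV fs)"
proof -
  show "multilinear fscale (alg_dual sV) fscale m (\<lambda>fs. pure_tensor sV fs vs)"
    using mixed_multilinear_pure_tensor[OF assms, of m "length vs"]
    unfolding mixed_multilinear_def by blast
  show "multilinear sV UNIV fscale n (pure_tensor sV fs)" if "set fs \<subseteq> alg_dual sV"
    using mixed_multilinear_pure_tensor[OF assms, of "length fs" n] that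
    unfolding mixed_multilinear_def by blast
qed

lemma mixed_action_pure:
  assumes V: "vector_space sV" and a: "Vector_Spaces.linear sV sV a"
    and "length fs = m" "set fs \<subseteq> alg_dual sV" "length vs = n"
  shows "mixed_action sV m n a (pure_tensor sV fs vs) =
    (\<Sum>i<m. pure_tensor sV (fs[i := (\<lambda>x. - (fs ! i) (a x))]) vs) +
    (\<Sum>j<n. pure_tensor sV fs (vs[j := a (vs ! j)]))"
proof -
  interpret a: Vector_Spaces.linear sV sV a by fact
  have closed: "(\<lambda>x. - f (a x)) \<in> alg_dual sV" if "f \<in> alg_dual sV" for f
    using that by (simp add: alg_dual_iff[OF V] a.add a.scale)
  have upd: "set (fs[i := (\<lambda>x. - (fs ! i) (a x))]) \<subseteq> alg_dual sV"
    if "length fs = m" "set fs \<subseteq> alg_dual sV" "i < m" for fs i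
  proof -
    have "fs ! i \<in> alg_dual sV" using that by auto
    then show ?thesis
      using closed that(2) set_update_subset_insert[of fs i "\<lambda>x. - (fs ! i) (a x)"] by blast
  qed
  have "mixed_multilinear sV fscale m n (\<lambda>fs vs.
     (\<Sum>i<m. pure_tensor sV (fs[i := (\<lambda>x. - (fs ! i) (a x))]) vs) +
     (\<Sum>j<n. pure_tensor sV fs (vs[j := a (vs ! j)])))"
    unfolding mixed_multilinear_def
  proof (intro conjI allI impI)
    fix vs :: "'a list"
    show "multilinear fscale (alg_dual sV) fscale m (\<lambda>fs.
       (\<Sum>i<m. pure_tensor sV (fs[i := (\<lambda>x. - (fs ! i) (a x))]) vs) +
       (\<Sum>j<n. pure_tensor sV fs (vs[j := a (vs ! j)])))"
    proof (intro multilinear_plus multilinear_sum fn.vector_space_axioms finite_lessThan)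
      fix i assume "i \<in> {..<m}"
      then show "multilinear fscale (alg_dual sV) fscale m
          (\<lambda>fs. pure_tensor sV (fs[i := (\<lambda>x. - (fs ! i) (a x))]) vs)"
        by (intro multilinear_apply_nth[OF multilinear_pure_tensor(1)[OF V],
              where D = "\<lambda>f x. - f (a x)"] closed) (auto simp: fscale_def)
    qed (rule multilinear_pure_tensor(1)[OF V])
  next
    fix fs assume fs: "length fs = m \<and> set fs \<subseteq> alg_dual sV"
    show "multilinear sV UNIV fscale n (\<lambda>vs.
       (\<Sum>i<m. pure_tensor sV (fs[i := (\<lambda>x. - (fs ! i) (a x))]) vs) +
       (\<Sum>j<n. pure_tensor sV fs (vs[j := a (vs ! j)])))"
    proof (intro multilinear_plus multilinear_sum fn.vector_space_axioms finite_lessThan)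
      fix i assume "i \<in> {..<m}"
      then show "multilinear sV UNIV fscale n (pure_tensor sV (fs[i := (\<lambda>x. - (fs ! i) (a x))]))"
        using upd fs by (intro multilinear_pure_tensor(2)[OF V]) simp
    next
      fix j assume "j \<in> {..<n}"
      then show "multilinear sV UNIV fscale n (\<lambda>vs. pure_tensor sV fs (vs[j := a (vs ! j)]))"
        using fs by (intro multilinear_apply_nth[OF multilinear_pure_tensor(2)[OF V]])
          (simp_all add: a.add a.scale)
    qed
  qed
  from tensor_lift_pure(2)[OF V this assms(3-5)] show ?thesis
    unfolding mixed_action_def .
qed

lemma contraction_pure:
  assumes V: "vector_space sV" and i: "i < m" and j: "j < n"
    and "length fs = m" "set fs \<subseteq> alg_dual sV" "length vs = n"
  shows "contraction sV m n i j (pure_tensor sV fs vs) =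
    fscale ((fs ! i) (vs ! j)) (pure_tensor sV (delete_nth i fs) (delete_nth j vs))"
proof -
  have "mixed_multilinear sV fscale m n (\<lambda>fs vs.
     fscale ((fs ! i) (vs ! j)) (pure_tensor sV (delete_nth i fs) (delete_nth j vs)))"
    unfolding mixed_multilinear_def
  proof (intro conjI allI impI)
    fix vs :: "'a list"
    show "multilinear fscale (alg_dual sV) fscale m (\<lambda>fs.
       fscale ((fs ! i) (vs ! j)) (pure_tensor sV (delete_nth i fs) (delete_nth j vs)))"
      by (rule multilinear_delete_nth[OF multilinear_pure_tensor(1)[OF V],
            where e = "\<lambda>f. f (vs ! j)"]) (simp_all add: fscale_def i)
  next
    fix fs assume fs: "length fs = m \<and> set fs \<subseteq> alg_dual sV"
    then have f: "fs ! i \<in> alg_dual sV" using i by auto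
    have "set (delete_nth i fs) \<subseteq> alg_dual sV"
      using fs set_take_subset[of i fs] set_drop_subset[of "Suc i" fs] by (auto simp: delete_nth_def)
    from multilinear_delete_nth[OF multilinear_pure_tensor(2)[OF V this], where n = n and i = j and e = "fs ! i"]
    show "multilinear sV UNIV fscale n (\<lambda>vs.
       fscale ((fs ! i) (vs ! j)) (pure_tensor sV (delete_nth i fs) (delete_nth j vs)))"
      using f j by (simp add: alg_dual_iff[OF V])
  qed
  from tensor_lift_pure(2)[OF V this assms(4-6)] show ?thesis
    unfolding contraction_def .
qed

end

theory Submission
  imports Defs
begin

text \<open>Choose dual bases \<open>e\<close> of \<open>V\<close> and \<open>d\<close> of \<open>V\<^sub>*\<close>; the Mackey Lie algebra then consists of the matrices with
  finite rows and columns.  Let \<open>T\<^sub>k\<close> be the span of the pure tensors with at most \<open>k\<close> factors outside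
  \<open>V\<^sub>*\<close>.  For every submodule \<open>W\<close> of the traceless tensors, \<open>W \<inter> T\<^sub>k\<close> is the \<open>k\<close>-th step of the socle
  filtration, the Schur functors playing no role.

  The layers are essential: if \<open>t\<close> lies in \<open>T\<^sub>k\<close> but not in \<open>T\<^bsub>k-1\<^esub>\<close>, a suitable rank one operator sends \<open>t\<close>
  to an element of \<open>T\<^bsub>k-1\<^esub>\<close> outside \<open>T\<^bsub>k-2\<^esub>\<close>.

  The layers are semisimple: modulo \<open>T\<^bsub>k-1\<^esub>\<close>, matrix units act on basis words by replacing letters, one
  occurrence at a time, also for letters from a basis of \<open>V\<^sup>*\<close> modulo \<open>V\<^sub>*\<close>.  For a fresh letter \<open>b\<close>,
  replacing each old letter \<open>a\<close> by \<open>b\<close> and back and summing over \<open>a\<close> multiplies a word by its number of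
  old letters, up to a sum of contractions, which vanishes on traceless tensors.  Hence a submodule
  is determined modulo \<open>T\<^bsub>k-1\<^esub>\<close> by its elements that are combinations of the rearrangements of one word
  with pairwise distinct letters.  Their coefficients form an arbitrary subspace stable under the
  finite group relabelling the letters, and Maschke's theorem applies.\<close>

section \<open>Dual bases\<close>

text \<open>A functional outside V_* has infinitely many coordinates, so an operator with finite
  rows can turn it into another one only up to an error in V_*; this is why letters are replaced
  only modulo the next lower filtration step. Vector letters meet another obstacle: the operator
  writing an old letter \<open>e a\<close> back also acts on the functionals that pair with
  \<open>e a\<close>, and these side effects add up to contractions. Tracelessness is used here, for
  vector letters only.

  To recover a tensor no inverse element of the enveloping algebra is built. Each replacement is
  phrased for an arbitrary submodule M containing the lower step: t lies in M as soon as its images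
  under suitable monomials do. Such criteria compose, one fresh letter at a time.

  The rearrangements of a word with distinct letters are indexed by S_m x S_n. Operators commute
  with permutations of the positions, which are right translations of the indices, so on
  coefficients they act by left translations; and since they never move a factor out of V_*, only
  those by S_(m-k) x S_k x S_n occur.\<close>

definition biorthogonal :: "('w \<Rightarrow> 'v \<Rightarrow> complex) \<Rightarrow> ('v \<times> 'w) set \<Rightarrow> bool" where
  "biorthogonal p R \<longleftrightarrow> (\<forall>r\<in>R. \<forall>s\<in>R. p (snd r) (fst s) = (if r = s then 1 else 0))"

text \<open>Lets \<open>biorthogonal_extend\<close>, which captures a vector, capture a covector as
  well: it is applied to the flipped pairing.\<close>

lemma biorthogonal_swap:
  fixes p :: "'w \<Rightarrow> 'v \<Rightarrow> complex"
  shows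
  "biorthogonal (\<lambda>v w. p w v) (prod.swap ` R) \<longleftrightarrow> biorthogonal p R"
proof -
  have "prod.swap r = prod.swap s \<longleftrightarrow> r = s" for r s :: "'v \<times> 'w" by (cases r; cases s) auto
  then show ?thesis unfolding biorthogonal_def ball_simps by (simp; metis)
qed

text \<open>Gram-Schmidt for a pairing. If \<open>x\<close> differs from its projection to the span
  of the old vectors by some \<open>x' \<noteq> 0\<close>, nondegeneracy supplies a partner for
  \<open>x'\<close>, which is then corrected to annihilate the old vectors.\<close>

lemma biorthogonal_extend:
  fixes sV :: "complex \<Rightarrow> 'v::ab_group_add \<Rightarrow> 'v" and sW :: "complex \<Rightarrow> 'w::ab_group_add \<Rightarrow> 'w"
  assumes V: "vector_space sV" and W: "vector_space sW"
    and nd: "nondegenerate_pairing sW sV p"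
    and R: "finite R" "biorthogonal p R"
  shows "\<exists>R'. R \<subseteq> R' \<and> finite R' \<and> biorthogonal p R' \<and> x \<in> module.span sV (fst ` R')"
proof -
  interpret V: vector_space sV by fact
  interpret W: vector_space sW by fact
  have pl: "Vector_Spaces.linear sV (*) (p w)" for w using nd unfolding nondegenerate_pairing_def by blast
  have pr: "Vector_Spaces.linear sW (*) (\<lambda>w. p w v)" for v
    using nd unfolding nondegenerate_pairing_def by blast
  have p1: "p w (v - v') = p w v - p w v'" "p w (sV c v) = c * p w v"
    "p w (sum h A) = (\<Sum>a\<in>A. p w (h a))" for w v v' c and h :: "'v \<times> 'w \<Rightarrow> 'v" and A
  proof -
    interpret l: Vector_Spaces.linear sV "(*)" "p w" by (rule pl)
    show "p w (v - v') = p w v - p w v'" "p w (sV c v) = c * p w v"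
      "p w (sum h A) = (\<Sum>a\<in>A. p w (h a))" by (rule l.diff l.scale l.sum)+
  qed
  have p2: "p (w - w') v = p w v - p w' v" "p (sW c w) v = c * p w v"
    "p (sum h A) v = (\<Sum>a\<in>A. p (h a) v)" for w v w' c and h :: "'v \<times> 'w \<Rightarrow> 'w" and A
  proof -
    interpret l: Vector_Spaces.linear sW "(*)" "\<lambda>w. p w v" by (rule pr)
    show "p (w - w') v = p w v - p w' v" "p (sW c w) v = c * p w v"
      "p (sum h A) v = (\<Sum>a\<in>A. p (h a) v)" by (rule l.diff l.scale l.sum)+
  qed
  define x' where "x' = x - (\<Sum>r\<in>R. sV (p (snd r) x) (fst r))"
  have xs: "(\<Sum>r\<in>R. sV (p (snd r) x) (fst r)) \<in> V.span (fst ` R)"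
    by (intro V.span_sum V.span_scale V.span_base) simp
  show ?thesis
  proof (cases "x' = 0")
    case True
    then have "x \<in> V.span (fst ` R)" using xs by (simp add: x'_def)
    then show ?thesis using R by blast
  next
    case False
    then obtain w0 where w0: "p w0 x' \<noteq> 0" using nd unfolding nondegenerate_pairing_def by blast
    define w1 where "w1 = sW (1 / p w0 x') w0"
    have w1: "p w1 x' = 1" using w0 by (simp add: w1_def p2)
    \<comment> \<open>The correction does not disturb the value at \<open>x'\<close>, because the
      old covectors vanish there.\<close>
    define w' where "w' = w1 - (\<Sum>r\<in>R. sW (p w1 (fst r)) (snd r))"
    have a: "p (snd s) x' = 0" if "s \<in> R" for s
    proof -
      have "(\<Sum>r\<in>R. p (snd r) x * p (snd s) (fst r)) = (\<Sum>r\<in>R. if r = s then p (snd s) x else 0)"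
        by (rule sum.cong) (use R(2) that in \<open>auto simp: biorthogonal_def\<close>)
      then show ?thesis using R(1) that by (simp add: x'_def p1)
    qed
    have b: "p w' (fst s) = 0" if "s \<in> R" for s
    proof -
      have "(\<Sum>r\<in>R. p w1 (fst r) * p (snd r) (fst s)) = (\<Sum>r\<in>R. if r = s then p w1 (fst s) else 0)"
        by (rule sum.cong) (use R(2) that in \<open>auto simp: biorthogonal_def\<close>)
      then show ?thesis using R(1) that by (simp add: w'_def p2)
    qed
    have c: "p w' x' = 1" using a by (simp add: w'_def p2 w1)
    have n: "(x', w') \<notin> R" using a c by fastforce
    have "biorthogonal p (insert (x', w') R)"
      unfolding biorthogonal_def
    proof (intro ballI)
      fix r s assume rs: "r \<in> insert (x', w') R" "s \<in> insert (x', w') R"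
      show "p (snd r) (fst s) = (if r = s then 1 else 0)"
      proof (cases "r \<in> R"; cases "s \<in> R")
        assume "r \<in> R" "s \<in> R"
        then show ?thesis using R(2) unfolding biorthogonal_def by blast
      next
        assume "r \<in> R" "s \<notin> R"
        then show ?thesis using a[of r] rs by auto
      next
        assume "r \<notin> R" "s \<in> R"
        then show ?thesis using b[of s] rs by auto
      next
        assume "r \<notin> R" "s \<notin> R"
        then show ?thesis using c rs by auto
      qed
    qed
    moreover have "x \<in> V.span (fst ` insert (x', w') R)"
    proof -
      have "x = x' + (\<Sum>r\<in>R. sV (p (snd r) x) (fst r))" by (simp add: x'_def)
      moreover have "x' \<in> V.span (fst ` insert (x', w') R)" by (rule V.span_base) simp
      moreover have "V.span (fst ` R) \<subseteq> V.span (fst ` insert (x', w') R)"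
        by (rule V.span_mono[OF image_mono[OF subset_insertI]])
      ultimately show ?thesis using xs V.span_add by (metis subsetD)
    qed
    ultimately show ?thesis
      using R(1) by (intro exI[of _ "insert (x', w') R"] conjI subset_insertI finite.insertI)
  qed
qed

lemma nondegenerate_pairing_flip:
  "nondegenerate_pairing sW sV p \<Longrightarrow> nondegenerate_pairing sV sW (\<lambda>v w. p w v)"
  by (simp add: nondegenerate_pairing_def)

lemma countably_infinite_dim_sequence:
  assumes "countably_infinite_dim s"
  shows "\<exists>x :: nat \<Rightarrow> _. module.span s (range x) = UNIV"
proof -
  obtain B where B: "module.span s B = UNIV" "infinite B" "countable B"
    using assms unfolding countably_infinite_dim_def by blast
  then have "range (from_nat_into B) = B" by (simp add: range_from_nat_into infinite_imp_nonempty)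
  then show ?thesis using B(1) by metis
qed

text \<open>Back and forth: stage \<open>n\<close> captures the \<open>n\<close>-th member of a
  spanning sequence on each side of the pairing, so the vectors and the covectors of the union both
  span.\<close>

lemma dual_bases_exist:
  fixes sV :: "complex \<Rightarrow> 'v::ab_group_add \<Rightarrow> 'v" and sW :: "complex \<Rightarrow> 'w::ab_group_add \<Rightarrow> 'w"
  assumes V: "vector_space sV" and W: "vector_space sW"
    and cV: "countably_infinite_dim sV" and cW: "countably_infinite_dim sW"
    and nd: "nondegenerate_pairing sW sV p"
  obtains e :: "nat \<Rightarrow> 'v" and d :: "nat \<Rightarrow> 'v \<Rightarrow> complex"
  where "\<And>i j. d i (e j) = (if i = j then 1 else 0)" "module.span sV (range e) = UNIV"
    "\<And>i. d i \<in> alg_dual sV" "fn.span (range d) = range p"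
proof -
  interpret V: vector_space sV by fact
  interpret W: vector_space sW by fact
  obtain x where x: "V.span (range (x :: nat \<Rightarrow> _)) = UNIV" using countably_infinite_dim_sequence[OF cV] by blast
  obtain f where f: "W.span (range (f :: nat \<Rightarrow> _)) = UNIV" using countably_infinite_dim_sequence[OF cW] by blast
  have "\<exists>R. \<forall>n. (finite (R n) \<and> biorthogonal p (R n)) \<and>
     (R n \<subseteq> R (Suc n) \<and> x n \<in> V.span (fst ` R (Suc n)) \<and> f n \<in> W.span (snd ` R (Suc n)))"
  proof (rule dependent_nat_choice)
    show "\<exists>R. finite R \<and> biorthogonal p R"
      by (rule exI[of _ "{}"]) (simp add: biorthogonal_def)
  next
    fix R n assume R: "finite R \<and> biorthogonal p R"
    then obtain R1 where R1: "R \<subseteq> R1" "finite R1" "biorthogonal p R1" "x n \<in> V.span (fst ` R1)"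
      using biorthogonal_extend[OF V W nd] by metis
    have "\<exists>R'. prod.swap ` R1 \<subseteq> R' \<and> finite R' \<and> biorthogonal (\<lambda>v w. p w v) R' \<and> f n \<in> W.span (fst ` R')"
      using R1 by (intro biorthogonal_extend[OF W V nondegenerate_pairing_flip[OF nd]])
        (auto simp: biorthogonal_swap)
    then obtain R2 where R2: "prod.swap ` R1 \<subseteq> R2" "finite R2" "biorthogonal (\<lambda>v w. p w v) R2"
      "f n \<in> W.span (fst ` R2)" by blast
    have s: "prod.swap ` prod.swap ` R2 = R2" by (simp add: image_comp)
    have sub: "R1 \<subseteq> prod.swap ` R2" using image_mono[OF R2(1), of prod.swap] by (simp add: image_comp)
    have "biorthogonal p (prod.swap ` R2)" using R2(3) s biorthogonal_swap[of p "prod.swap ` R2"] by simp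
    moreover have "fst ` R2 = snd ` prod.swap ` R2" by (simp add: image_comp comp_def)
    moreover have "V.span (fst ` R1) \<subseteq> V.span (fst ` prod.swap ` R2)"
      by (rule V.span_mono) (use sub in blast)
    ultimately show "\<exists>R'. (finite R' \<and> biorthogonal p R') \<and>
        R \<subseteq> R' \<and> x n \<in> V.span (fst ` R') \<and> f n \<in> W.span (snd ` R')"
      using R1 R2 sub by (intro exI[of _ "prod.swap ` R2"]) auto
  qed
  then obtain R where R: "\<And>n. finite (R n)" "\<And>n. biorthogonal p (R n)" "\<And>n. R n \<subseteq> R (Suc n)"
    "\<And>n. x n \<in> V.span (fst ` R (Suc n))" "\<And>n. f n \<in> W.span (snd ` R (Suc n))" by blast
  have mono: "R n \<subseteq> R n'" if "n \<le> n'" for n n' using lift_Suc_mono_le[of R, OF R(3) that] by simp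
  define U where "U = (\<Union>n. R n)"
  have bU: "biorthogonal p U"
    unfolding biorthogonal_def
  proof (intro ballI)
    fix r s assume "r \<in> U" "s \<in> U"
    then obtain n n' where "r \<in> R n" "s \<in> R n'" unfolding U_def by blast
    then have "r \<in> R (max n n')" "s \<in> R (max n n')" using mono[of n "max n n'"] mono[of n' "max n n'"] by auto
    then show "p (snd r) (fst s) = (if r = s then 1 else 0)" using R(2) unfolding biorthogonal_def by blast
  qed
  have "range x \<subseteq> V.span (fst ` U)"
  proof safe
    fix n show "x n \<in> V.span (fst ` U)"
      using R(4)[of n] V.span_mono[of "fst ` R (Suc n)" "fst ` U"] unfolding U_def by blast
  qed
  then have sV: "V.span (fst ` U) = UNIV" using x V.span_minimal[OF _ V.subspace_span] by blast
  have "range f \<subseteq> W.span (snd ` U)"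
  proof safe
    fix n show "f n \<in> W.span (snd ` U)"
      using R(5)[of n] W.span_mono[of "snd ` R (Suc n)" "snd ` U"] unfolding U_def by blast
  qed
  then have sW: "W.span (snd ` U) = UNIV" using f W.span_minimal[OF _ W.subspace_span] by blast
  have cU: "countable U" unfolding U_def using R(1) by (simp add: countable_finite)
  \<comment> \<open>A countably infinite set of pairs is enumerated by \<open>nat\<close> without
    repetition; the two components become \<open>e\<close> and \<open>d\<close>.\<close>
  have iU: "infinite U"
  proof
    assume "finite U"
    moreover obtain B where "\<not> V.dependent B" "infinite B"
      using cV unfolding countably_infinite_dim_def by blast
    ultimately show False using V.independent_span_bound[of "fst ` U" B] sV by simp
  qed
  define g where "g = from_nat_into U"
  have g: "bij_betw g UNIV U" unfolding g_def by (rule bij_betw_from_nat_into[OF cU iU])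
  then have gU: "range g = U" and gi: "g i = g j \<longleftrightarrow> i = j" for i j
    by (auto simp: bij_betw_def inj_eq)
  have pl: "Vector_Spaces.linear sW fscale p"
  proof (unfold Vector_Spaces.linear_iff, intro conjI allI)
    have pr: "Vector_Spaces.linear sW (*) (\<lambda>w. p w v)" for v
      using nd unfolding nondegenerate_pairing_def by blast
    show "p (w + w') = p w + p w'" for w w'
      using pr unfolding Vector_Spaces.linear_iff by (simp add: fun_eq_iff)
    show "p (sW c w) = fscale c (p w)" for c w
      using pr unfolding Vector_Spaces.linear_iff by (simp add: fun_eq_iff fscale_def)
  qed unfold_locales
  interpret pl: Vector_Spaces.linear sW fscale p by (rule pl)
  show thesis
  proof
    show "p (snd (g i)) (fst (g j)) = (if i = j then 1 else 0)" for i j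
      using bU gU gi unfolding biorthogonal_def by (metis rangeI)
    show "V.span (range (\<lambda>i. fst (g i))) = UNIV" using sV gU by (metis image_image)
    show "p (snd (g i)) \<in> alg_dual sV" for i
      using nd unfolding nondegenerate_pairing_def alg_dual_def by blast
    have "fn.span (range (\<lambda>i. p (snd (g i)))) = fn.span (p ` snd ` U)"
      using gU by (metis image_image)
    also have "\<dots> = p ` W.span (snd ` U)" by (rule pl.span_image)
    finally show "fn.span (range (\<lambda>i. p (snd (g i)))) = range p" using sW by simp
  qed
qed

section \<open>The Mackey Lie algebra in dual bases\<close>

locale dual_bases =
  fixes sV :: "complex \<Rightarrow> 'v::ab_group_add \<Rightarrow> 'v"
    and e :: "nat \<Rightarrow> 'v" and d :: "nat \<Rightarrow> 'v \<Rightarrow> complex"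
  assumes V: "vector_space sV"
    and d_dual: "d i \<in> alg_dual sV"
    and d_e: "d i (e j) = (if i = j then 1 else 0)"
    and span_e: "module.span sV (range e) = UNIV"
begin

sublocale V: vector_space sV by (rule V)

abbreviation "D \<equiv> alg_dual sV"
abbreviation "Vs \<equiv> fn.span (range d)"
abbreviation "g \<equiv> mackey_algebra sV Vs"

lemma dualD:
  assumes "f \<in> D"
  shows "f (x + y) = f x + f y" "f (sV c x) = c * f x" "f 0 = 0" "f (- x) = - f x"
    "f (x - y) = f x - f y" "f (sum h A) = (\<Sum>a\<in>A. f (h a))"
proof -
  interpret f: Vector_Spaces.linear sV "(*)" f using assms by (simp add: alg_dual_def)
  show "f (x + y) = f x + f y" "f (sV c x) = c * f x" "f 0 = 0" "f (- x) = - f x"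
    "f (x - y) = f x - f y" "f (sum h A) = (\<Sum>a\<in>A. f (h a))"
    by (simp_all add: f.add f.scale f.neg f.diff f.sum)
qed

lemma subspace_D: "fn.subspace D"
  by (rule subspace_alg_dual[OF V])

lemma Vs_sub: "Vs \<subseteq> D"
  by (rule fn.span_minimal[OF _ subspace_D]) (use d_dual in auto)

lemma d_in_Vs: "d i \<in> Vs"
  by (rule fn.span_base) simp

lemma inj_d: "d i = d j \<longleftrightarrow> i = j"
  using d_e[of i i] d_e[of j i] by (auto split: if_splits)

lemma inj_e: "e i = e j \<longleftrightarrow> i = j"
  using d_e[of i i] d_e[of i j] by (auto split: if_splits)

lemma independent_e: "\<not> V.dependent (range e)"
proof
  assume "V.dependent (range e)"
  then obtain T u where T: "finite T" "T \<subseteq> range e" "(\<Sum>v\<in>T. sV (u v) v) = 0" "\<exists>v\<in>T. u v \<noteq> 0"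
    unfolding V.dependent_explicit by auto
  then obtain i where i: "e i \<in> T" "u (e i) \<noteq> 0" by blast
  have "0 = d i (\<Sum>v\<in>T. sV (u v) v)" using T(3) by (simp add: dualD[OF d_dual])
  also have "\<dots> = (\<Sum>v\<in>T. u v * d i v)" by (simp add: dualD[OF d_dual])
  also have "\<dots> = (\<Sum>v\<in>T. if v = e i then u (e i) else 0)"
  proof (rule sum.cong)
    fix v assume "v \<in> T"
    then obtain j where "v = e j" using T(2) by blast
    then show "u v * d i v = (if v = e i then u (e i) else 0)" by (simp add: d_e inj_e)
  qed simp
  also have "\<dots> = u (e i)" using T(1) i by simp
  finally show False using i by simp
qed

lemma functional_eqI:
  assumes "f \<in> D" "f' \<in> D" "\<And>i. f (e i) = f' (e i)"
  shows "f = f'"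
proof
  fix v
  have "v \<in> V.span (range e)" using span_e by simp
  then show "f v = f' v"
    by (induction rule: V.span_induct_alt)
      (use assms in \<open>auto simp: dualD[OF assms(1)] dualD[OF assms(2)]\<close>)
qed

lemma functional_exists: "\<exists>f\<in>D. \<forall>i. f (e i) = c i"
proof -
  have vs: "vector_space ((*) :: complex \<Rightarrow> _)" by unfold_locales (auto simp: algebra_simps)
  interpret P: vector_space_pair sV "(*) :: complex \<Rightarrow> _"
    by (simp add: vector_space_pair_def V vs)
  obtain f where "Vector_Spaces.linear sV (*) f" "\<forall>x\<in>range e. f x = c (inv e x)"
    using P.linear_independent_extend[OF independent_e, of "\<lambda>x. c (inv e x)"] by blast
  moreover have "inv e (e i) = i" for i using inj_e by (intro inv_f_f) (simp add: inj_on_def)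
  ultimately show ?thesis by (auto simp: alg_dual_def)
qed

lemma endomorphism_exists: "\<exists>a. Vector_Spaces.linear sV sV a \<and> (\<forall>i. a (e i) = u i)"
proof -
  interpret P: vector_space_pair sV sV
    by (simp add: vector_space_pair_def V)
  obtain f where "Vector_Spaces.linear sV sV f" "\<forall>x\<in>range e. f x = u (inv e x)"
    using P.linear_independent_extend[OF independent_e, of "\<lambda>x. u (inv e x)"] by blast
  moreover have "inv e (e i) = i" for i using inj_e by (intro inv_f_f) (simp add: inj_on_def)
  ultimately show ?thesis by auto
qed

lemma fun_sum_apply: "(\<Sum>a\<in>A. h a) x = (\<Sum>a\<in>A. h a x)" for h :: "'a \<Rightarrow> 'b \<Rightarrow> complex"
  by (induction A rule: infinite_finite_induct) auto

lemma Vs_iff: "f \<in> Vs \<longleftrightarrow> f \<in> D \<and> finite {i. f (e i) \<noteq> 0}"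
proof
  assume f: "f \<in> Vs"
  then have "finite {i. f (e i) \<noteq> 0}"
  proof (induction rule: fn.span_induct_alt)
    case base
    then show ?case by simp
  next
    case (step c x y)
    then obtain j where "x = d j" by blast
    then have "{i. (fscale c x + y) (e i) \<noteq> 0} \<subseteq> insert j {i. y (e i) \<noteq> 0}"
      by (auto simp: fscale_def d_e split: if_splits)
    then show ?case using step(2) finite_subset by blast
  qed
  then show "f \<in> D \<and> finite {i. f (e i) \<noteq> 0}" using f Vs_sub by blast
next
  assume f: "f \<in> D \<and> finite {i. f (e i) \<noteq> 0}"
  let ?I = "{i. f (e i) \<noteq> 0}"
  have s: "(\<Sum>i\<in>?I. fscale (f (e i)) (d i)) \<in> Vs"
    by (intro fn.span_sum fn.span_scale fn.span_base) simp
  have "f = (\<Sum>i\<in>?I. fscale (f (e i)) (d i))"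
  proof (rule functional_eqI)
    fix j
    have "(\<Sum>i\<in>?I. f (e i) * d i (e j)) = (\<Sum>i\<in>?I. if i = j then f (e j) else 0)"
      by (rule sum.cong) (auto simp: d_e)
    also have "\<dots> = f (e j)" using f by simp
    finally show "f (e j) = (\<Sum>i\<in>?I. fscale (f (e i)) (d i)) (e j)"
      by (simp add: fun_sum_apply fscale_def)
  qed (use f s Vs_sub in auto)
  then show "f \<in> Vs" using s by simp
qed

lemma g_linear: "a \<in> g \<Longrightarrow> Vector_Spaces.linear sV sV a"
  and g_Vs: "a \<in> g \<Longrightarrow> f \<in> Vs \<Longrightarrow> f \<circ> a \<in> Vs"
  by (simp_all add: mackey_algebra_def)

lemma dual_comp: "Vector_Spaces.linear sV sV a \<Longrightarrow> f \<in> D \<Longrightarrow> (\<lambda>x. - f (a x)) \<in> D"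
  by (simp add: alg_dual_iff[OF V] Vector_Spaces.linear_iff)

lemma dual_comp': "Vector_Spaces.linear sV sV a \<Longrightarrow> f \<in> D \<Longrightarrow> f \<circ> a \<in> D"
  by (simp add: alg_dual_iff[OF V] Vector_Spaces.linear_iff)

text \<open>The columns are finite automatically, because \<open>a (e j)\<close> is a vector. A
  finite row puts \<open>d i \<circ> a\<close> into \<open>Vs\<close>, and linearity extends this
  from the \<open>d i\<close> to their span.\<close>

lemma gI:
  assumes a: "Vector_Spaces.linear sV sV a" and "\<And>i. finite {j. d i (a (e j)) \<noteq> 0}"
  shows "a \<in> g"
proof -
  have "d i \<circ> a \<in> Vs" for i
    unfolding Vs_iff using assms(2) dual_comp'[OF a d_dual] by simp
  moreover have "fn.subspace {f. f \<circ> a \<in> Vs}"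
  proof (rule fn.subspaceI, goal_cases)
    case 1
    have "(0 :: 'v \<Rightarrow> complex) \<circ> a = 0" by auto
    then show ?case by (simp add: fn.span_zero)
  next
    case (2 x y)
    have "(x + y) \<circ> a = (x \<circ> a) + (y \<circ> a)" by auto
    with 2 show ?case by (simp add: fn.span_add)
  next
    case (3 c x)
    have "fscale c x \<circ> a = fscale c (x \<circ> a)" by (auto simp: fscale_def)
    with 3 show ?case by (simp add: fn.span_scale)
  qed
  ultimately have "Vs \<subseteq> {f. f \<circ> a \<in> Vs}" by (intro fn.span_minimal) auto
  then show ?thesis using a by (auto simp: mackey_algebra_def)
qed

definition rank_one :: "'v \<Rightarrow> nat \<Rightarrow> 'v \<Rightarrow> 'v" where
  "rank_one v b x = sV (d b x) v"

lemma rank_one_in_g: "rank_one v b \<in> g"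
proof (rule gI)
  show "Vector_Spaces.linear sV sV (rank_one v b)"
    unfolding Vector_Spaces.linear_iff rank_one_def
    by (simp add: V dualD[OF d_dual] V.scale_left_distrib)
  show "finite {j. d i (rank_one v b (e j)) \<noteq> 0}" for i
    by (rule finite_subset[of _ "{b}"]) (auto simp: rank_one_def d_e dualD[OF d_dual])
qed

lemma dual_rank_one: "f \<in> D \<Longrightarrow> (\<lambda>x. - f (rank_one v b x)) = fscale (- f v) (d b)"
  by (auto simp: rank_one_def dualD fscale_def)

text \<open>The \<open>f k\<close> are the indicators of the blocks of a partition of the basis
  \<open>e\<close> into infinitely many infinite blocks, so a nontrivial combination has infinite
  support and lies outside \<open>Vs\<close>. \<open>Q\<close> has to be infinite to offer fresh
  letters at every stage.\<close>

lemma exists_independent_mod_Vs: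
  obtains Q where "range d \<inter> Q = {}" "infinite Q" "\<not> fn.dependent (range d \<union> Q)"
    "fn.span (range d \<union> Q) = D"
proof -
  have "\<exists>f\<in>D. \<forall>i. f (e i) = (if fst (prod_decode i) = k then 1 else 0)" for k
    by (rule functional_exists)
  then obtain f where f: "\<And>k. f k \<in> D" "\<And>k i. f k (e i) = (if fst (prod_decode i) = k then 1 else 0)"
    by metis
  have fe: "f k (e (prod_encode (k', j))) = (if k' = k then 1 else 0)" for k k' j by (simp add: f)
  have inj_f: "inj f"
  proof (rule injI)
    fix k k' assume "f k = f k'"
    then show "k = k'" using fe[of k k 0] fe[of k' k 0] by (auto split: if_splits)
  qed
  have disj: "range d \<inter> range f = {}"
  proof (rule ccontr)
    assume "range d \<inter> range f \<noteq> {}"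
    then obtain i k where ik: "d i = f k" by auto
    have "prod_encode (k, 0) = i" "prod_encode (k, 1) = i"
      using fe[of k k 0] fe[of k k 1] d_e[of i "prod_encode (k, 0)"] d_e[of i "prod_encode (k, 1)"]
      unfolding ik by (metis zero_neq_one)+
    then have "prod_encode (k, 0) = prod_encode (k, 1)" by simp
    then show False by (simp add: prod_encode_eq)
  qed
  have indep: "\<not> fn.dependent (range d \<union> range f)"
  proof
    assume "fn.dependent (range d \<union> range f)"
    then obtain T u where T: "finite T" "T \<subseteq> range d \<union> range f" "(\<Sum>v\<in>T. fscale (u v) v) = 0"
      and u: "\<exists>v\<in>T. u v \<noteq> 0"
      unfolding fn.dependent_explicit by auto
    have ev: "(\<Sum>v\<in>T. u v * v x) = 0" for x
      using fun_cong[OF T(3), of x] by (simp add: fun_sum_apply fscale_def)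
    \<comment> \<open>Block \<open>k\<close> is infinite and \<open>T\<close> is finite, so some
      basis vector of this block is annihilated by all members of \<open>T\<close> except
      \<open>f k\<close>.\<close>
    have uf: "u (f k) = 0" if k: "f k \<in> T" for k
    proof -
      have "finite {i. d i \<in> T}" using T(1) finite_vimageI[of T d] inj_d by (simp add: vimage_def inj_on_def)
      then have "finite ((\<lambda>j. prod_encode (k, j)) -` {i. d i \<in> T})"
        by (rule finite_vimageI) (simp add: inj_on_def prod_encode_eq)
      then obtain j where j: "d (prod_encode (k, j)) \<notin> T"
        by (metis (mono_tags, lifting) ex_new_if_finite infinite_UNIV_nat mem_Collect_eq vimage_def)
      have "0 = (\<Sum>v\<in>T. u v * v (e (prod_encode (k, j))))" using ev by simp
      also have "\<dots> = (\<Sum>v\<in>T. if v = f k then u (f k) else 0)"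
      proof (rule sum.cong)
        fix v assume v: "v \<in> T"
        then consider i where "v = d i" | k' where "v = f k'" using T(2) by blast
        then show "u v * v (e (prod_encode (k, j))) = (if v = f k then u (f k) else 0)"
        proof cases
          case 1
          then have "i \<noteq> prod_encode (k, j)" "v \<noteq> f k" using v j disj by auto
          then show ?thesis using 1 by (simp add: d_e)
        next
          case 2
          then show ?thesis using inj_f by (simp add: fe inj_eq)
        qed
      qed simp
      also have "\<dots> = u (f k)" using T(1) k by simp
      finally show ?thesis by simp
    qed
    have "u (d i) = 0" if i: "d i \<in> T" for i
    proof -
      have "0 = (\<Sum>v\<in>T. u v * v (e i))" using ev by simp
      also have "\<dots> = (\<Sum>v\<in>T. if v = d i then u (d i) else 0)"
      proof (rule sum.cong)
        fix v assume v: "v \<in> T"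
        then consider j where "v = d j" | k' where "v = f k'" using T(2) by blast
        then show "u v * v (e i) = (if v = d i then u (d i) else 0)"
        proof cases
          case 1
          then show ?thesis by (simp add: d_e inj_d)
        next
          case 2
          then show ?thesis using uf v disj by auto
        qed
      qed simp
      also have "\<dots> = u (d i)" using T(1) i by simp
      finally show ?thesis by simp
    qed
    then show False using uf u T(2) by blast
  qed
  have sub: "range d \<union> range f \<subseteq> D" using f d_dual by auto
  \<comment> \<open>Any basis of the dual that extends these functionals will do; \<open>Q\<close>
    is what it adds to \<open>range d\<close>, and \<open>range f\<close> keeps it infinite.\<close>
  obtain B where B: "range d \<union> range f \<subseteq> B" "B \<subseteq> D" "\<not> fn.dependent B" "D \<subseteq> fn.span B"
    using fn.maximal_independent_subset_extend[OF sub indep] by blast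
  have "range f \<subseteq> B - range d" using B(1) disj by blast
  then have inf: "infinite (B - range d)"
    using finite_subset range_inj_infinite[OF inj_f] by blast
  have "range d \<union> (B - range d) = B" using B(1) by blast
  moreover have "fn.span B = D" using B fn.span_minimal[OF B(2) subspace_D] by blast
  ultimately show thesis using that[of "B - range d"] inf B(3) by simp
qed

end

section \<open>A basis of the full dual extending the dual basis\<close>

locale mackey_basis = dual_bases +
  fixes Q :: "('a \<Rightarrow> complex) set"
  assumes Q_disj: "range d \<inter> Q = {}" and Q_infinite: "infinite Q"
    and indep_dQ: "\<not> fn.dependent (range d \<union> Q)"
    and span_dQ: "fn.span (range d \<union> Q) = D"
begin

abbreviation "B \<equiv> range d \<union> Q"

lemma B_sub: "B \<subseteq> D"
  by (rule fn.span_superset[of "range d \<union> Q", unfolded span_dQ])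

lemma Q_dual: "\<phi> \<in> Q \<Longrightarrow> \<phi> \<in> D"
  using B_sub by blast

text \<open>Finitely many basis functionals have dual vectors. Including the first \<open>N\<close>
  functionals \<open>d j\<close> among them makes the vectors invisible to these; in
  \<open>Q_replacement\<close> this yields finite rows and leaves letters already in use
  alone.\<close>

lemma dual_system:
  assumes X: "finite X" "X \<subseteq> Q"
  shows "\<exists>u. \<forall>\<phi>\<in>X. (\<forall>\<psi>\<in>X. \<psi> (u \<phi>) = (if \<psi> = \<phi> then 1 else 0)) \<and> (\<forall>j<N. d j (u \<phi>) = 0)"
proof -
  let ?Y = "X \<union> d ` {..<N}"
  have "?Y \<subseteq> B" using X by auto
  moreover have "\<not> fn.dependent ?Y" by (rule fn.independent_mono[OF indep_dQ \<open>?Y \<subseteq> B\<close>])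
  ultimately obtain x where x: "\<forall>b\<in>?Y. \<forall>b'\<in>?Y. b (x b') = (if b = b' then 1 else 0)"
    using dual_vectors[OF V, of ?Y] X(1) B_sub
    by (metis (no_types, lifting) finite_Un finite_imageI finite_lessThan subset_trans)
  show ?thesis
  proof (intro exI[of _ x] ballI conjI allI impI)
    fix \<phi> \<psi> assume "\<phi> \<in> X" "\<psi> \<in> X" then show "\<psi> (x \<phi>) = (if \<psi> = \<phi> then 1 else 0)" using x by simp
  next
    fix \<phi> j assume \<phi>: "\<phi> \<in> X" and j: "j < N"
    then have "d j \<noteq> \<phi>" using X Q_disj by blast
    then show "d j (x \<phi>) = 0" using x[THEN bspec, THEN bspec, of "d j" \<phi>] \<phi> j by simp
  qed
qed

lemma Q_not_Vs: "\<phi> \<in> Q \<Longrightarrow> \<phi> \<notin> Vs"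
proof
  assume \<phi>: "\<phi> \<in> Q" "\<phi> \<in> Vs"
  then have "\<phi> \<in> fn.span (B - {\<phi>})" using fn.span_mono[of "range d" "B - {\<phi>}"] Q_disj by blast
  then show False using indep_dQ \<phi> unfolding fn.dependent_def by blast
qed

text \<open>The endomorphism maps \<open>e i\<close> to a multiple of a vector \<open>u i\<close> whose coordinates below \<open>i\<close> vanish, so that
  its matrix has finite rows although \<open>\<chi>\<close> is arbitrary.\<close>

lemma Q_replacement:
  assumes X: "finite X" "X \<subseteq> Q" and \<phi>: "\<phi> \<in> X" and \<chi>: "\<chi> \<in> D"
  shows "\<exists>a\<in>g. (\<lambda>x. - \<phi> (a x)) - \<chi> \<in> Vs \<and> (\<forall>\<psi>\<in>X - {\<phi>}. \<forall>x. \<psi> (a x) = 0) \<and>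
     (\<forall>j<N. \<forall>x. d j (a x) = 0) \<and> (\<forall>j<N. a (e j) = 0)"
proof -
  have "\<exists>u. (\<forall>\<psi>\<in>X. \<psi> u = (if \<psi> = \<phi> then 1 else 0)) \<and> (\<forall>j<max N i. d j u = 0)" for i
    using dual_system[OF X, of "max N i"] \<phi> by meson
  then obtain u where u: "\<And>i \<psi>. \<psi> \<in> X \<Longrightarrow> \<psi> (u i) = (if \<psi> = \<phi> then 1 else 0)"
    "\<And>i j. j < max N i \<Longrightarrow> d j (u i) = 0" by metis
  obtain a where a: "Vector_Spaces.linear sV sV a"
    "\<And>i. a (e i) = (if i < N then 0 else sV (- \<chi> (e i)) (u i))"
    using endomorphism_exists[of "\<lambda>i. if i < N then 0 else sV (- \<chi> (e i)) (u i)"] by blast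
  have ag: "a \<in> g"
  proof (rule gI[OF a(1)])
    fix i
    have "{j. d i (a (e j)) \<noteq> 0} \<subseteq> {..i}"
    proof
      fix j assume "j \<in> {j. d i (a (e j)) \<noteq> 0}"
      then have "d i (u j) \<noteq> 0" by (auto simp: a dualD[OF d_dual] split: if_splits)
      then show "j \<in> {..i}" using u(2)[of i j] by (cases "i < j") auto
    qed
    then show "finite {j. d i (a (e j)) \<noteq> 0}" by (rule finite_subset) simp
  qed
  have XD: "\<psi> \<in> D" if "\<psi> \<in> X" for \<psi> using that X Q_dual by blast
  \<comment> \<open>Sending the first \<open>N\<close> basis vectors to zero spoils the agreement
    with \<chi> there, but an error in finitely many coordinates belongs to
    \<open>Vs\<close>.\<close>
  have 1: "(\<lambda>x. - \<phi> (a x)) - \<chi> \<in> Vs"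
    unfolding Vs_iff
  proof
    show "(\<lambda>x. - \<phi> (a x)) - \<chi> \<in> D"
      using fn.subspace_diff[OF subspace_D dual_comp[OF a(1) XD[OF \<phi>]] \<chi>] .
    show "finite {i. ((\<lambda>x. - \<phi> (a x)) - \<chi>) (e i) \<noteq> 0}"
      by (rule finite_subset[of _ "{..<N}"]) (auto simp: a u \<phi> dualD[OF XD[OF \<phi>]] split: if_splits)
  qed
  have zero: "f (a x) = 0" if f: "f \<in> D" "\<And>i. f (a (e i)) = 0" for f x
  proof -
    have "f \<circ> a = 0"
      by (rule functional_eqI[OF dual_comp'[OF a(1) f(1)] fn.subspace_0[OF subspace_D]]) (simp add: f)
    then show ?thesis by (metis comp_apply zero_fun_apply)
  qed
  have 2: "\<psi> (a x) = 0" if "\<psi> \<in> X - {\<phi>}" for \<psi> x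
    by (rule zero) (use that in \<open>auto simp: XD a dualD[OF XD] u\<close>)
  have 3: "d j (a x) = 0" if "j < N" for j x
    by (rule zero) (use that in \<open>auto simp: d_dual a dualD[OF d_dual] u\<close>)
  show ?thesis
    using ag 1 2 3 a(2) by (intro bexI[of _ a]) auto
qed

end

section \<open>Mixed tensors\<close>

text \<open>Isolated because it gives, through \<open>tensor_lift_pure\<close>, the linearity of
  \<open>mixed_action\<close>; \<open>mixed_action_pure\<close> records only the values on pure
  tensors.\<close>

lemma mixed_multilinear_action:
  assumes V: "vector_space sV" and a: "Vector_Spaces.linear sV sV a"
  shows "mixed_multilinear sV fscale m n (\<lambda>fs vs.
     (\<Sum>i<m. pure_tensor sV (fs[i := (\<lambda>x. - (fs ! i) (a x))]) vs) +
     (\<Sum>j<n. pure_tensor sV fs (vs[j := a (vs ! j)])))"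
proof -
  interpret a: Vector_Spaces.linear sV sV a by fact
  have closed: "(\<lambda>x. - f (a x)) \<in> alg_dual sV" if "f \<in> alg_dual sV" for f
    using that by (simp add: alg_dual_iff[OF V] a.add a.scale)
  have upd: "set (fs[i := (\<lambda>x. - (fs ! i) (a x))]) \<subseteq> alg_dual sV"
    if "length fs = m" "set fs \<subseteq> alg_dual sV" "i < m" for fs i
  proof -
    have "fs ! i \<in> alg_dual sV" using that by auto
    then show ?thesis
      using closed that(2) set_update_subset_insert[of fs i "\<lambda>x. - (fs ! i) (a x)"] by blast
  qed
  show ?thesis
    unfolding mixed_multilinear_def
  proof (intro conjI allI impI)
    fix vs :: "'a list"
    show "multilinear fscale (alg_dual sV) fscale m (\<lambda>fs.
       (\<Sum>i<m. pure_tensor sV (fs[i := (\<lambda>x. - (fs ! i) (a x))]) vs) +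
       (\<Sum>j<n. pure_tensor sV fs (vs[j := a (vs ! j)])))"
    proof (intro multilinear_plus multilinear_sum fn.vector_space_axioms finite_lessThan)
      fix i assume "i \<in> {..<m}"
      then show "multilinear fscale (alg_dual sV) fscale m
          (\<lambda>fs. pure_tensor sV (fs[i := (\<lambda>x. - (fs ! i) (a x))]) vs)"
        by (intro multilinear_apply_nth[OF multilinear_pure_tensor(1)[OF V],
              where D = "\<lambda>f x. - f (a x)"] closed) (auto simp: fscale_def)
    qed (rule multilinear_pure_tensor(1)[OF V])
  next
    fix fs assume fs: "length fs = m \<and> set fs \<subseteq> alg_dual sV"
    show "multilinear sV UNIV fscale n (\<lambda>vs.
       (\<Sum>i<m. pure_tensor sV (fs[i := (\<lambda>x. - (fs ! i) (a x))]) vs) +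
       (\<Sum>j<n. pure_tensor sV fs (vs[j := a (vs ! j)])))"
    proof (intro multilinear_plus multilinear_sum fn.vector_space_axioms finite_lessThan)
      fix i assume "i \<in> {..<m}"
      then show "multilinear sV UNIV fscale n (pure_tensor sV (fs[i := (\<lambda>x. - (fs ! i) (a x))]))"
        using upd fs by (intro multilinear_pure_tensor(2)[OF V]) simp
    next
      fix j assume "j \<in> {..<n}"
      then show "multilinear sV UNIV fscale n (\<lambda>vs. pure_tensor sV fs (vs[j := a (vs ! j)]))"
        using fs by (intro multilinear_apply_nth[OF multilinear_pure_tensor(2)[OF V]])
          (simp_all add: a.add a.scale)
    qed
  qed
qed

lemma mixed_multilinear_contraction:
  assumes V: "vector_space sV" and i: "i < m" and j: "j < n"
  shows "mixed_multilinear sV fscale m n (\<lambda>fs vs.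
     fscale ((fs ! i) (vs ! j)) (pure_tensor sV (delete_nth i fs) (delete_nth j vs)))"
  unfolding mixed_multilinear_def
  proof (intro conjI allI impI)
  fix vs :: "'a list"
  show "multilinear fscale (alg_dual sV) fscale m (\<lambda>fs.
     fscale ((fs ! i) (vs ! j)) (pure_tensor sV (delete_nth i fs) (delete_nth j vs)))"
    by (rule multilinear_delete_nth[OF multilinear_pure_tensor(1)[OF V],
          where e = "\<lambda>f. f (vs ! j)"]) (simp_all add: fscale_def i)
  next
  fix fs assume fs: "length fs = m \<and> set fs \<subseteq> alg_dual sV"
  then have f: "fs ! i \<in> alg_dual sV" using i by auto
  have "set (delete_nth i fs) \<subseteq> alg_dual sV"
    using fs set_take_subset[of i fs] set_drop_subset[of "Suc i" fs] by (auto simp: delete_nth_def)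
  from multilinear_delete_nth[OF multilinear_pure_tensor(2)[OF V this], where n = n and i = j and e = "fs ! i"]
  show "multilinear sV UNIV fscale n (\<lambda>vs.
     fscale ((fs ! i) (vs ! j)) (pure_tensor sV (delete_nth i fs) (delete_nth j vs)))"
    using f j by (simp add: alg_dual_iff[OF V])
  qed

lemma linear_mixed_action:
  assumes "vector_space sV" "Vector_Spaces.linear sV sV a"
  shows "Vector_Spaces.linear fscale fscale (mixed_action sV m n a)"
  unfolding mixed_action_def
  by (rule tensor_lift_pure(1)[OF assms(1) mixed_multilinear_action[OF assms]])

lemma linear_contraction:
  assumes "vector_space sV" "i < m" "j < n"
  shows "Vector_Spaces.linear fscale fscale (contraction sV m n i j)"
  unfolding contraction_def
  by (rule tensor_lift_pure(1)[OF assms(1) mixed_multilinear_contraction[OF assms]])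

text \<open>Each position has its own spanning set, since \<open>pt_expand\<close> must expand a
  factor from \<open>Vs\<close> in \<open>range d\<close> alone. The induction opens up the
  positions one by one: those below \<open>k\<close> range over the span, the others over the
  spanning set.\<close>

lemma multilinear_span:
  assumes sU: "vector_space sU" and s: "vector_space s"
    and ml: "multilinear sU U s n \<psi>" and U: "module.subspace sU U"
    and S: "\<And>i. i < n \<Longrightarrow> S i \<subseteq> U"
    and us: "length us = n" "\<And>i. i < n \<Longrightarrow> us ! i \<in> module.span sU (S i)"
  shows "\<psi> us \<in> module.span s (\<psi> ` {bs. length bs = n \<and> (\<forall>i<n. bs ! i \<in> S i)})"
proof -
  interpret U: vector_space sU by fact
  interpret X: vector_space s by fact
  let ?R = "X.span (\<psi> ` {bs. length bs = n \<and> (\<forall>i<n. bs ! i \<in> S i)})"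
  have SU: "U.span (S i) \<subseteq> U" if "i < n" for i
    by (rule U.span_minimal[OF S[OF that] U])
  have "\<forall>us. length us = n \<and> (\<forall>i<n. us ! i \<in> U.span (S i)) \<and> (\<forall>i. k \<le> i \<and> i < n \<longrightarrow> us ! i \<in> S i) \<longrightarrow>
     \<psi> us \<in> ?R" for k
  proof (induction k)
    case 0
    show ?case by (intro allI impI X.span_base) auto
  next
    case (Suc k)
    show ?case
    proof (intro allI impI, elim conjE)
      fix us
      assume us: "length us = n" "\<forall>i<n. us ! i \<in> U.span (S i)"
        and B: "\<forall>i. Suc k \<le> i \<and> i < n \<longrightarrow> us ! i \<in> S i"
      show "\<psi> us \<in> ?R"
      proof (cases "k < n")
        case False
        then show ?thesis using Suc us by auto
      next
        case k: True
        have usU: "set us \<subseteq> U" using us SU by (auto simp: in_set_conv_nth) blast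
        let ?A = "{x \<in> U. \<psi> (us[k := x]) \<in> ?R}"
        have "U.span (S k) \<subseteq> ?A"
        proof (rule U.span_minimal)
          show "S k \<subseteq> ?A"
          proof
            fix x assume x: "x \<in> S k"
            have "(us[k := x]) ! i \<in> S i" if "k \<le> i" "i < n" for i
              using that B x us by (cases "i = k") auto
            moreover have "(us[k := x]) ! i \<in> U.span (S i)" if "i < n" for i
              using that x us U.span_base by (cases "i = k") auto
            ultimately show "x \<in> ?A" using Suc us x S[OF k] by auto
          qed
        next
          show "U.subspace ?A"
          proof (rule U.subspaceI, goal_cases)
            case 1
            have zero: "0 \<in> U" by (rule U.subspace_0[OF U])
            have "\<psi> (us[k := sU 0 0]) = 0"
              using multilinear_scale[OF ml us(1) usU k zero, of 0] by simp
            then show ?case using zero X.span_zero by simp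
          next
            case (2 x y)
            then show ?case
              using multilinear_add[OF ml us(1) usU k] X.span_add U.subspace_add[OF U] by simp
          next
            case (3 c x)
            then show ?case
              using multilinear_scale[OF ml us(1) usU k] X.span_scale U.subspace_scale[OF U] by simp
          qed
        qed
        then have "us ! k \<in> ?A" using us k by blast
        then show ?thesis by simp
      qed
    qed
  qed
  from this[of 0] this[of n] us show ?thesis by auto
qed

lemma (in module) span_finite_subset:
  assumes "x \<in> span S"
  shows "\<exists>F. finite F \<and> F \<subseteq> S \<and> x \<in> span F"
  using assms
proof (induction rule: span_induct_alt)
  case base
  then show ?case by (intro exI[of _ "{}"]) (simp add: span_zero)
next
  case (step c x y)
  then obtain F where F: "finite F" "F \<subseteq> S" "y \<in> span F" by blast
  then have "c *s x + y \<in> span (insert x F)"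
    by (meson insertI1 span_add span_base span_mono span_scale subsetD subset_insertI)
  then show ?case using F step(1) by (intro exI[of _ "insert x F"]) auto
qed

locale mackey_tensors = mackey_basis +
  fixes m n :: nat
begin

abbreviation "pt \<equiv> pure_tensor sV"
abbreviation "Mix \<equiv> mixed_tensors sV m n"
abbreviation "act \<equiv> mixed_action sV m n"

definition lists_of :: "('a \<Rightarrow> complex) list \<Rightarrow> 'a list \<Rightarrow> bool" where
  "lists_of fs vs \<longleftrightarrow> length fs = m \<and> set fs \<subseteq> D \<and> length vs = n"

lemma Mix_eq: "Mix = fn.span {pt fs vs | fs vs. lists_of fs vs}"
  by (simp add: mixed_tensors_def lists_of_def)

lemma act_linear: "a \<in> g \<Longrightarrow> Vector_Spaces.linear fscale fscale (act a)"
  by (rule linear_mixed_action[OF V g_linear])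

lemma act_simps:
  assumes "a \<in> g"
  shows "act a (x + y) = act a x + act a y" "act a (fscale c x) = fscale c (act a x)" "act a 0 = 0"
    "act a (x - y) = act a x - act a y" "act a (sum h A) = (\<Sum>i\<in>A. act a (h i))"
proof -
  interpret l: Vector_Spaces.linear fscale fscale "act a" by (rule act_linear[OF assms])
  show "act a (x + y) = act a x + act a y" "act a (fscale c x) = fscale c (act a x)" "act a 0 = 0"
    "act a (x - y) = act a x - act a y" "act a (sum h A) = (\<Sum>i\<in>A. act a (h i))"
    by (rule l.add l.scale l.zero l.diff l.sum)+
qed

lemma act_pure:
  assumes "a \<in> g" "lists_of fs vs"
  shows "act a (pt fs vs) = (\<Sum>i<m. pt (fs[i := (\<lambda>x. - (fs ! i) (a x))]) vs) +
    (\<Sum>j<n. pt fs (vs[j := a (vs ! j)]))"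
  using mixed_action_pure[OF V g_linear[OF assms(1)]] assms(2) by (simp add: lists_of_def)

lemma pt_add1: "lists_of fs vs \<Longrightarrow> i < m \<Longrightarrow> f \<in> D \<Longrightarrow> f' \<in> D \<Longrightarrow>
    pt (fs[i := f + f']) vs = pt (fs[i := f]) vs + pt (fs[i := f']) vs"
  using multilinear_add[OF multilinear_pure_tensor(1)[OF V, where m = m and vs = vs]] by (simp add: lists_of_def)

lemma pt_scale1: "lists_of fs vs \<Longrightarrow> i < m \<Longrightarrow> f \<in> D \<Longrightarrow>
    pt (fs[i := fscale c f]) vs = fscale c (pt (fs[i := f]) vs)"
  using multilinear_scale[OF multilinear_pure_tensor(1)[OF V, where m = m and vs = vs]] by (simp add: lists_of_def)

lemma pt_scale2: "lists_of fs vs \<Longrightarrow> j < n \<Longrightarrow>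
    pt fs (vs[j := sV c v]) = fscale c (pt fs (vs[j := v]))"
  using multilinear_scale[OF multilinear_pure_tensor(2)[OF V, where n = n and fs = fs]] by (simp add: lists_of_def)

lemma pt_zero1: "lists_of fs vs \<Longrightarrow> i < m \<Longrightarrow> pt (fs[i := 0]) vs = 0"
  using pt_scale1[of fs vs i 0 0] fn.subspace_0[OF subspace_D] by simp

lemma pt_zero2: "lists_of fs vs \<Longrightarrow> j < n \<Longrightarrow> pt fs (vs[j := 0]) = 0"
  using pt_scale2[of fs vs j 0 0] by simp

lemma lists_of_upd1: "lists_of fs vs \<Longrightarrow> f \<in> D \<Longrightarrow> lists_of (fs[i := f]) vs"
  unfolding lists_of_def using set_update_subset_insert[of fs i f] by auto

lemma lists_of_upd2: "lists_of fs vs \<Longrightarrow> lists_of fs (vs[j := v])"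
  by (simp add: lists_of_def)

lemma lists_of_nth: "lists_of fs vs \<Longrightarrow> i < m \<Longrightarrow> fs ! i \<in> D"
  unfolding lists_of_def by auto

subsection \<open>The filtration\<close>

definition nq :: "('a \<Rightarrow> complex) list \<Rightarrow> nat" where
  "nq fs = card {i. i < length fs \<and> fs ! i \<notin> Vs}"

text \<open>The inequality is strict, so that \<open>Tlt 0\<close> is the zero space below the first layer.\<close>

definition Tlt :: "nat \<Rightarrow> 'a mixed set" where
  "Tlt k = fn.span {pt fs vs | fs vs. lists_of fs vs \<and> nq fs < k}"

lemma subspace_Tlt: "fn.subspace (Tlt k)"
  by (simp add: Tlt_def)

lemma Tlt_base: "lists_of fs vs \<Longrightarrow> nq fs < k \<Longrightarrow> pt fs vs \<in> Tlt k"
  unfolding Tlt_def by (rule fn.span_base) blast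

lemma Tlt_mono: "k \<le> l \<Longrightarrow> Tlt k \<subseteq> Tlt l"
  unfolding Tlt_def by (rule fn.span_mono) fastforce

lemma Tlt_0: "Tlt 0 = {0}"
  by (simp add: Tlt_def)

lemma nq_le: "nq fs \<le> length fs"
proof -
  have "nq fs \<le> card {..<length fs}" unfolding nq_def by (rule card_mono) auto
  then show ?thesis by simp
qed

lemma Tlt_Suc_m: "Tlt (Suc m) = Mix"
proof -
  have "nq fs < Suc m" if "lists_of fs vs" for fs vs using nq_le[of fs] that by (simp add: lists_of_def)
  then show ?thesis unfolding Tlt_def Mix_eq by metis
qed

lemma nq_upd_le: "f \<in> Vs \<or> fs ! i \<notin> Vs \<Longrightarrow> nq (fs[i := f]) \<le> nq fs"
  unfolding nq_def by (rule card_mono; cases "i < length fs") (auto simp: nth_list_update split: if_splits)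

lemma nq_upd_less:
  assumes "f \<in> Vs" "fs ! i \<notin> Vs" "i < length fs"
  shows "nq (fs[i := f]) < nq fs"
  unfolding nq_def
proof (rule psubset_card_mono)
  show "{j. j < length (fs[i := f]) \<and> fs[i := f] ! j \<notin> Vs} \<subset> {i. i < length fs \<and> fs ! i \<notin> Vs}"
    using assms by (auto simp: nth_list_update split: if_splits)
qed simp

text \<open>An operator changes one factor at a time and keeps factors from \<open>Vs\<close> inside
  \<open>Vs\<close>. The predicate is left open for two uses: a bound on the degree in
  \<open>Tlt_act\<close>, and prescribed positions for \<open>Vs\<close> in
  \<open>cy_acts\<close>.\<close>

lemma span_pure_act:
  assumes P: "\<And>fs vs i f. lists_of fs vs \<Longrightarrow> P fs \<Longrightarrow> i < m \<Longrightarrow> f \<in> Vs \<or> fs ! i \<notin> Vs \<Longrightarrow> P (fs[i := f])"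
    and a: "a \<in> g" and t: "t \<in> fn.span {pt fs vs |fs vs. lists_of fs vs \<and> P fs}"
  shows "act a t \<in> fn.span {pt fs vs |fs vs. lists_of fs vs \<and> P fs}"
  using t
proof (induction rule: fn.span_induct_alt)
  case base
  show ?case unfolding act_simps[OF a] by (rule fn.span_zero)
next
  case (step c x y)
  let ?S = "{pt fs vs |fs vs. lists_of fs vs \<and> P fs}"
  obtain fs vs where x: "x = pt fs vs" and w: "lists_of fs vs" "P fs" using step(1) by blast
  have base: "pt fs' vs' \<in> fn.span ?S" if "lists_of fs' vs'" "P fs'" for fs' vs'
    using that by (intro fn.span_base) blast
  have "pt (fs[i := (\<lambda>x. - (fs ! i) (a x))]) vs \<in> fn.span ?S" if i: "i < m" for i
  proof (rule base)
    show "lists_of (fs[i := (\<lambda>x. - (fs ! i) (a x))]) vs"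
      by (rule lists_of_upd1[OF w(1) dual_comp[OF g_linear[OF a] lists_of_nth[OF w(1) i]]])
    have "(\<lambda>x. - (fs ! i) (a x)) \<in> Vs" if "fs ! i \<in> Vs"
    proof -
      have "(\<lambda>x. - (fs ! i) (a x)) = - ((fs ! i) \<circ> a)" by auto
      then show ?thesis using fn.span_neg[OF g_Vs[OF a that]] by simp
    qed
    then show "P (fs[i := (\<lambda>x. - (fs ! i) (a x))])" by (intro P[OF w i]) blast
  qed
  moreover have "pt fs (vs[j := a (vs ! j)]) \<in> fn.span ?S" for j
    by (rule base[OF lists_of_upd2[OF w(1)] w(2)])
  ultimately have "act a (pt fs vs) \<in> fn.span ?S"
    unfolding act_pure[OF a w(1)] by (intro fn.span_add fn.span_sum) auto
  then show ?case unfolding act_simps[OF a] x by (intro fn.span_add fn.span_scale step(2))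
qed

lemma Tlt_act: "a \<in> g \<Longrightarrow> t \<in> Tlt k \<Longrightarrow> act a t \<in> Tlt k"
  unfolding Tlt_def by (erule span_pure_act[rotated]) (use nq_upd_le le_less_trans in blast)+

lemma Tlt_upd:
  assumes "lists_of fs vs" "nq fs \<le> k" "i < m" "fs ! i \<notin> Vs" "f \<in> Vs"
  shows "pt (fs[i := f]) vs \<in> Tlt k"
proof (rule Tlt_base)
  show "lists_of (fs[i := f]) vs" using assms Vs_sub by (intro lists_of_upd1) auto
  show "nq (fs[i := f]) < k"
    using nq_upd_less[OF assms(5,4)] assms by (simp add: lists_of_def)
qed

text \<open>The error term has a factor from \<open>Vs\<close> at a position that was outside
  \<open>Vs\<close>, so its degree drops. This is what makes replacement up to an error in
  \<open>Vs\<close> good enough.\<close>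

lemma Tlt_cong:
  assumes "lists_of fs vs" "nq fs \<le> k" "i < m" "fs ! i \<notin> Vs" "f \<in> D" "f' \<in> D" "f - f' \<in> Vs"
  shows "pt (fs[i := f]) vs - pt (fs[i := f']) vs \<in> Tlt k"
proof -
  have "pt (fs[i := f' + (f - f')]) vs = pt (fs[i := f']) vs + pt (fs[i := f - f']) vs"
    by (rule pt_add1) (use assms Vs_sub in auto)
  then have "pt (fs[i := f]) vs - pt (fs[i := f']) vs = pt (fs[i := f - f']) vs" by simp
  then show ?thesis using Tlt_upd[OF assms(1-4,7)] by simp
qed

subsection \<open>Basis words and coordinates\<close>

definition words :: "(('a \<Rightarrow> complex) list \<times> 'a list) set" where
  "words = {(bs, cs). length bs = m \<and> set bs \<subseteq> B \<and> length cs = n \<and> set cs \<subseteq> range e}"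

abbreviation "ptw w \<equiv> pt (fst w) (snd w)"

lemma words_lists_of: "w \<in> words \<Longrightarrow> lists_of (fst w) (snd w)"
  using subset_trans[OF _ B_sub, of "set (fst w)"] by (auto simp: words_def lists_of_def)

text \<open>Keeping the expansion of a factor from \<open>Vs\<close> inside \<open>range d\<close>
  prevents the degree from growing; hence \<open>Tlt k\<close> is spanned by basis words.\<close>

lemma pt_expand:
  assumes w: "lists_of fs vs"
  shows "pt fs vs \<in> fn.span (ptw ` {w \<in> words. \<forall>i<m. fs ! i \<in> Vs \<longrightarrow> fst w ! i \<in> range d})"
proof -
  let ?S = "\<lambda>i. if fs ! i \<in> Vs then range d else B"
  let ?F = "{bs. length bs = m \<and> (\<forall>i<m. bs ! i \<in> ?S i)}" and ?C = "{cs. length cs = n \<and> (\<forall>i<n. cs ! i \<in> range e)}"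
  let ?W = "{w \<in> words. \<forall>i<m. fs ! i \<in> Vs \<longrightarrow> fst w ! i \<in> range d}"
  have 1: "pt fs vs \<in> fn.span ((\<lambda>fs. pt fs vs) ` ?F)"
  proof (rule multilinear_span[OF fn.vector_space_axioms fn.vector_space_axioms
        multilinear_pure_tensor(1)[OF V] subspace_D])
    fix i assume "i < m"
    then show "?S i \<subseteq> D" "fs ! i \<in> fn.span (?S i)"
      using B_sub d_dual lists_of_nth[OF w(1)] by (auto simp: span_dQ)
  qed (use w in \<open>simp add: lists_of_def\<close>)
  have 2: "pt bs vs \<in> fn.span (ptw ` ?W)" if bs: "bs \<in> ?F" for bs
  proof -
    have sB: "set bs \<subseteq> B" using bs by (auto simp: in_set_conv_nth split: if_splits)
    have "pt bs vs \<in> fn.span (pt bs ` ?C)"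
    proof (rule multilinear_span[OF V fn.vector_space_axioms
          multilinear_pure_tensor(2)[OF V] V.subspace_UNIV])
      show "set bs \<subseteq> D" by (rule subset_trans[OF sB B_sub])
    qed (use w in \<open>auto simp: lists_of_def span_e\<close>)
    also have "\<dots> \<subseteq> fn.span (ptw ` ?W)"
    proof (rule fn.span_mono, rule image_subsetI)
      fix cs :: "'a list" assume cs: "cs \<in> ?C"
      then have "set cs \<subseteq> range e" by (auto simp: in_set_conv_nth)
      then have "(bs, cs) \<in> ?W" using sB bs cs unfolding words_def by auto
      then show "pt bs cs \<in> ptw ` ?W" by (force intro: image_eqI[of _ _ "(bs, cs)"])
    qed
    finally show ?thesis .
  qed
  have "fn.span ((\<lambda>fs. pt fs vs) ` ?F) \<subseteq> fn.span (ptw ` ?W)"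
    by (rule fn.span_minimal) (use 2 in auto)
  then show ?thesis using 1 by blast
qed

lemma Tlt_words: "Tlt k = fn.span (ptw ` {w \<in> words. nq (fst w) < k})"
proof
  show "fn.span (ptw ` {w \<in> words. nq (fst w) < k}) \<subseteq> Tlt k"
    unfolding Tlt_def by (rule fn.span_mono) (use words_lists_of in blast)
  show "Tlt k \<subseteq> fn.span (ptw ` {w \<in> words. nq (fst w) < k})"
    unfolding Tlt_def
  proof (rule fn.span_minimal; (intro fn.subspace_span subsetI)?)
    fix t assume "t \<in> {pt fs vs |fs vs. lists_of fs vs \<and> nq fs < k}"
    then obtain fs vs where t: "t = pt fs vs" and w: "lists_of fs vs" "nq fs < k" by blast
    have "nq (fst w') \<le> nq fs"
      if w': "w' \<in> {w \<in> words. \<forall>i<m. fs ! i \<in> Vs \<longrightarrow> fst w ! i \<in> range d}" for w'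
    proof -
      have "{i. i < length (fst w') \<and> fst w' ! i \<notin> Vs} \<subseteq> {i. i < length fs \<and> fs ! i \<notin> Vs}"
        using w' w(1) d_in_Vs by (auto simp: words_def lists_of_def)
      then show ?thesis unfolding nq_def by (intro card_mono) auto
    qed
    then have "{w \<in> words. \<forall>i<m. fs ! i \<in> Vs \<longrightarrow> fst w ! i \<in> range d} \<subseteq> {w \<in> words. nq (fst w) < k}"
      using w(2) by fastforce
    then show "t \<in> fn.span (ptw ` {w \<in> words. nq (fst w) < k})"
      unfolding t using pt_expand[OF w(1)] fn.span_mono[OF image_mono] by blast
  qed
qed

lemma coordinate_map_exists:
  "\<exists>c. Vector_Spaces.linear fscale fscale c \<and>
     (\<forall>w\<in>words. c (ptw w) = (\<lambda>w'. if w' = w then 1 else (0 :: complex)))"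
proof -
  interpret P: vector_space_pair "fscale :: complex \<Rightarrow> 'a mixed \<Rightarrow> 'a mixed"
    "fscale :: complex \<Rightarrow> (('a \<Rightarrow> complex) list \<times> 'a list \<Rightarrow> complex) \<Rightarrow> _" by unfold_locales
  let ?L = "lists B \<times> lists (range e)"
  note inj = pure_tensors_of_basis_independent(1)[OF V B_sub indep_dQ independent_e]
  have sub: "words \<subseteq> ?L" by (auto simp: words_def)
  obtain c where c: "Vector_Spaces.linear fscale fscale c"
    "\<forall>t\<in>(\<lambda>(fs, vs). pt fs vs) ` ?L. c t =
       (\<lambda>w'. if w' = inv_into ?L (\<lambda>(fs, vs). pt fs vs) t then 1 else 0)"
    using P.linear_independent_extend[OF pure_tensors_of_basis_independent(2)[OF V B_sub indep_dQ independent_e],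
       of "\<lambda>t. (\<lambda>w'. if w' = inv_into ?L (\<lambda>(fs, vs). pt fs vs) t then 1 else 0)"] by iprover
  have "c (ptw w) = (\<lambda>w'. if w' = w then 1 else 0)" if w: "w \<in> words" for w
  proof -
    have L: "w \<in> ?L" using w sub by blast
    have "ptw w = (\<lambda>(fs, vs). pt fs vs) w" by (simp add: case_prod_beta)
    then show ?thesis using bspec[OF c(2) imageI[OF L]] inv_into_f_f[OF inj L] by simp
  qed
  then show ?thesis using c(1) by blast
qed

text \<open>Coordinates with respect to the basis words. Outside \<open>Mix\<close> the values come
  from an arbitrary linear extension.\<close>

definition crd :: "'a mixed \<Rightarrow> ('a \<Rightarrow> complex) list \<times> 'a list \<Rightarrow> complex" where
  "crd = (SOME c. Vector_Spaces.linear fscale fscale c \<and>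
     (\<forall>w\<in>words. c (ptw w) = (\<lambda>w'. if w' = w then 1 else 0)))"

lemma crd_linear: "Vector_Spaces.linear fscale fscale crd"
  and crd_word: "w \<in> words \<Longrightarrow> crd (ptw w) = (\<lambda>w'. if w' = w then 1 else 0)"
  using someI_ex[OF coordinate_map_exists, folded crd_def] by auto

lemma crd_simps:
  "crd (x + y) w = crd x w + crd y w" "crd (fscale c x) w = c * crd x w" "crd 0 w = 0"
    "crd (x - y) w = crd x w - crd y w" "crd (sum h A) w = (\<Sum>i\<in>A. crd (h i) w)" "crd (- x) w = - crd x w"
proof -
  interpret l: Vector_Spaces.linear fscale fscale crd by (rule crd_linear)
  show "crd (x + y) w = crd x w + crd y w" "crd (fscale c x) w = c * crd x w" "crd 0 w = 0"
    "crd (x - y) w = crd x w - crd y w" "crd (sum h A) w = (\<Sum>i\<in>A. crd (h i) w)" "crd (- x) w = - crd x w"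
    by (simp_all add: l.add l.scale l.zero l.diff l.sum l.neg fun_sum_apply) (simp add: fscale_def)
qed

lemma crd_expand:
  assumes "finite \<Omega>" "\<Omega> \<subseteq> words" "t \<in> fn.span (ptw ` \<Omega>)"
  shows "t = (\<Sum>w\<in>\<Omega>. fscale (crd t w) (ptw w))"
  using assms(3)
proof (induction rule: fn.span_induct_alt)
  case base
  show ?case by (simp only: crd_simps fn.scale_zero_left sum.neutral_const)
next
  case (step c x y)
  then obtain w where w: "w \<in> \<Omega>" "x = ptw w" by blast
  then have "w \<in> words" using assms by blast
  then have "(\<Sum>w'\<in>\<Omega>. fscale (crd x w') (ptw w')) = (\<Sum>w'\<in>\<Omega>. if w' = w then x else 0)"
    by (intro sum.cong) (auto simp: w crd_word)
  also have "\<dots> = x" using w assms(1) by simp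
  finally have x: "(\<Sum>w'\<in>\<Omega>. fscale (crd x w') (ptw w')) = x" .
  have "(\<Sum>w'\<in>\<Omega>. fscale (crd (fscale c x + y) w') (ptw w')) =
      fscale c (\<Sum>w'\<in>\<Omega>. fscale (crd x w') (ptw w')) + (\<Sum>w'\<in>\<Omega>. fscale (crd y w') (ptw w'))"
    by (simp add: crd_simps fn.scale_sum_right fn.scale_left_distrib sum.distrib)
  then show ?case unfolding x using step(2) by (simp only: )
qed

lemma Tlt_finite_words:
  assumes "t \<in> Tlt k"
  obtains \<Omega> where "finite \<Omega>" "\<Omega> \<subseteq> {w \<in> words. nq (fst w) < k}" "t \<in> fn.span (ptw ` \<Omega>)"
proof -
  obtain F where F: "finite F" "F \<subseteq> ptw ` {w \<in> words. nq (fst w) < k}" "t \<in> fn.span F"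
    using fn.span_finite_subset assms[unfolded Tlt_words] by blast
  then obtain \<Omega> where "finite \<Omega>" "\<Omega> \<subseteq> {w \<in> words. nq (fst w) < k}" "F = ptw ` \<Omega>"
    using finite_subset_image[OF F(1,2)] by blast
  then show thesis using that F by blast
qed

lemma crd_Tlt:
  assumes "t \<in> Tlt k" "\<not> nq (fst w) < k"
  shows "crd t w = 0"
  using assms(1)[unfolded Tlt_words]
proof (induction rule: fn.span_induct_alt)
  case base
  show ?case by (simp only: crd_simps)
next
  case (step c x y)
  then obtain w' where w': "w' \<in> words" "nq (fst w') < k" "x = ptw w'" by blast
  then have "crd x w = 0" using assms(2) by (auto simp: crd_word)
  then show ?case unfolding crd_simps using step(2) by simp
qed

text \<open>Converse of \<open>crd_Tlt\<close>: if all coordinates at words of degree at least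
  \<open>k\<close> vanish, the basis expansion of \<open>t\<close> consists of words in
  \<open>Tlt k\<close>.\<close>

lemma crd_nonzero:
  assumes "t \<in> Mix" "t \<notin> Tlt k"
  obtains w where "w \<in> words" "crd t w \<noteq> 0" "k \<le> nq (fst w)"
proof (rule ccontr)
  assume *: "\<not> thesis"
  note obt = that
  have "t \<in> Tlt (Suc m)" using assms(1) by (simp add: Tlt_Suc_m)
  then obtain \<Omega> where \<Omega>: "finite \<Omega>" "\<Omega> \<subseteq> {w \<in> words. nq (fst w) < Suc m}" "t \<in> fn.span (ptw ` \<Omega>)"
    by (rule Tlt_finite_words)
  then have \<Omega>w: "\<Omega> \<subseteq> words" by auto
  have "fscale (crd t w) (ptw w) \<in> Tlt k" if w: "w \<in> \<Omega>" for w
  proof (cases "crd t w = 0")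
    case True
    then show ?thesis using fn.subspace_0[OF subspace_Tlt] by simp
  next
    case False
    then have "\<not> k \<le> nq (fst w)" using * obt[OF subsetD[OF \<Omega>w w]] by iprover
    then have "nq (fst w) < k" by simp
    then show ?thesis
      using w \<Omega>(2) words_lists_of by (intro fn.subspace_scale[OF subspace_Tlt] Tlt_base) auto
  qed
  then have "(\<Sum>w\<in>\<Omega>. fscale (crd t w) (ptw w)) \<in> Tlt k" by (rule fn.subspace_sum[OF subspace_Tlt])
  then have "t \<in> Tlt k" using crd_expand[OF \<Omega>(1) \<Omega>w \<Omega>(3)] by simp
  then show False using assms by blast
qed

lemma crd_support:
  assumes "crd t w \<noteq> 0" "t \<in> fn.span (ptw ` \<Omega>)" "\<Omega> \<subseteq> words"
  shows "w \<in> \<Omega>"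
proof (rule ccontr)
  assume w: "w \<notin> \<Omega>"
  have "crd t w = 0"
    using assms(2)
  proof (induction rule: fn.span_induct_alt)
    case base
    show ?case by (simp only: crd_simps)
  next
    case (step c x y)
    then obtain w' where w': "w' \<in> \<Omega>" "x = ptw w'" by blast
    then have "crd x w = 0" using w assms(3) crd_word[of w'] by auto
    then show ?case unfolding crd_simps using step(2) by simp
  qed
  then show False using assms(1) by simp
qed

end

lemma prod_delete_nth:
  assumes "i < length us" "length es = length us"
  shows "(\<Prod>k<length us - 1. ev (delete_nth i us ! k) (delete_nth i es ! k)) =
    (\<Prod>k\<in>{..<length us} - {i}. ev (us ! k) (es ! k))"
  by (rule prod.reindex_bij_witness[of _ "\<lambda>k. if k < i then k else k - 1" "\<lambda>k. if k < i then k else Suc k"])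
    (use assms in \<open>auto simp: delete_nth_def nth_append min_def split: if_splits\<close>)

lemma prod_list_update:
  assumes "i < length us"
  shows "(\<Prod>k<length us. ev (us[i := u] ! k) (es ! k)) =
    ev u (es ! i) * (\<Prod>k\<in>{..<length us} - {i}. ev (us ! k) (es ! k))"
proof -
  have "(\<Prod>k<length us. ev (us[i := u] ! k) (es ! k)) =
      ev (us[i := u] ! i) (es ! i) * (\<Prod>k\<in>{..<length us} - {i}. ev (us[i := u] ! k) (es ! k))"
    by (rule prod.remove) (use assms in auto)
  also have "(\<Prod>k\<in>{..<length us} - {i}. ev (us[i := u] ! k) (es ! k)) =
      (\<Prod>k\<in>{..<length us} - {i}. ev (us ! k) (es ! k))"
    by (rule prod.cong) auto
  finally show ?thesis using assms by simp
qed

lemma set_delete_nth: "set (delete_nth i xs) \<subseteq> set xs"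
  unfolding delete_nth_def using set_take_subset[of i xs] set_drop_subset[of "Suc i" xs] by auto

lemma permute_list_update:
  assumes "\<rho> permutes {..<length xs}" "k < length xs"
  shows "permute_list \<rho> (xs[k := x]) = (permute_list \<rho> xs)[inv \<rho> k := x]"
proof (rule nth_equalityI)
  fix i assume i: "i < length (permute_list \<rho> (xs[k := x]))"
  then have ri: "\<rho> i < length xs" using permutes_in_image[OF assms(1), of i] by simp
  have "inv \<rho> k = i \<longleftrightarrow> k = \<rho> i" using permutes_inverses[OF assms(1)] by metis
  then show "permute_list \<rho> (xs[k := x]) ! i = (permute_list \<rho> xs)[inv \<rho> k := x] ! i"
    using i ri assms by (auto simp: permute_list_nth nth_list_update)
qed simp

lemma permute_tensor_decomposable:
  assumes "\<sigma> permutes {..<length us}"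
  shows "permute_tensor \<sigma> (decomposable ev E us) = decomposable ev E (permute_list (inv \<sigma>) us)"
proof
  fix es
  show "permute_tensor \<sigma> (decomposable ev E us) es = decomposable ev E (permute_list (inv \<sigma>) us) es"
  proof (cases "length es = length us")
    case True
    then have s: "set (permute_list \<sigma> es) = set es" using assms by (intro set_permute_list) simp
    have "(\<Prod>i<length us. ev (us ! i) (es ! \<sigma> i)) =
        (\<Prod>i<length us. ev (us ! inv \<sigma> i) (es ! \<sigma> (inv \<sigma> i)))"
      using prod.permute[OF permutes_inv[OF assms], of "\<lambda>i. ev (us ! i) (es ! \<sigma> i)"] by (simp add: comp_def)
    moreover have "permute_list \<sigma> es ! i = es ! \<sigma> i" if "i < length us" for i
      using that True by (simp add: permute_list_def)
    moreover have "permute_list (inv \<sigma>) us ! i = us ! inv \<sigma> i" if "i < length us" for i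
      using that by (simp add: permute_list_def)
    ultimately show ?thesis
      using True s permutes_inverses[OF assms] by (simp add: permute_tensor_def decomposable_def)
  qed (simp add: permute_tensor_def decomposable_def)
qed

section \<open>Contractions as operators on mixed tensors\<close>

context mackey_tensors
begin

abbreviation "Tl \<equiv> traceless sV m n"

lemma contraction_simps:
  assumes "i < m" "j < n"
  shows "contraction sV m n i j (x + y) = contraction sV m n i j x + contraction sV m n i j y"
    "contraction sV m n i j (fscale c x) = fscale c (contraction sV m n i j x)"
    "contraction sV m n i j 0 = 0"
proof -
  interpret l: Vector_Spaces.linear fscale fscale "contraction sV m n i j" by (rule linear_contraction[OF V assms])
  show "contraction sV m n i j (x + y) = contraction sV m n i j x + contraction sV m n i j y"
    "contraction sV m n i j (fscale c x) = fscale c (contraction sV m n i j x)"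
    "contraction sV m n i j 0 = 0"
    by (rule l.add l.scale l.zero)+
qed

text \<open>Contraction followed by the insertion of \<open>h\<close> and \<open>w\<close> in the two vacated positions; unlike the
  contraction it does not change the number of tensor factors.\<close>

definition kop :: "('a \<Rightarrow> complex) \<Rightarrow> 'a \<Rightarrow> nat \<Rightarrow> nat \<Rightarrow> 'a mixed \<Rightarrow> 'a mixed" where
  "kop h w i j t = (\<lambda>(xs, gs). if length xs = m \<and> length gs = n \<and> set gs \<subseteq> D
     then h (xs ! i) * (gs ! j) w * contraction sV m n i j t (delete_nth i xs, delete_nth j gs) else 0)"

lemma kop_simps:
  assumes "i < m" "j < n"
  shows "kop h w i j (x + y) = kop h w i j x + kop h w i j y"
    "kop h w i j (fscale c x) = fscale c (kop h w i j x)" "kop h w i j 0 = 0"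
    "kop h w i j (sum f A) = (\<Sum>a\<in>A. kop h w i j (f a))"
proof -
  show 1: "kop h w i j (x + y) = kop h w i j x + kop h w i j y" for x y
    unfolding kop_def contraction_simps[OF assms] by (rule ext) (auto simp: algebra_simps)
  show "kop h w i j (fscale c x) = fscale c (kop h w i j x)"
    unfolding kop_def contraction_simps[OF assms] by (rule ext) (auto simp: fscale_def)
  show 0: "kop h w i j 0 = 0"
    unfolding kop_def contraction_simps[OF assms] by (rule ext) auto
  show "kop h w i j (sum f A) = (\<Sum>a\<in>A. kop h w i j (f a))"
    by (induction A rule: infinite_finite_induct) (simp_all only: 0 1 sum.infinite sum.empty sum.insert not_False_eq_True)
qed

lemma kop_pure:
  assumes w: "lists_of fs vs" and i: "i < m" and j: "j < n"
  shows "kop h w i j (pt fs vs) = fscale ((fs ! i) (vs ! j)) (pt (fs[i := h]) (vs[j := w]))"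
proof
  fix z :: "'a list \<times> ('a \<Rightarrow> complex) list"
  obtain xs gs where z: "z = (xs, gs)" by (cases z)
  have l: "length fs = m" "length vs = n" "set fs \<subseteq> D" using w by (auto simp: lists_of_def)
  show "kop h w i j (pt fs vs) z = fscale ((fs ! i) (vs ! j)) (pt (fs[i := h]) (vs[j := w])) z"
  proof (cases "length xs = m \<and> length gs = n \<and> set gs \<subseteq> D")
    case False
    then show ?thesis
      unfolding z kop_def using l by (auto simp: pure_tensor_def outer_def decomposable_def fscale_def)
  next
    case True
    have dl: "length (delete_nth i fs) = m - 1" "length (delete_nth j vs) = n - 1"
      "length (delete_nth i xs) = m - 1" "length (delete_nth j gs) = n - 1"
      using i j l True by (simp_all add: length_delete_nth)
    have sD: "set (delete_nth j gs) \<subseteq> D" using subset_trans[OF set_delete_nth[of j gs]] True by simp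
    have 1: "(\<Prod>k<m - 1. (delete_nth i fs ! k) (delete_nth i xs ! k)) = (\<Prod>k\<in>{..<m} - {i}. (fs ! k) (xs ! k))"
      using prod_delete_nth[of i fs xs "\<lambda>f x. f x"] i l True by simp
    have 2: "(\<Prod>k<n - 1. (delete_nth j gs ! k) (delete_nth j vs ! k)) = (\<Prod>k\<in>{..<n} - {j}. (gs ! k) (vs ! k))"
      using prod_delete_nth[of j vs gs "\<lambda>f x. x f"] j l True by simp
    have 3: "(\<Prod>k<m. (fs[i := h] ! k) (xs ! k)) = h (xs ! i) * (\<Prod>k\<in>{..<m} - {i}. (fs ! k) (xs ! k))"
      using prod_list_update[of i fs "\<lambda>f x. f x"] i l by simp
    have 4: "(\<Prod>k<n. (gs ! k) (vs[j := w] ! k)) = (gs ! j) w * (\<Prod>k\<in>{..<n} - {j}. (gs ! k) (vs ! k))"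
      using prod_list_update[of j vs "\<lambda>f x. x f"] j l by simp
    show ?thesis
      unfolding z kop_def contraction_pure[OF V i j l(1,3,2)]
      using True dl sD l
      by (simp add: pure_tensor_def outer_def decomposable_def fscale_def 1[simplified] 2[simplified] 3 4)
  qed
qed

lemma Tl_Mix: "t \<in> Tl \<Longrightarrow> t \<in> Mix"
  by (simp add: traceless_def)

lemma kop_traceless: "t \<in> Tl \<Longrightarrow> i < m \<Longrightarrow> j < n \<Longrightarrow> kop h w i j t = 0"
  by (auto simp: kop_def traceless_def fun_eq_iff)

text \<open>\<open>kop\<close> looks at a contraction only on argument lists of the right shape;
  elsewhere the contraction is zero, so nothing is lost.\<close>

lemma contraction_support:
  assumes t: "t \<in> Mix" and i: "i < m" and j: "j < n"
    and nz: "contraction sV m n i j t (xs, gs) \<noteq> 0"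
  shows "length xs = m - 1 \<and> length gs = n - 1 \<and> set gs \<subseteq> D"
proof (rule ccontr)
  assume *: "\<not> ?thesis"
  have "contraction sV m n i j t (xs, gs) = 0"
    using t[unfolded Mix_eq]
  proof (induction rule: fn.span_induct_alt)
    case base
    show ?case unfolding contraction_simps[OF i j] by simp
  next
    case (step c x y)
    then obtain fs vs where x: "x = pt fs vs" "lists_of fs vs" by blast
    then have l: "length fs = m" "length vs = n" "set fs \<subseteq> D" by (auto simp: lists_of_def)
    have "length (delete_nth i fs) = m - 1" "length (delete_nth j vs) = n - 1"
      using i j l by (simp_all add: length_delete_nth)
    then have "contraction sV m n i j x (xs, gs) = 0"
      unfolding x contraction_pure[OF V i j l(1,3,2)] using *
      by (auto simp: pure_tensor_def outer_def decomposable_def fscale_def)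
    then show ?case unfolding contraction_simps[OF i j] using step(2) by (simp add: fscale_def)
  qed
  then show False using nz by simp
qed

text \<open>The pair \<open>d 0\<close>, \<open>e 0\<close> is chosen because
  \<open>d 0 (e 0) = 1\<close>: putting \<open>e 0\<close> and \<open>d 0\<close> into the vacated
  arguments makes \<open>kop\<close> return the value of the contraction.\<close>

lemma traceless_kopI:
  assumes t: "t \<in> Mix" and z: "\<And>i j. i < m \<Longrightarrow> j < n \<Longrightarrow> kop (d 0) (e 0) i j t = 0"
  shows "t \<in> Tl"
  unfolding traceless_def
proof (intro CollectI conjI allI impI t ext)
  fix i j assume i: "i < m" and j: "j < n"
  fix z :: "'a list \<times> ('a \<Rightarrow> complex) list"
  obtain xs gs where zz: "z = (xs, gs)" by (cases z)
  show "contraction sV m n i j t z = 0 z"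
  proof (rule ccontr)
    assume nz: "contraction sV m n i j t z \<noteq> 0 z"
    then have l: "length xs = m - 1" "length gs = n - 1" "set gs \<subseteq> D"
      using contraction_support[OF t i j, of xs gs] by (auto simp: zz)
    let ?xs = "take i xs @ e 0 # drop i xs" and ?gs = "take j gs @ d 0 # drop j gs"
    have del: "delete_nth i ?xs = xs" "delete_nth j ?gs = gs" "?xs ! i = e 0" "?gs ! j = d 0"
      using i j l by (auto simp: delete_nth_def nth_append min_def)
    have "length ?xs = m" "length ?gs = n" using i j l by auto
    moreover have "set ?gs \<subseteq> D"
      using l set_take_subset[of j gs] set_drop_subset[of j gs] d_dual by auto
    ultimately have "kop (d 0) (e 0) i j t (?xs, ?gs) = contraction sV m n i j t (xs, gs)"
      by (simp add: kop_def del d_e)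
    then show False using z[OF i j] nz by (simp add: zz)
  qed
qed

text \<open>Invariance of the contraction: acting on the contracted covector and on the contracted
  vector gives opposite terms. What remains are corrections for the inserted \<open>h\<close> and
  \<open>w\<close>, which the action on the right moves as well; on traceless tensors they vanish
  too, whence \<open>Tl_act\<close>.\<close>

lemma kop_act:
  assumes t: "t \<in> Mix" and a: "a \<in> g" and h: "h \<in> D" and i: "i < m" and j: "j < n"
  shows "kop h w i j (act a t) =
    act a (kop h w i j t) - kop (\<lambda>x. - h (a x)) w i j t - kop h (a w) i j t"
  using t[unfolded Mix_eq]
proof (induction rule: fn.span_induct_alt)
  case base
  show ?case by (simp only: act_simps[OF a] kop_simps[OF i j]) simp
next
  case (step c x y)
  then obtain fs vs where x: "x = pt fs vs" and l: "lists_of fs vs" by blast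
  let ?A = "\<lambda>f x. - f (a x)"
  let ?c = "(fs ! i) (vs ! j)"
  have AD: "?A (fs ! k) \<in> D" if "k < m" for k
    by (rule dual_comp[OF g_linear[OF a] lists_of_nth[OF l that]])
  have le: "length fs = m" "length vs = n" using l by (auto simp: lists_of_def)
  have l': "lists_of (fs[i := h]) (vs[j := w])"
    by (intro lists_of_upd1 lists_of_upd2 l h)
  have A: "kop h w i j (\<Sum>k<m. pt (fs[k := ?A (fs ! k)]) vs) =
      fscale (- (fs ! i) (a (vs ! j))) (pt (fs[i := h]) (vs[j := w])) +
      (\<Sum>k\<in>{..<m} - {i}. fscale ?c (pt (fs[k := ?A (fs ! k), i := h]) (vs[j := w])))"
  proof -
    have "kop h w i j (\<Sum>k<m. pt (fs[k := ?A (fs ! k)]) vs) =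
        (\<Sum>k<m. fscale ((fs[k := ?A (fs ! k)] ! i) (vs ! j)) (pt (fs[k := ?A (fs ! k), i := h]) (vs[j := w])))"
      unfolding kop_simps[OF i j] by (intro sum.cong refl kop_pure lists_of_upd1 l AD i j) simp
    also have "\<dots> = fscale (- (fs ! i) (a (vs ! j))) (pt (fs[i := h]) (vs[j := w])) +
      (\<Sum>k\<in>{..<m} - {i}. fscale ((fs[k := ?A (fs ! k)] ! i) (vs ! j)) (pt (fs[k := ?A (fs ! k), i := h]) (vs[j := w])))"
      by (subst sum.remove[of _ i]) (use i le in auto)
    also have "(\<Sum>k\<in>{..<m} - {i}. fscale ((fs[k := ?A (fs ! k)] ! i) (vs ! j)) (pt (fs[k := ?A (fs ! k), i := h]) (vs[j := w]))) =
      (\<Sum>k\<in>{..<m} - {i}. fscale ?c (pt (fs[k := ?A (fs ! k), i := h]) (vs[j := w])))"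
      by (rule sum.cong) auto
    finally show ?thesis .
  qed
  have Bb: "kop h w i j (\<Sum>k<n. pt fs (vs[k := a (vs ! k)])) =
      fscale ((fs ! i) (a (vs ! j))) (pt (fs[i := h]) (vs[j := w])) +
      (\<Sum>k\<in>{..<n} - {j}. fscale ?c (pt (fs[i := h]) (vs[k := a (vs ! k), j := w])))"
  proof -
    have "kop h w i j (\<Sum>k<n. pt fs (vs[k := a (vs ! k)])) =
        (\<Sum>k<n. fscale ((fs ! i) (vs[k := a (vs ! k)] ! j)) (pt (fs[i := h]) (vs[k := a (vs ! k), j := w])))"
      unfolding kop_simps[OF i j] by (intro sum.cong refl kop_pure lists_of_upd2 l i j)
    also have "\<dots> = fscale ((fs ! i) (a (vs ! j))) (pt (fs[i := h]) (vs[j := w])) +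
      (\<Sum>k\<in>{..<n} - {j}. fscale ((fs ! i) (vs[k := a (vs ! k)] ! j)) (pt (fs[i := h]) (vs[k := a (vs ! k), j := w])))"
      by (subst sum.remove[of _ j]) (use j le in auto)
    also have "(\<Sum>k\<in>{..<n} - {j}. fscale ((fs ! i) (vs[k := a (vs ! k)] ! j)) (pt (fs[i := h]) (vs[k := a (vs ! k), j := w]))) =
      (\<Sum>k\<in>{..<n} - {j}. fscale ?c (pt (fs[i := h]) (vs[k := a (vs ! k), j := w])))"
      by (rule sum.cong) auto
    finally show ?thesis .
  qed
  have C: "(\<Sum>k<m. pt (fs[i := h, k := ?A (fs[i := h] ! k)]) (vs[j := w])) =
      pt (fs[i := ?A h]) (vs[j := w]) + (\<Sum>k\<in>{..<m} - {i}. pt (fs[k := ?A (fs ! k), i := h]) (vs[j := w]))"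
  proof -
    have "(\<Sum>k\<in>{..<m} - {i}. pt (fs[i := h, k := ?A (fs[i := h] ! k)]) (vs[j := w])) =
        (\<Sum>k\<in>{..<m} - {i}. pt (fs[k := ?A (fs ! k), i := h]) (vs[j := w]))"
      by (rule sum.cong) (auto simp: list_update_swap)
    then show ?thesis by (subst sum.remove[of _ i]) (use i le in auto)
  qed
  have E: "(\<Sum>k<n. pt (fs[i := h]) (vs[j := w, k := a (vs[j := w] ! k)])) =
      pt (fs[i := h]) (vs[j := a w]) + (\<Sum>k\<in>{..<n} - {j}. pt (fs[i := h]) (vs[k := a (vs ! k), j := w]))"
  proof -
    have "(\<Sum>k\<in>{..<n} - {j}. pt (fs[i := h]) (vs[j := w, k := a (vs[j := w] ! k)])) =
        (\<Sum>k\<in>{..<n} - {j}. pt (fs[i := h]) (vs[k := a (vs ! k), j := w]))"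
      by (rule sum.cong) (auto simp: list_update_swap)
    then show ?thesis by (subst sum.remove[of _ j]) (use j le in auto)
  qed
  have "kop h w i j (act a x) =
    act a (kop h w i j x) - kop (\<lambda>x. - h (a x)) w i j x - kop h (a w) i j x"
    unfolding x act_pure[OF a l] kop_pure[OF l i j] act_simps[OF a] act_pure[OF a l']
      kop_simps(1)[OF i j] A Bb C E
    by (simp only: fn.scale_right_distrib fn.scale_sum_right fn.scale_minus_left) (simp only: algebra_simps, simp)
  then show ?case
    unfolding act_simps[OF a] kop_simps[OF i j] step(2)
    by (simp only: fn.scale_right_diff_distrib) (simp only: algebra_simps)
qed

lemma Mix_act: "a \<in> g \<Longrightarrow> t \<in> Mix \<Longrightarrow> act a t \<in> Mix"
  using Tlt_act[of a t "Suc m"] by (simp add: Tlt_Suc_m)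

lemma Tl_act:
  assumes a: "a \<in> g" and t: "t \<in> Tl"
  shows "act a t \<in> Tl"
proof (rule traceless_kopI[OF Mix_act[OF a Tl_Mix[OF t]]])
  fix i j assume i: "i < m" and j: "j < n"
  show "kop (d 0) (e 0) i j (act a t) = 0"
    unfolding kop_act[OF Tl_Mix[OF t] a d_dual i j] kop_traceless[OF t i j] act_simps[OF a] by simp
qed

lemma kop_Tlt:
  assumes t: "t \<in> Tlt k" and i: "i < m" and j: "j < n" and h: "h \<in> Vs"
  shows "kop h w i j t \<in> Tlt k"
  using t[unfolded Tlt_def]
proof (induction rule: fn.span_induct_alt)
  case base
  show ?case unfolding kop_simps[OF i j] by (rule fn.subspace_0[OF subspace_Tlt])
next
  case (step c x y)
  then obtain fs vs where x: "x = pt fs vs" and l: "lists_of fs vs" "nq fs < k" by blast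
  have "pt (fs[i := h]) (vs[j := w]) \<in> Tlt k"
  proof (rule Tlt_base)
    show "lists_of (fs[i := h]) (vs[j := w])" using h Vs_sub by (intro lists_of_upd1 lists_of_upd2 l) auto
    show "nq (fs[i := h]) < k" using nq_upd_le[of h fs i] h l by auto
  qed
  then show ?case
    unfolding kop_simps[OF i j] x kop_pure[OF l(1) i j]
    by (intro fn.subspace_add[OF subspace_Tlt] fn.subspace_scale[OF subspace_Tlt] step(2))
qed

subsection \<open>Permutations of the tensor factors\<close>

definition ppos :: "(nat \<Rightarrow> nat) \<Rightarrow> (nat \<Rightarrow> nat) \<Rightarrow> 'a mixed \<Rightarrow> 'a mixed" where
  "ppos \<sigma> \<tau> t = (\<lambda>(xs, gs). t (permute_list \<sigma> xs, permute_list \<tau> gs))"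

lemma ppos_simps:
  "ppos \<sigma> \<tau> (x + y) = ppos \<sigma> \<tau> x + ppos \<sigma> \<tau> y" "ppos \<sigma> \<tau> (fscale c x) = fscale c (ppos \<sigma> \<tau> x)"
  "ppos \<sigma> \<tau> 0 = 0" "ppos \<sigma> \<tau> (sum f A) = (\<Sum>a\<in>A. ppos \<sigma> \<tau> (f a))"
proof -
  show 1: "ppos \<sigma> \<tau> (x + y) = ppos \<sigma> \<tau> x + ppos \<sigma> \<tau> y" for x y by (auto simp: ppos_def)
  show "ppos \<sigma> \<tau> (fscale c x) = fscale c (ppos \<sigma> \<tau> x)" by (auto simp: ppos_def fscale_def)
  show 0: "ppos \<sigma> \<tau> 0 = 0" by (auto simp: ppos_def)
  show "ppos \<sigma> \<tau> (sum f A) = (\<Sum>a\<in>A. ppos \<sigma> \<tau> (f a))"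
    by (induction A rule: infinite_finite_induct) (simp_all only: 0 1 sum.infinite sum.empty sum.insert not_False_eq_True)
qed

lemma ppos_pure:
  assumes "lists_of fs vs" "\<sigma> permutes {..<m}" "\<tau> permutes {..<n}"
  shows "ppos \<sigma> \<tau> (pt fs vs) = pt (permute_list (inv \<sigma>) fs) (permute_list (inv \<tau>) vs)"
proof -
  have "ppos \<sigma> \<tau> (pt fs vs) = outer (permute_tensor \<sigma> (decomposable ev_covector UNIV fs))
      (permute_tensor \<tau> (decomposable ev_vector D vs))"
    by (auto simp: ppos_def pure_tensor_def outer_def permute_tensor_def)
  then show ?thesis
    using assms by (simp add: permute_tensor_decomposable lists_of_def pure_tensor_def)
qed

lemma lists_of_permute:
  "lists_of fs vs \<Longrightarrow> \<sigma> permutes {..<m} \<Longrightarrow> \<tau> permutes {..<n} \<Longrightarrow>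
    lists_of (permute_list \<sigma> fs) (permute_list \<tau> vs)"
  by (simp add: lists_of_def)

text \<open>The action is a sum over positions, and permuting the factors merely reindexes it. Both
  the Young symmetrizers and the analysis of coefficients in \<open>cy_acts\<close> rest on
  this.\<close>

lemma act_ppos:
  assumes t: "t \<in> Mix" and a: "a \<in> g" and \<sigma>: "\<sigma> permutes {..<m}" and \<tau>: "\<tau> permutes {..<n}"
  shows "act a (ppos \<sigma> \<tau> t) = ppos \<sigma> \<tau> (act a t)"
  using t[unfolded Mix_eq]
proof (induction rule: fn.span_induct_alt)
  case base
  show ?case by (simp only: act_simps[OF a] ppos_simps)
next
  case (step c x y)
  then obtain fs vs where x: "x = pt fs vs" and l: "lists_of fs vs" by blast
  let ?A = "\<lambda>f x. - f (a x)"
  have le: "length fs = m" "length vs = n" using l by (auto simp: lists_of_def)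
  note \<sigma>' = permutes_inv[OF \<sigma>] and \<tau>' = permutes_inv[OF \<tau>]
  have AD: "?A (fs ! k) \<in> D" if "k < m" for k
    by (rule dual_comp[OF g_linear[OF a] lists_of_nth[OF l that]])
  let ?fs = "permute_list (inv \<sigma>) fs" and ?vs = "permute_list (inv \<tau>) vs"
  have inv: "inv (inv \<sigma>) = \<sigma>" "inv (inv \<tau>) = \<tau>"
    using \<sigma> \<tau> by (simp_all add: permutes_bij inv_inv_eq)
  have 1: "ppos \<sigma> \<tau> (pt (fs[k := ?A (fs ! k)]) vs) = pt (?fs[\<sigma> k := ?A (?fs ! \<sigma> k)]) ?vs" if k: "k < m" for k
  proof -
    have "\<sigma> k < m" using permutes_in_image[OF \<sigma>, of k] k by simp
    then have "?fs ! \<sigma> k = fs ! k" using \<sigma>' le permutes_inverses[OF \<sigma>] by (simp add: permute_list_def)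
    then show ?thesis
      using ppos_pure[OF lists_of_upd1[OF l AD[OF k]] \<sigma> \<tau>] permute_list_update[of "inv \<sigma>" fs k] k le \<sigma>' inv by simp
  qed
  have 2: "ppos \<sigma> \<tau> (pt fs (vs[k := a (vs ! k)])) = pt ?fs (?vs[\<tau> k := a (?vs ! \<tau> k)])" if k: "k < n" for k
  proof -
    have "\<tau> k < n" using permutes_in_image[OF \<tau>, of k] k by simp
    then have "?vs ! \<tau> k = vs ! k" using \<tau>' le permutes_inverses[OF \<tau>] by (simp add: permute_list_def)
    then show ?thesis
      using ppos_pure[OF lists_of_upd2[OF l] \<sigma> \<tau>] permute_list_update[of "inv \<tau>" vs k] k le \<tau>' inv by simp
  qed
  have "(\<Sum>k<m. pt (?fs[k := ?A (?fs ! k)]) ?vs) = (\<Sum>k<m. ppos \<sigma> \<tau> (pt (fs[k := ?A (fs ! k)]) vs))"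
    unfolding sum.permute[OF \<sigma>, of "\<lambda>k. pt (?fs[k := ?A (?fs ! k)]) ?vs"] by (rule sum.cong) (auto simp: 1)
  moreover have "(\<Sum>k<n. pt ?fs (?vs[k := a (?vs ! k)])) = (\<Sum>k<n. ppos \<sigma> \<tau> (pt fs (vs[k := a (vs ! k)])))"
    unfolding sum.permute[OF \<tau>, of "\<lambda>k. pt ?fs (?vs[k := a (?vs ! k)])"] by (rule sum.cong) (auto simp: 2)
  ultimately have "act a (ppos \<sigma> \<tau> x) = ppos \<sigma> \<tau> (act a x)"
    unfolding x act_pure[OF a l] ppos_pure[OF l \<sigma> \<tau>] act_pure[OF a lists_of_permute[OF l \<sigma>' \<tau>']] ppos_simps
    by simp
  then show ?case unfolding act_simps[OF a] ppos_simps step(2) by simp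
qed

end

section \<open>Rank one operators and the drop in degree\<close>

context mackey_tensors
begin

lemma Q_iff: "b \<in> B \<Longrightarrow> b \<notin> Vs \<longleftrightarrow> b \<in> Q"
  using d_in_Vs Q_not_Vs by auto

lemma nq_eq: "set bs \<subseteq> B \<Longrightarrow> nq bs = size (filter_mset (\<lambda>b. b \<in> Q) (mset bs))"
proof -
  assume bs: "set bs \<subseteq> B"
  have "{i. i < length bs \<and> bs ! i \<notin> Vs} = {i. i < length bs \<and> bs ! i \<in> Q}"
    using Q_iff subsetD[OF bs nth_mem] by auto
  then show ?thesis unfolding nq_def mset_filter[symmetric] size_mset length_filter_conv_card by simp
qed

lemma act_rank_one:
  assumes l: "lists_of fs vs"
  shows "act (rank_one v b) (pt fs vs) = (\<Sum>i<m. fscale (- (fs ! i) v) (pt (fs[i := d b]) vs)) +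
    (\<Sum>j<n. fscale (d b (vs ! j)) (pt fs (vs[j := v])))"
  unfolding act_pure[OF rank_one_in_g l]
proof (intro arg_cong2[of _ _ _ _ "(+)"] sum.cong refl)
  fix i assume i: "i \<in> {..<m}"
  then have "(\<lambda>x. - (fs ! i) (rank_one v b x)) = fscale (- (fs ! i) v) (d b)"
    by (intro dual_rank_one lists_of_nth[OF l]) simp
  then show "pt (fs[i := \<lambda>x. - (fs ! i) (rank_one v b x)]) vs = fscale (- (fs ! i) v) (pt (fs[i := d b]) vs)"
    using pt_scale1[OF l _ d_dual] i by (simp only: lessThan_iff)
next
  fix j assume "j \<in> {..<n}"
  then show "pt fs (vs[j := rank_one v b (vs ! j)]) = fscale (d b (vs ! j)) (pt fs (vs[j := v]))"
    unfolding rank_one_def using pt_scale2[OF l] by simp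
qed

lemma index_bound:
  assumes "finite F" "finite C"
  shows "\<exists>N. (\<forall>i. d i \<in> F \<longrightarrow> i < N) \<and> (\<forall>i. e i \<in> C \<longrightarrow> i < N)"
proof -
  have "finite (d -` F)" "finite (e -` C)"
    using assms inj_d inj_e by (auto intro!: finite_vimageI simp: inj_on_def)
  then obtain N where "\<forall>i\<in>d -` F \<union> e -` C. i < N"
    using finite_nat_set_iff_bounded[of "d -` F \<union> e -` C"] by auto
  then show ?thesis by (intro exI[of _ N]) auto
qed

lemma wordD:
  assumes "(bs, cs) \<in> words"
  shows "lists_of bs cs" "length bs = m" "length cs = n" "set bs \<subseteq> B" "set cs \<subseteq> range e"
    "i < m \<Longrightarrow> bs ! i \<in> B" "j < n \<Longrightarrow> cs ! j \<in> range e"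
proof -
  show "lists_of bs cs" using words_lists_of[OF assms] by simp
  show 1: "length bs = m" "length cs = n" "set bs \<subseteq> B" "set cs \<subseteq> range e"
    using assms by (auto simp: words_def)
  show "i < m \<Longrightarrow> bs ! i \<in> B" "j < n \<Longrightarrow> cs ! j \<in> range e"
    using subsetD[OF 1(3) nth_mem] subsetD[OF 1(4) nth_mem] 1(1,2) by simp_all
qed

lemma wordI: "length bs = m \<Longrightarrow> set bs \<subseteq> B \<Longrightarrow> length cs = n \<Longrightarrow> set cs \<subseteq> range e \<Longrightarrow> (bs, cs) \<in> words"
  by (simp add: words_def)

lemma word_upd1: "(bs, cs) \<in> words \<Longrightarrow> b \<in> B \<Longrightarrow> (bs[i := b], cs) \<in> words"
  unfolding words_def using set_update_subset_insert[of bs i b] by auto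

lemma word_upd2: "(bs, cs) \<in> words \<Longrightarrow> c \<in> range e \<Longrightarrow> (bs, cs[i := c]) \<in> words"
  unfolding words_def using set_update_subset_insert[of cs i c] by auto

lemma nq_upd_eq:
  assumes "f \<in> Vs" "fs ! i \<notin> Vs" "i < length fs"
  shows "nq fs = Suc (nq (fs[i := f]))"
proof -
  have "{j. j < length fs \<and> fs ! j \<notin> Vs} = insert i {j. j < length (fs[i := f]) \<and> fs[i := f] ! j \<notin> Vs}"
    using assms by (auto simp: nth_list_update split: if_splits)
  moreover have "i \<notin> {j. j < length (fs[i := f]) \<and> fs[i := f] ! j \<notin> Vs}" using assms by auto
  ultimately show ?thesis unfolding nq_def by simp
qed

text \<open>The rank one operator \<open>x \<mapsto> d N x \<cdot> v\<close> with fresh \<open>N\<close> and with \<open>v\<close> dual to one of the functionals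
  occurring in \<open>t\<close> modulo \<open>Vs\<close> and annihilated by the others replaces that functional by \<open>- d N\<close>
  and lowers the filtration degree by exactly one.\<close>

lemma lower_degree:
  assumes t: "t \<in> Tlt (Suc (Suc l))" "t \<notin> Tlt (Suc l)"
  shows "\<exists>a\<in>g. act a t \<in> Tlt (Suc l) \<and> act a t \<notin> Tlt l"
proof -
  obtain \<Omega> where \<Omega>: "finite \<Omega>" "\<Omega> \<subseteq> {w \<in> words. nq (fst w) < Suc (Suc l)}" "t \<in> fn.span (ptw ` \<Omega>)"
    using t(1) by (rule Tlt_finite_words)
  have \<Omega>w: "\<Omega> \<subseteq> words" using \<Omega>(2) by auto
  have tM: "t \<in> Mix"
    using \<Omega>(3) fn.span_mono[of "ptw ` \<Omega>" "{pt fs vs |fs vs. lists_of fs vs}"] words_lists_of \<Omega>w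
    unfolding Mix_eq by blast
  obtain w0 where w0: "w0 \<in> words" "crd t w0 \<noteq> 0" "Suc l \<le> nq (fst w0)"
    using tM t(2) by (rule crd_nonzero)
  have w0\<Omega>: "w0 \<in> \<Omega>" by (rule crd_support[OF w0(2) \<Omega>(3) \<Omega>w])
  obtain bs0 cs0 where w0': "w0 = (bs0, cs0)" by (cases w0)
  have nq0: "nq bs0 = Suc l" using w0(3) w0\<Omega> \<Omega>(2) by (auto simp: w0')
  note W0 = wordD[OF w0(1)[unfolded w0']]
  have "{i. i < length bs0 \<and> bs0 ! i \<notin> Vs} \<noteq> {}" using nq0 unfolding nq_def by (metis card.empty nat.distinct(1))
  then obtain i0 where i0: "i0 < m" "bs0 ! i0 \<notin> Vs" using W0(2) by auto
  define \<phi> where "\<phi> = bs0 ! i0"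
  define F where "F = \<Union>(set ` fst ` \<Omega>)"
  define C where "C = \<Union>(set ` snd ` \<Omega>)"
  have fin: "finite F" "finite C" using \<Omega>(1) by (auto simp: F_def C_def)
  obtain N where N: "\<And>i. d i \<in> F \<Longrightarrow> i < N" "\<And>i. e i \<in> C \<Longrightarrow> i < N"
    using index_bound[OF fin] by blast
  have FB: "F \<subseteq> B" unfolding F_def using \<Omega>w by (force simp: words_def)
  have \<phi>F: "\<phi> \<in> F" using w0\<Omega> i0 W0(2) unfolding F_def \<phi>_def w0' by force
  have \<phi>Q: "\<phi> \<in> F \<inter> Q" using \<phi>F FB i0 Q_iff[of \<phi>] by (auto simp: \<phi>_def)
  obtain u where u: "\<And>\<psi>. \<psi> \<in> F \<inter> Q \<Longrightarrow> \<psi> u = (if \<psi> = \<phi> then 1 else 0)" "\<And>j. j < N \<Longrightarrow> d j u = 0"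
    using dual_system[of "F \<inter> Q" N] fin(1) \<phi>Q by blast
  have uF: "\<psi> u = (if \<psi> = \<phi> then 1 else 0)" if \<psi>: "\<psi> \<in> F" for \<psi>
  proof (cases "\<psi> \<in> Q")
    case True
    then show ?thesis using u(1) \<psi> by blast
  next
    case False
    then obtain j where j: "\<psi> = d j" using \<psi> FB by auto
    then have "\<psi> \<noteq> \<phi>" using \<phi>Q Q_disj by blast
    then show ?thesis using u(2) N(1) \<psi> j by simp
  qed
  let ?a = "rank_one u N"
  have inF: "bs ! i \<in> F" if "(bs, cs) \<in> \<Omega>" "i < m" for bs cs i
    using that wordD(2)[of bs cs] \<Omega>w unfolding F_def by force
  have inC: "cs ! j \<in> C" if "(bs, cs) \<in> \<Omega>" "j < n" for bs cs j
    using that wordD(3)[of bs cs] \<Omega>w unfolding C_def by force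
  have act: "act ?a (pt bs cs) = (\<Sum>i\<in>{i. i < m \<and> bs ! i = \<phi>}. - pt (bs[i := d N]) cs)"
    if w: "(bs, cs) \<in> \<Omega>" for bs cs
  proof -
    have W: "(bs, cs) \<in> words" using w \<Omega>w by blast
    have z: "d N (cs ! j) = 0" if j: "j < n" for j
    proof -
      obtain i where i: "cs ! j = e i" using wordD(7)[OF W j] by blast
      then have "i < N" using inC[OF w j] N(2) by simp
      then show ?thesis by (simp add: i d_e)
    qed
    have "act ?a (pt bs cs) = (\<Sum>i<m. if bs ! i = \<phi> then - pt (bs[i := d N]) cs else 0)"
      unfolding act_rank_one[OF wordD(1)[OF W]] using z uF[OF inF[OF w]]
      by (auto intro!: sum.cong)
    also have "\<dots> = (\<Sum>i\<in>{i. i < m \<and> bs ! i = \<phi>}. - pt (bs[i := d N]) cs)"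
      by (subst sum.inter_filter[symmetric]) (auto intro: sum.cong)
    finally show ?thesis .
  qed
  \<comment> \<open>The word obtained from \<open>w0\<close> by changing a single occurrence of
    \<phi>. As \<open>d N\<close> is fresh, its place reveals which letter was replaced, so
    \<open>w1\<close> arises from \<open>w0\<close> only and its coefficient cannot cancel.\<close>
  define w1 where "w1 = (bs0[i0 := d N], cs0)"
  have dN: "d N \<notin> F" using N(1) by blast
  have crd1: "crd (act ?a (ptw w)) w1 = (if w = w0 then - 1 else 0)" if w: "w \<in> \<Omega>" for w
  proof -
    obtain bs cs where w': "w = (bs, cs)" by (cases w)
    have W: "(bs, cs) \<in> words" using w \<Omega>w w' by blast
    have eq: "w1 = (bs[i := d N], cs) \<longleftrightarrow> i = i0 \<and> w = w0" if i: "i < m" "bs ! i = \<phi>" for i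
    proof
      assume *: "w1 = (bs[i := d N], cs)"
      then have b: "bs0[i0 := d N] = bs[i := d N]" by (simp add: w1_def)
      have ii: "i = i0"
      proof (rule ccontr)
        assume "i \<noteq> i0"
        then have "bs0 ! i = bs0[i0 := d N] ! i" by simp
        also have "\<dots> = d N" unfolding b using i wordD(2)[OF W] by simp
        finally show False using inF[of bs0 cs0 i] w0\<Omega> i dN by (simp add: w0')
      qed
      have "bs0[i0 := d N, i0 := \<phi>] = bs[i := d N, i0 := \<phi>]" using b by simp
      then have "bs0 = bs" using ii i(2) \<phi>_def by (metis list_update_id list_update_overwrite)
      then show "i = i0 \<and> w = w0" using ii * by (simp add: w1_def w' w0')
    next
      assume "i = i0 \<and> w = w0" then show "w1 = (bs[i := d N], cs)" by (simp add: w1_def w' w0')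
    qed
    have "crd (act ?a (ptw w)) w1 = (\<Sum>i\<in>{i. i < m \<and> bs ! i = \<phi>}. - crd (pt (bs[i := d N]) cs) w1)"
      using act[of bs cs] w by (simp add: w' crd_simps)
    also have "\<dots> = (\<Sum>i\<in>{i. i < m \<and> bs ! i = \<phi>}. if i = i0 \<and> w = w0 then - 1 else 0)"
    proof (rule sum.cong)
      fix i assume i: "i \<in> {i. i < m \<and> bs ! i = \<phi>}"
      have "crd (pt (bs[i := d N]) cs) = (\<lambda>w. if w = (bs[i := d N], cs) then 1 else 0)"
        using crd_word[OF word_upd1[OF W, of "d N" i]] by simp
      then show "- crd (pt (bs[i := d N]) cs) w1 = (if i = i0 \<and> w = w0 then - 1 else 0)"
        using eq i by simp
    qed simp
    also have "\<dots> = (if w = w0 then - 1 else 0)"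
    proof (cases "w = w0")
      case True
      then have "i0 \<in> {i. i < m \<and> bs ! i = \<phi>}" using i0 by (simp add: w' w0' \<phi>_def)
      then show ?thesis using True by simp
    qed simp
    finally show ?thesis .
  qed
  have texp: "t = (\<Sum>w\<in>\<Omega>. fscale (crd t w) (ptw w))" by (rule crd_expand[OF \<Omega>(1) \<Omega>w \<Omega>(3)])
  have aexp: "act ?a t = (\<Sum>w\<in>\<Omega>. fscale (crd t w) (act ?a (ptw w)))"
    by (subst texp) (simp only: act_simps[OF rank_one_in_g])
  have "crd (act ?a t) w1 = (\<Sum>w\<in>\<Omega>. crd t w * (if w = w0 then - 1 else 0))"
    unfolding aexp crd_simps using crd1 by simp
  also have "\<dots> = (\<Sum>w\<in>\<Omega>. if w = w0 then - crd t w0 else 0)"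
    by (rule sum.cong) auto
  also have "\<dots> = - crd t w0" using w0\<Omega> \<Omega>(1) by simp
  finally have "crd (act ?a t) w1 \<noteq> 0" using w0(2) by simp
  moreover have "nq (fst w1) = l"
    using nq_upd_eq[OF d_in_Vs[of N] i0(2)] i0(1) W0(2) nq0 by (simp add: w1_def)
  ultimately have 1: "act ?a t \<notin> Tlt l" using crd_Tlt[of "act ?a t" l w1] by auto
  have "act ?a (ptw w) \<in> Tlt (Suc l)" if w: "w \<in> \<Omega>" for w
  proof -
    obtain bs cs where w': "w = (bs, cs)" by (cases w)
    have W: "(bs, cs) \<in> words" "nq bs \<le> Suc l" using w \<Omega>(2) w' by auto
    have "pt (bs[i := d N]) cs \<in> Tlt (Suc l)" if "i < m" "bs ! i = \<phi>" for i
      using that Tlt_upd[OF wordD(1)[OF W(1)] W(2) _ _ d_in_Vs, of i] i0(2) by (simp add: \<phi>_def)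
    then show ?thesis
      using act[of bs cs] w unfolding w'
      by (auto intro!: fn.subspace_sum[OF subspace_Tlt] fn.subspace_neg[OF subspace_Tlt])
  qed
  then have "act ?a t \<in> Tlt (Suc l)"
    unfolding aexp by (intro fn.subspace_sum[OF subspace_Tlt] fn.subspace_scale[OF subspace_Tlt])
  then show ?thesis using 1 rank_one_in_g by blast
qed

subsection \<open>Replacement of letters\<close>

text \<open>For letters in \<open>Q\<close> the operator of \<open>Q_replacement\<close> annihilates
  all other letters in sight and hits \<beta> up to \<open>Vs\<close>. For letters
  \<open>d p\<close> and \<open>d q\<close> a rank one operator works: its effect on letters from
  \<open>Q\<close> lowers the degree, and \<open>fresh\<close> keeps it off the vectors.\<close>

lemma replace_functional:
  assumes X: "finite X" "X \<subseteq> B" and J: "finite J" and \<alpha>: "\<alpha> \<in> X" and \<beta>: "\<beta> \<in> B"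
    and type: "\<alpha> \<in> Q \<longleftrightarrow> \<beta> \<in> Q" and fresh: "\<And>q. \<beta> = d q \<Longrightarrow> e q \<notin> J"
  shows "\<exists>a\<in>g. \<forall>bs cs. (bs, cs) \<in> words \<longrightarrow> nq bs \<le> k \<longrightarrow> set bs \<subseteq> X \<longrightarrow> set cs \<subseteq> J \<longrightarrow>
    act a (pt bs cs) - (\<Sum>i\<in>{i. i < m \<and> bs ! i = \<alpha>}. pt (bs[i := \<beta>]) cs) \<in> Tlt k"
proof (cases "\<alpha> \<in> Q")
  case True
  then have \<beta>Q: "\<beta> \<in> Q" using type by simp
  obtain N where N: "\<And>i. d i \<in> X \<Longrightarrow> i < N" "\<And>i. e i \<in> J \<Longrightarrow> i < N"
    using index_bound[OF X(1) J] by blast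
  have "finite (X \<inter> Q)" "X \<inter> Q \<subseteq> Q" "\<alpha> \<in> X \<inter> Q" using X(1) \<alpha> True by auto
  from Q_replacement[OF this Q_dual[OF \<beta>Q], of N] obtain a where a: "a \<in> g"
    "(\<lambda>x. - \<alpha> (a x)) - \<beta> \<in> Vs" "\<And>\<psi> x. \<psi> \<in> X \<inter> Q - {\<alpha>} \<Longrightarrow> \<psi> (a x) = 0"
    "\<And>j x. j < N \<Longrightarrow> d j (a x) = 0" "\<And>j. j < N \<Longrightarrow> a (e j) = 0" by blast
  show ?thesis
  proof (intro bexI[OF _ a(1)] allI impI)
    fix bs cs assume w: "(bs, cs) \<in> words" and nq: "nq bs \<le> k" and sub: "set bs \<subseteq> X" "set cs \<subseteq> J"
    note W = wordD[OF w]
    have "pt bs (cs[j := a (cs ! j)]) = 0" if j: "j < n" for j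
    proof -
      obtain i where i: "cs ! j = e i" using W(7)[OF j] by blast
      have "cs ! j \<in> J" using sub(2) j W(3) by auto
      then have "a (cs ! j) = 0" using N(2) a(5) i by simp
      then show ?thesis using pt_zero2[OF W(1) j] by simp
    qed
    then have "act a (pt bs cs) = (\<Sum>i<m. pt (bs[i := (\<lambda>x. - (bs ! i) (a x))]) cs)"
      unfolding act_pure[OF a(1) W(1)] by simp
    also have "\<dots> = (\<Sum>i\<in>{i. i < m \<and> bs ! i = \<alpha>}. pt (bs[i := (\<lambda>x. - \<alpha> (a x))]) cs)"
    proof (rule sum.mono_neutral_cong_right)
      show "\<forall>i\<in>{..<m} - {i. i < m \<and> bs ! i = \<alpha>}. pt (bs[i := (\<lambda>x. - (bs ! i) (a x))]) cs = 0"
      proof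
        fix i assume i: "i \<in> {..<m} - {i. i < m \<and> bs ! i = \<alpha>}"
        then have bX: "bs ! i \<in> X" "bs ! i \<noteq> \<alpha>" using sub(1) W(2) by auto
        have "(bs ! i) (a x) = 0" for x
        proof (cases "bs ! i \<in> Q")
          case True
          then show ?thesis using a(3) bX by blast
        next
          case False
          then obtain j where "bs ! i = d j" using bX X(2) by auto
          then show ?thesis using a(4) N(1) bX by simp
        qed
        then have "(\<lambda>x. - (bs ! i) (a x)) = 0" by auto
        then show "pt (bs[i := (\<lambda>x. - (bs ! i) (a x))]) cs = 0" using pt_zero1[OF W(1)] i by simp
      qed
    qed auto
    finally have "act a (pt bs cs) - (\<Sum>i\<in>{i. i < m \<and> bs ! i = \<alpha>}. pt (bs[i := \<beta>]) cs) =
      (\<Sum>i\<in>{i. i < m \<and> bs ! i = \<alpha>}. pt (bs[i := (\<lambda>x. - \<alpha> (a x))]) cs - pt (bs[i := \<beta>]) cs)"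
      by (simp add: sum_subtractf)
    also have "\<dots> \<in> Tlt k"
    proof (rule fn.subspace_sum[OF subspace_Tlt])
      fix i assume i: "i \<in> {i. i < m \<and> bs ! i = \<alpha>}"
      show "pt (bs[i := (\<lambda>x. - \<alpha> (a x))]) cs - pt (bs[i := \<beta>]) cs \<in> Tlt k"
        using i by (intro Tlt_cong[OF W(1) nq] a(2) dual_comp g_linear[OF a(1)])
          (auto simp: Q_dual True \<beta>Q Q_not_Vs)
    qed
    finally show "act a (pt bs cs) - (\<Sum>i\<in>{i. i < m \<and> bs ! i = \<alpha>}. pt (bs[i := \<beta>]) cs) \<in> Tlt k" .
  qed
next
  case False
  then obtain p where p: "\<alpha> = d p" using \<alpha> X(2) by auto
  obtain q where q: "\<beta> = d q" using \<beta> type False by auto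
  \<comment> \<open>The sign in \<open>- e p\<close> compensates the one in the action on
    covectors.\<close>
  show ?thesis
  proof (intro bexI[OF _ rank_one_in_g[of "- e p" q]] allI impI)
    fix bs cs assume w: "(bs, cs) \<in> words" and nq: "nq bs \<le> k" and sub: "set bs \<subseteq> X" "set cs \<subseteq> J"
    note W = wordD[OF w]
    have z: "d q (cs ! j) = 0" if j: "j < n" for j
    proof -
      obtain i where i: "cs ! j = e i" using W(7)[OF j] by blast
      have "cs ! j \<in> J" using sub(2) j W(3) by auto
      then have "i \<noteq> q" using fresh[OF q] i by auto
      then show ?thesis by (simp add: i d_e)
    qed
    have "act (rank_one (- e p) q) (pt bs cs) - (\<Sum>i\<in>{i. i < m \<and> bs ! i = \<alpha>}. pt (bs[i := \<beta>]) cs) =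
        (\<Sum>i<m. fscale (- (bs ! i) (- e p)) (pt (bs[i := d q]) cs)) -
        (\<Sum>i<m. if bs ! i = \<alpha> then pt (bs[i := \<beta>]) cs else 0)"
      unfolding act_rank_one[OF W(1)] using z by (simp add: sum.inter_filter[symmetric])
    also have "\<dots> = (\<Sum>i<m. fscale (- (bs ! i) (- e p)) (pt (bs[i := d q]) cs) -
        (if bs ! i = \<alpha> then pt (bs[i := \<beta>]) cs else 0))"
      by (simp add: sum_subtractf)
    also have "\<dots> \<in> Tlt k"
    proof (rule fn.subspace_sum[OF subspace_Tlt])
      fix i assume "i \<in> {..<m}"
      then have i: "i < m" by simp
      have ev: "- (bs ! i) (- e p) = (bs ! i) (e p)"
        using dualD(4)[OF lists_of_nth[OF W(1) i]] by simp
      show "fscale (- (bs ! i) (- e p)) (pt (bs[i := d q]) cs) -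
        (if bs ! i = \<alpha> then pt (bs[i := \<beta>]) cs else 0) \<in> Tlt k"
      proof (cases "bs ! i \<in> Q")
        case True
        then have "pt (bs[i := d q]) cs \<in> Tlt k"
          by (intro Tlt_upd[OF W(1) nq i] d_in_Vs Q_not_Vs)
        then show ?thesis unfolding ev using True False by (auto intro: fn.subspace_scale[OF subspace_Tlt])
      next
        case False
        then obtain j where "bs ! i = d j" using W(6)[OF i] by auto
        then show ?thesis unfolding ev using fn.subspace_0[OF subspace_Tlt] by (auto simp: p q d_e inj_d)
      qed
    qed
    finally show "act (rank_one (- e p) q) (pt bs cs) - (\<Sum>i\<in>{i. i < m \<and> bs ! i = \<alpha>}. pt (bs[i := \<beta>]) cs) \<in> Tlt k" .
  qed
qed

text \<open>The operator affects a functional only if it is nonzero at \<open>e q\<close>. Among the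
  letters in \<open>range d\<close> that is \<open>d q\<close>, which is absent, and a letter from
  \<open>Q\<close> becomes \<open>d p\<close>, which lowers the degree.\<close>

lemma replace_vector:
  assumes w: "(bs, cs) \<in> words" and nq: "nq bs \<le> k" and fresh: "d q \<notin> set bs"
  shows "act (rank_one (e q) p) (pt bs cs) - (\<Sum>j\<in>{j. j < n \<and> cs ! j = e p}. pt bs (cs[j := e q])) \<in> Tlt k"
proof -
  note W = wordD[OF w]
  have "(\<Sum>j<n. fscale (d p (cs ! j)) (pt bs (cs[j := e q]))) = (\<Sum>j<n. if cs ! j = e p then pt bs (cs[j := e q]) else 0)"
  proof (rule sum.cong)
    fix j assume "j \<in> {..<n}"
    then obtain i where "cs ! j = e i" using W(7)[of j] by auto
    then show "fscale (d p (cs ! j)) (pt bs (cs[j := e q])) = (if cs ! j = e p then pt bs (cs[j := e q]) else 0)"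
      by (simp add: d_e inj_e)
  qed simp
  also have "\<dots> = (\<Sum>j\<in>{j. j < n \<and> cs ! j = e p}. pt bs (cs[j := e q]))"
    by (simp add: sum.inter_filter[symmetric])
  finally have "act (rank_one (e q) p) (pt bs cs) - (\<Sum>j\<in>{j. j < n \<and> cs ! j = e p}. pt bs (cs[j := e q])) =
     (\<Sum>i<m. fscale (- (bs ! i) (e q)) (pt (bs[i := d p]) cs))"
    unfolding act_rank_one[OF W(1)] by simp
  also have "\<dots> \<in> Tlt k"
  proof (rule fn.subspace_sum[OF subspace_Tlt])
    fix i assume "i \<in> {..<m}"
    then have i: "i < m" by simp
    show "fscale (- (bs ! i) (e q)) (pt (bs[i := d p]) cs) \<in> Tlt k"
    proof (cases "bs ! i \<in> Q")
      case True
      then have "pt (bs[i := d p]) cs \<in> Tlt k"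
        by (intro Tlt_upd[OF W(1) nq i] d_in_Vs Q_not_Vs)
      then show ?thesis by (rule fn.subspace_scale[OF subspace_Tlt])
    next
      case False
      then obtain j where j: "bs ! i = d j" using W(6)[OF i] by auto
      have "bs ! i \<in> set bs" using i W(2) by simp
      then have "j \<noteq> q" using fresh j by auto
      then show ?thesis using fn.subspace_0[OF subspace_Tlt] by (simp add: j d_e)
    qed
  qed
  finally show ?thesis .
qed

end

lemma sum_by_letter:
  fixes h :: "nat \<Rightarrow> 'x::comm_monoid_add"
  assumes "finite Y"
  shows "(\<Sum>\<alpha>\<in>Y. \<Sum>i\<in>{i. i < N \<and> xs ! i = \<alpha>}. h i) = (\<Sum>i\<in>{i. i < N \<and> xs ! i \<in> Y}. h i)"
proof -
  have "(\<Sum>\<alpha>\<in>Y. \<Sum>i\<in>{i. i < N \<and> xs ! i = \<alpha>}. h i) =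
      (\<Sum>\<alpha>\<in>Y. \<Sum>i\<in>{i \<in> {i. i < N \<and> xs ! i \<in> Y}. xs ! i = \<alpha>}. h i)"
    by (intro sum.cong) auto
  also have "\<dots> = (\<Sum>i\<in>{i. i < N \<and> xs ! i \<in> Y}. h i)"
    by (rule sum.group) (use assms in auto)
  finally show ?thesis .
qed

lemma card_letters: "card {i. i < length xs \<and> xs ! i \<in> Y} = size (filter_mset (\<lambda>x. x \<in> Y) (mset xs))"
  unfolding mset_filter[symmetric] size_mset length_filter_conv_card ..

section \<open>Monomials of the enveloping algebra and submodules\<close>

context mackey_tensors
begin

text \<open>A monomial of the enveloping algebra, the head of the list acting first. Monomials
  suffice since they are only used to move inside submodules, which are closed under sums.\<close>

primrec acts :: "('a \<Rightarrow> 'a) list \<Rightarrow> 'a mixed \<Rightarrow> 'a mixed" where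
  "acts [] t = t"
| "acts (a # u) t = acts u (act a t)"

lemma acts_append: "acts (u @ u') t = acts u' (acts u t)"
  by (induction u arbitrary: t) auto

lemma acts_simps:
  assumes "set u \<subseteq> g"
  shows "acts u (x + y) = acts u x + acts u y" "acts u (fscale c x) = fscale c (acts u x)"
    "acts u 0 = 0" "acts u (sum h A) = (\<Sum>i\<in>A. acts u (h i))"
proof -
  show 1: "acts u (x + y) = acts u x + acts u y" for x y
    using assms by (induction u arbitrary: x y) (simp_all only: acts.simps list.set insert_subset act_simps)
  show "acts u (fscale c x) = fscale c (acts u x)"
    using assms by (induction u arbitrary: x) (simp_all only: acts.simps list.set insert_subset act_simps)
  show 0: "acts u 0 = 0"
    using assms by (induction u) (simp_all only: acts.simps list.set insert_subset act_simps)
  show "acts u (sum h A) = (\<Sum>i\<in>A. acts u (h i))"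
    by (induction A rule: infinite_finite_induct) (simp_all only: 0 1 sum.infinite sum.empty sum.insert not_False_eq_True)
qed

definition gstable :: "'a mixed set \<Rightarrow> bool" where
  "gstable M \<longleftrightarrow> fn.subspace M \<and> (\<forall>a\<in>g. \<forall>x\<in>M. act a x \<in> M)"

lemma gstableD: "gstable M \<Longrightarrow> fn.subspace M" "gstable M \<Longrightarrow> a \<in> g \<Longrightarrow> x \<in> M \<Longrightarrow> act a x \<in> M"
  by (auto simp: gstable_def)

lemma gstable_acts: "gstable M \<Longrightarrow> set u \<subseteq> g \<Longrightarrow> x \<in> M \<Longrightarrow> acts u x \<in> M"
  by (induction u arbitrary: x) (auto dest: gstableD)

lemma gstable_Tlt: "gstable (Tlt k)"
  using subspace_Tlt Tlt_act by (auto simp: gstable_def)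

lemma subspace_Tl: "fn.subspace Tl"
proof (rule fn.subspaceI, goal_cases)
  case 1
  have "(0 :: 'a mixed) \<in> Mix" unfolding Mix_eq by (rule fn.span_zero)
  then show ?case using contraction_simps(3) by (simp add: traceless_def)
next
  case (2 x y)
  then have "x + y \<in> Mix" unfolding traceless_def Mix_eq by (auto intro: fn.span_add)
  with 2 show ?case using contraction_simps(1) by (simp add: traceless_def)
next
  case (3 c x)
  then have "fscale c x \<in> Mix" unfolding traceless_def Mix_eq by (auto intro: fn.span_scale)
  with 3 show ?case using contraction_simps(2) by (simp add: traceless_def)
qed

lemma gstable_Tl: "gstable Tl"
  using subspace_Tl Tl_act by (auto simp: gstable_def)

abbreviation "spn k \<Omega> \<equiv> fn.span (ptw ` \<Omega> \<union> Tlt k)"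

lemma Tlt_spn: "x \<in> Tlt k \<Longrightarrow> x \<in> spn k \<Omega>"
  by (rule fn.span_base) simp

lemma word_spn: "(bs, cs) \<in> \<Omega> \<Longrightarrow> pt bs cs \<in> spn k \<Omega>"
  by (rule fn.span_base) force

subsection \<open>Polarization\<close>

text \<open>\<open>red k \<Omega> \<Omega>'\<close>: modulo the filtration step \<open>Tlt k\<close>, a traceless combination of words in \<open>\<Omega>\<close> can be
  recovered from those elements of the submodule it generates that are combinations of words in \<open>\<Omega>'\<close>.\<close>

definition red :: "nat \<Rightarrow> (('a \<Rightarrow> complex) list \<times> 'a list) set \<Rightarrow> (('a \<Rightarrow> complex) list \<times> 'a list) set \<Rightarrow> bool" where
  "red k \<Omega> \<Omega>' \<longleftrightarrow> (\<forall>t M. t \<in> Tl \<longrightarrow> t \<in> spn k \<Omega> \<longrightarrow> gstable M \<longrightarrow> Tlt k \<subseteq> M \<longrightarrow>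
     (\<forall>u. set u \<subseteq> g \<longrightarrow> acts u t \<in> spn k \<Omega>' \<longrightarrow> acts u t \<in> M) \<longrightarrow> t \<in> M)"

lemma redD:
  assumes "red k \<Omega> \<Omega>'" "t \<in> Tl" "t \<in> spn k \<Omega>" "gstable M" "Tlt k \<subseteq> M"
    "\<And>u. set u \<subseteq> g \<Longrightarrow> acts u t \<in> spn k \<Omega>' \<Longrightarrow> acts u t \<in> M"
  shows "t \<in> M"
  using assms unfolding red_def by simp

lemma red_trans:
  assumes 1: "red k \<Omega> \<Omega>'" and 2: "red k \<Omega>' \<Omega>''"
  shows "red k \<Omega> \<Omega>''"
  unfolding red_def
proof (intro allI impI)
  fix t M
  assume t: "t \<in> Tl" "t \<in> spn k \<Omega>" and M: "gstable M" "Tlt k \<subseteq> M"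
    and *: "\<forall>u. set u \<subseteq> g \<longrightarrow> acts u t \<in> spn k \<Omega>'' \<longrightarrow> acts u t \<in> M"
  show "t \<in> M"
  proof (rule redD[OF 1 t M])
    fix u assume u: "set u \<subseteq> g" "acts u t \<in> spn k \<Omega>'"
    show "acts u t \<in> M"
    proof (rule redD[OF 2 gstable_acts[OF gstable_Tl u(1) t(1)] u(2) M])
      fix u' assume u': "set u' \<subseteq> g" "acts u' (acts u t) \<in> spn k \<Omega>''"
      then show "acts u' (acts u t) \<in> M" using *[rule_format, of "u @ u'"] u(1) by (simp add: acts_append)
    qed
  qed
qed

lemma red_mono:
  assumes "red k \<Omega> \<Omega>'" "\<Omega>0 \<subseteq> \<Omega>" "\<Omega>' \<subseteq> \<Omega>1"
  shows "red k \<Omega>0 \<Omega>1"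
proof -
  have "spn k \<Omega>0 \<subseteq> spn k \<Omega>" "spn k \<Omega>' \<subseteq> spn k \<Omega>1"
    by (intro fn.span_mono Un_mono image_mono assms order_refl)+
  then show ?thesis using assms(1) unfolding red_def by (meson subsetD)
qed

text \<open>Common core of both polarization steps. Replacing letters by \<open>F\<close> and
  restoring them by \<open>R\<close> amounts to the nonzero scalar \<open>s\<close>, up to
  \<open>Tlt k\<close> and an operator \<open>K\<close> that vanishes on traceless tensors. As
  \<open>M\<close> contains all \<open>F \<alpha> t\<close>, it contains
  \<open>fscale s t\<close>.\<close>

lemma red_step:
  assumes A: "finite A" and g: "\<And>\<alpha>. \<alpha> \<in> A \<Longrightarrow> F \<alpha> \<in> g" "\<And>\<alpha>. \<alpha> \<in> A \<Longrightarrow> R \<alpha> \<in> g"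
    and F: "\<And>\<alpha> w. \<alpha> \<in> A \<Longrightarrow> w \<in> \<Omega> \<Longrightarrow> act (F \<alpha>) (ptw w) \<in> spn k \<Omega>'"
    and K: "\<And>x y. K (x + y) = K x + K y" "\<And>c x. K (fscale c x) = fscale c (K x)"
      "\<And>x. x \<in> Tlt k \<Longrightarrow> K x \<in> Tlt k" "\<And>t. t \<in> Tl \<Longrightarrow> K t = 0"
    and R: "\<And>w. w \<in> \<Omega> \<Longrightarrow> (\<Sum>\<alpha>\<in>A. act (R \<alpha>) (act (F \<alpha>) (ptw w))) - fscale s (ptw w) + K (ptw w) \<in> Tlt k"
    and s: "s \<noteq> 0"
  shows "red k \<Omega> \<Omega>'"
  unfolding red_def
proof (intro allI impI)
  fix t M
  assume t: "t \<in> Tl" "t \<in> spn k \<Omega>" and M: "gstable M" "Tlt k \<subseteq> M"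
    and *: "\<forall>u. set u \<subseteq> g \<longrightarrow> acts u t \<in> spn k \<Omega>' \<longrightarrow> acts u t \<in> M"
  have "act (F \<alpha>) t \<in> spn k \<Omega>'" if \<alpha>: "\<alpha> \<in> A" for \<alpha>
    using t(2)
  proof (induction rule: fn.span_induct_alt)
    case base
    show ?case unfolding act_simps[OF g(1)[OF \<alpha>]] by (rule fn.span_zero)
  next
    case (step c x y)
    have "act (F \<alpha>) x \<in> spn k \<Omega>'"
      using step(1) F[OF \<alpha>] Tlt_spn[OF Tlt_act[OF g(1)[OF \<alpha>]]] by blast
    then show ?case unfolding act_simps[OF g(1)[OF \<alpha>]] by (intro fn.span_add fn.span_scale step(2))
  qed
  then have FM: "act (F \<alpha>) t \<in> M" if "\<alpha> \<in> A" for \<alpha>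
    using *[rule_format, of "[F \<alpha>]"] g that by simp
  let ?L = "\<lambda>t. (\<Sum>\<alpha>\<in>A. act (R \<alpha>) (act (F \<alpha>) t)) - fscale s t + K t"
  have L1: "?L (x + y) = ?L x + ?L y" for x y
  proof -
    have "(\<Sum>\<alpha>\<in>A. act (R \<alpha>) (act (F \<alpha>) (x + y))) =
        (\<Sum>\<alpha>\<in>A. act (R \<alpha>) (act (F \<alpha>) x)) + (\<Sum>\<alpha>\<in>A. act (R \<alpha>) (act (F \<alpha>) y))"
      unfolding sum.distrib[symmetric] by (intro sum.cong refl) (simp only: act_simps g)
    then show ?thesis by (simp only: K fn.scale_right_distrib) (simp only: algebra_simps)
  qed
  have L2: "?L (fscale c x) = fscale c (?L x)" for c x
  proof -
    have "(\<Sum>\<alpha>\<in>A. act (R \<alpha>) (act (F \<alpha>) (fscale c x))) = fscale c (\<Sum>\<alpha>\<in>A. act (R \<alpha>) (act (F \<alpha>) x))"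
      unfolding fn.scale_sum_right by (intro sum.cong refl) (simp only: act_simps g)
    moreover have "fscale s (fscale c x) = fscale c (fscale s x)" by (simp add: mult.commute)
    ultimately show ?thesis by (simp only: K fn.scale_right_distrib fn.scale_right_diff_distrib)
  qed
  have "?L t \<in> Tlt k"
    using t(2)
  proof (induction rule: fn.span_induct_alt)
    case base
    have "?L (fscale 0 0) = fscale 0 (?L 0)" by (rule L2)
    then have "?L 0 = 0" by (simp only: fn.scale_zero_left)
    then show ?case by (simp only: fn.subspace_0[OF subspace_Tlt])
  next
    case (step c x y)
    from step(1) have "?L x \<in> Tlt k"
    proof
      assume "x \<in> ptw ` \<Omega>"
      then show ?thesis using R by blast
    next
      assume x: "x \<in> Tlt k"
      then show ?thesis
        by (intro fn.subspace_add[OF subspace_Tlt] fn.subspace_diff[OF subspace_Tlt]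
            fn.subspace_sum[OF subspace_Tlt] fn.subspace_scale[OF subspace_Tlt] K Tlt_act g x)
    qed
    then show ?case
      unfolding L1 L2 by (rule fn.subspace_add[OF subspace_Tlt fn.subspace_scale[OF subspace_Tlt] step(2)])
  qed
  then have "?L t \<in> M" using M(2) by blast
  moreover have "(\<Sum>\<alpha>\<in>A. act (R \<alpha>) (act (F \<alpha>) t)) \<in> M"
    by (intro fn.subspace_sum[OF gstableD(1)[OF M(1)]] gstableD(2)[OF M(1)] g FM)
  ultimately have "(\<Sum>\<alpha>\<in>A. act (R \<alpha>) (act (F \<alpha>) t)) - ?L t \<in> M"
    by (intro fn.subspace_diff[OF gstableD(1)[OF M(1)]])
  then have "fscale s t \<in> M" using K(4)[OF t(1)] by simp
  then have "fscale (1 / s) (fscale s t) \<in> M" by (rule fn.subspace_scale[OF gstableD(1)[OF M(1)]])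
  then show "t \<in> M" using s by simp
qed

text \<open>In the next two definitions \<open>C\<close> collects the letters already replaced by fresh ones and \<open>R\<close> the \<open>s\<close>
  letters from \<open>Y\<close> still to be replaced.\<close>

definition wordsF where
  "wordsF k Y \<C> s \<D> = {(bs, cs) \<in> words. nq bs \<le> k \<and> cs \<in> \<D> \<and>
     (\<exists>C\<in>\<C>. \<exists>R. mset bs = C + R \<and> set_mset R \<subseteq> Y \<and> size R = s)}"

definition wordsV where
  "wordsV Y \<B> C s = {(bs, cs) \<in> words. bs \<in> \<B> \<and> (\<exists>R. mset cs = C + R \<and> set_mset R \<subseteq> Y \<and> size R = s)}"

lemma mset_split_update:
  assumes "mset bs = C + R" "i < length bs" "bs ! i \<in> Y" "set_mset C \<inter> Y = {}" "set_mset R \<subseteq> Y" "size R = Suc s"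
  shows "\<exists>R'. mset (bs[i := b]) = add_mset b C + R' \<and> set_mset R' \<subseteq> Y \<and> size R' = s"
proof (intro exI[of _ "R - {#bs ! i#}"] conjI)
  have "bs ! i \<in># mset bs" using assms(2) by simp
  then have R: "bs ! i \<in># R" using assms by auto
  have "mset (bs[i := b]) = add_mset b (mset bs - {#bs ! i#})" using assms(2) by (simp add: mset_update)
  also have "mset bs - {#bs ! i#} = C + (R - {#bs ! i#})" unfolding assms(1) by (rule diff_union_single_conv[OF R])
  finally show "mset (bs[i := b]) = add_mset b C + (R - {#bs ! i#})" by simp
  show "set_mset (R - {#bs ! i#}) \<subseteq> Y" using assms(5) by (meson in_diffD subset_iff)
  show "size (R - {#bs ! i#}) = s" using R assms(6) by (simp add: size_Diff_singleton)
qed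

text \<open>Makes the scalar in \<open>red_step\<close> the same for all words of a family: it
  counts positions with old letters, with repetition.\<close>

lemma count_split:
  assumes "mset bs = C + R" "set_mset C \<inter> Y = {}" "set_mset R \<subseteq> Y"
  shows "card {i. i < length bs \<and> bs ! i \<in> Y} = size R"
proof -
  have "filter_mset (\<lambda>x. x \<in> Y) C = {#}" 
    by (rule multiset_eqI) (use assms(2) in \<open>auto simp: count_eq_zero_iff\<close>)
  moreover have "filter_mset (\<lambda>x. x \<in> Y) R = R" using assms(3) by (simp add: filter_mset_eq_conv subset_iff)
  ultimately show ?thesis unfolding card_letters assms(1) by simp
qed

text \<open>Replacing an occurrence of \<alpha> by the fresh letter \<open>b\<close> and putting
  \<alpha> back returns the word once for each occurrence of \<alpha>. Summed over \<open>Y\<close>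
  this gives the factor \<open>Suc s\<close>, without contractions. \<open>type\<close> makes
  replacement possible in both directions, and \<open>fresh\<close> keeps both operators away from
  the vectors.\<close>

lemma red_functional:
  assumes X: "finite X" "X \<subseteq> B" and J: "finite J" and Y: "Y \<subseteq> X" and b: "b \<in> B" "b \<notin> X"
    and type: "\<And>\<alpha>. \<alpha> \<in> Y \<Longrightarrow> \<alpha> \<in> Q \<longleftrightarrow> b \<in> Q"
    and fresh: "\<And>q. d q \<in> insert b Y \<Longrightarrow> e q \<notin> J"
    and C: "\<And>C. C \<in> \<C> \<Longrightarrow> set_mset C \<subseteq> X \<and> set_mset C \<inter> Y = {}"
    and D': "\<And>cs. cs \<in> \<D> \<Longrightarrow> set cs \<subseteq> J"
  shows "red k (wordsF k Y \<C> (Suc s) \<D>) (wordsF k Y (add_mset b ` \<C>) s \<D>)"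
proof -
  let ?sub = "\<lambda>\<alpha> \<beta> bs cs. \<Sum>i\<in>{i. i < m \<and> bs ! i = \<alpha>}. pt (bs[i := \<beta>]) cs"
  have "\<forall>\<alpha>\<in>Y. \<exists>F\<in>g. (\<forall>bs cs. (bs, cs) \<in> words \<longrightarrow> nq bs \<le> k \<longrightarrow> set bs \<subseteq> X \<longrightarrow> set cs \<subseteq> J \<longrightarrow>
      act F (pt bs cs) - ?sub \<alpha> b bs cs \<in> Tlt k)"
  proof
    fix \<alpha> assume "\<alpha> \<in> Y"
    then show "\<exists>F\<in>g. (\<forall>bs cs. (bs, cs) \<in> words \<longrightarrow> nq bs \<le> k \<longrightarrow> set bs \<subseteq> X \<longrightarrow> set cs \<subseteq> J \<longrightarrow>
      act F (pt bs cs) - ?sub \<alpha> b bs cs \<in> Tlt k)"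
      by (intro replace_functional[OF X J, of \<alpha> b k]) (use Y b type fresh in auto)
  qed
  from bchoice[OF this[unfolded Bex_def]] obtain F where F0: "\<forall>\<alpha>\<in>Y. F \<alpha> \<in> g \<and>
      (\<forall>bs cs. (bs, cs) \<in> words \<longrightarrow> nq bs \<le> k \<longrightarrow> set bs \<subseteq> X \<longrightarrow> set cs \<subseteq> J \<longrightarrow>
        act (F \<alpha>) (pt bs cs) - ?sub \<alpha> b bs cs \<in> Tlt k)" ..
  have F: "\<And>\<alpha>. \<alpha> \<in> Y \<Longrightarrow> F \<alpha> \<in> g" "\<And>\<alpha> bs cs. \<alpha> \<in> Y \<Longrightarrow> (bs, cs) \<in> words \<Longrightarrow> nq bs \<le> k \<Longrightarrow>
      set bs \<subseteq> X \<Longrightarrow> set cs \<subseteq> J \<Longrightarrow> act (F \<alpha>) (pt bs cs) - ?sub \<alpha> b bs cs \<in> Tlt k"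
    using F0 by simp_all
  \<comment> \<open>The restoring operators must be controlled on the alphabet enlarged by
    \<open>b\<close>, since they are applied after \<open>b\<close> has been written.\<close>
  have "\<forall>\<alpha>\<in>Y. \<exists>R\<in>g. (\<forall>bs cs. (bs, cs) \<in> words \<longrightarrow> nq bs \<le> k \<longrightarrow> set bs \<subseteq> insert b X \<longrightarrow> set cs \<subseteq> J \<longrightarrow>
      act R (pt bs cs) - ?sub b \<alpha> bs cs \<in> Tlt k)"
  proof
    fix \<alpha> assume "\<alpha> \<in> Y"
    then show "\<exists>R\<in>g. (\<forall>bs cs. (bs, cs) \<in> words \<longrightarrow> nq bs \<le> k \<longrightarrow> set bs \<subseteq> insert b X \<longrightarrow> set cs \<subseteq> J \<longrightarrow>
      act R (pt bs cs) - ?sub b \<alpha> bs cs \<in> Tlt k)"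
      by (intro replace_functional[of "insert b X" J b \<alpha> k]) (use X J Y b type fresh in auto)
  qed
  from bchoice[OF this[unfolded Bex_def]] obtain R where R0: "\<forall>\<alpha>\<in>Y. R \<alpha> \<in> g \<and>
      (\<forall>bs cs. (bs, cs) \<in> words \<longrightarrow> nq bs \<le> k \<longrightarrow> set bs \<subseteq> insert b X \<longrightarrow> set cs \<subseteq> J \<longrightarrow>
        act (R \<alpha>) (pt bs cs) - ?sub b \<alpha> bs cs \<in> Tlt k)" ..
  have R: "\<And>\<alpha>. \<alpha> \<in> Y \<Longrightarrow> R \<alpha> \<in> g" "\<And>\<alpha> bs cs. \<alpha> \<in> Y \<Longrightarrow> (bs, cs) \<in> words \<Longrightarrow> nq bs \<le> k \<Longrightarrow>
      set bs \<subseteq> insert b X \<Longrightarrow> set cs \<subseteq> J \<Longrightarrow> act (R \<alpha>) (pt bs cs) - ?sub b \<alpha> bs cs \<in> Tlt k"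
    using R0 by simp_all
  have W: "(bs, cs) \<in> words" "nq bs \<le> k" "set bs \<subseteq> X" "set cs \<subseteq> J" "b \<notin> set bs"
    if w: "(bs, cs) \<in> wordsF k Y \<C> (Suc s) \<D>" for bs cs
  proof -
    show "(bs, cs) \<in> words" "nq bs \<le> k" "set cs \<subseteq> J" using that D' by (auto simp: wordsF_def)
    obtain C R where CR: "mset bs = C + R" "C \<in> \<C>" "set_mset R \<subseteq> Y" using w by (auto simp: wordsF_def)
    have "set bs = set_mset C \<union> set_mset R" unfolding set_mset_mset[symmetric] CR(1) by simp
    then show "set bs \<subseteq> X" using C[OF CR(2)] CR(3) Y by auto
    then show "b \<notin> set bs" using b by blast
  qed
  have W': "(bs[i := b], cs) \<in> wordsF k Y (add_mset b ` \<C>) s \<D>"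
    if w: "(bs, cs) \<in> wordsF k Y \<C> (Suc s) \<D>" and i: "i < m" "bs ! i \<in> Y" for bs cs i
  proof -
    obtain C R where CR: "mset bs = C + R" "C \<in> \<C>" "set_mset R \<subseteq> Y" "size R = Suc s"
      using w by (auto simp: wordsF_def)
    have "i < length bs" using i wordD(2)[OF W(1)[OF w]] by simp
    from mset_split_update[OF CR(1) this i(2) conjunct2[OF C[OF CR(2)]] CR(3,4), of b] CR(2)
    have "\<exists>C\<in>add_mset b ` \<C>. \<exists>R. mset (bs[i := b]) = C + R \<and> set_mset R \<subseteq> Y \<and> size R = s" by blast
    moreover have "b \<in> Vs \<or> bs ! i \<notin> Vs" using Q_iff[OF b(1)] type[OF i(2)] Q_not_Vs by blast
    then have "nq (bs[i := b]) \<le> k" using nq_upd_le[of b bs i] W(2)[OF w] by simp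
    moreover have "cs \<in> \<D>" using w by (auto simp: wordsF_def)
    ultimately show ?thesis using word_upd1[OF W(1)[OF w] b(1)] by (simp add: wordsF_def)
  qed
  show ?thesis
  proof (rule red_step[where A = Y and F = F and R = R and s = "of_nat (Suc s)" and K = "\<lambda>_. 0"])
    show "finite Y" using X Y finite_subset by blast
    show "F \<alpha> \<in> g" "R \<alpha> \<in> g" if "\<alpha> \<in> Y" for \<alpha> using F R that by auto
  next
    fix \<alpha> w assume \<alpha>: "\<alpha> \<in> Y" and w: "w \<in> wordsF k Y \<C> (Suc s) \<D>"
    obtain bs cs where w': "w = (bs, cs)" by (cases w)
    note WW = W[OF w[unfolded w']]
    have "act (F \<alpha>) (pt bs cs) = (act (F \<alpha>) (pt bs cs) - ?sub \<alpha> b bs cs) + ?sub \<alpha> b bs cs" by simp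
    also have "\<dots> \<in> spn k (wordsF k Y (add_mset b ` \<C>) s \<D>)"
      by (intro fn.span_add Tlt_spn F \<alpha> WW fn.span_sum word_spn W'[OF w[unfolded w']]) (use \<alpha> in auto)
    finally show "act (F \<alpha>) (ptw w) \<in> spn k (wordsF k Y (add_mset b ` \<C>) s \<D>)" by (simp add: w')
  next
    fix w assume w: "w \<in> wordsF k Y \<C> (Suc s) \<D>"
    obtain bs cs where w': "w = (bs, cs)" by (cases w)
    note WW = W[OF w[unfolded w']]
    note lw = wordD[OF WW(1)]
    have RF: "act (R \<alpha>) (act (F \<alpha>) (pt bs cs)) - (\<Sum>i\<in>{i. i < m \<and> bs ! i = \<alpha>}. pt bs cs) \<in> Tlt k"
      if \<alpha>: "\<alpha> \<in> Y" for \<alpha>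
    proof -
      have 1: "act (R \<alpha>) (act (F \<alpha>) (pt bs cs) - ?sub \<alpha> b bs cs) \<in> Tlt k"
        by (intro Tlt_act R F \<alpha> WW)
      have 2: "act (R \<alpha>) (pt (bs[i := b]) cs) - pt bs cs \<in> Tlt k" if i: "i < m" "bs ! i = \<alpha>" for i
      proof -
        have w2: "(bs[i := b], cs) \<in> wordsF k Y (add_mset b ` \<C>) s \<D>"
          by (rule W'[OF w[unfolded w']]) (use i \<alpha> in auto)
        \<comment> \<open>The fresh letter stands at just one place, so restoring \<alpha> undoes
          exactly this replacement.\<close>
        have "{i'. i' < m \<and> bs[i := b] ! i' = b} = {i}"
        proof -
          have "bs ! i' \<noteq> b" if "i' < m" for i' using that WW(5) lw(2) nth_mem by metis
          then show ?thesis using i lw(2) by (auto simp: nth_list_update)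
        qed
        then have "?sub b \<alpha> (bs[i := b]) cs = pt bs cs" using i(2) by (simp add: list_update_same_conv) (metis list_update_id)
        moreover have "act (R \<alpha>) (pt (bs[i := b]) cs) - ?sub b \<alpha> (bs[i := b]) cs \<in> Tlt k"
        proof (rule R(2)[OF \<alpha>])
          show "(bs[i := b], cs) \<in> words" "nq (bs[i := b]) \<le> k" using w2 by (auto simp: wordsF_def)
          show "set (bs[i := b]) \<subseteq> insert b X" using set_update_subset_insert[of bs i b] WW(3) by blast
        qed (rule WW)
        ultimately show ?thesis by simp
      qed
      have "act (R \<alpha>) (act (F \<alpha>) (pt bs cs)) - (\<Sum>i\<in>{i. i < m \<and> bs ! i = \<alpha>}. pt bs cs) =
          act (R \<alpha>) (act (F \<alpha>) (pt bs cs) - ?sub \<alpha> b bs cs) +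
          (\<Sum>i\<in>{i. i < m \<and> bs ! i = \<alpha>}. act (R \<alpha>) (pt (bs[i := b]) cs) - pt bs cs)"
        unfolding act_simps[OF R(1)[OF \<alpha>]] sum_subtractf by (simp only: algebra_simps)
      also have "\<dots> \<in> Tlt k"
        by (intro fn.subspace_add[OF subspace_Tlt] 1 fn.subspace_sum[OF subspace_Tlt] 2) auto
      finally show ?thesis .
    qed
    obtain C R0 where CR: "mset bs = C + R0" "C \<in> \<C>" "set_mset R0 \<subseteq> Y" "size R0 = Suc s"
      using w by (auto simp: wordsF_def w')
    have "card {i. i < m \<and> bs ! i \<in> Y} = Suc s"
      using count_split[OF CR(1) conjunct2[OF C[OF CR(2)]] CR(3)] CR(4) lw(2) by simp
    then have "fscale (of_nat (Suc s)) (pt bs cs) = (\<Sum>i\<in>{i. i < m \<and> bs ! i \<in> Y}. pt bs cs)"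
      by (simp only: fn.sum_constant_scale)
    also have "\<dots> = (\<Sum>\<alpha>\<in>Y. \<Sum>i\<in>{i. i < m \<and> bs ! i = \<alpha>}. pt bs cs)"
      by (rule sum_by_letter[symmetric]) (use X Y finite_subset in blast)
    finally have "(\<Sum>\<alpha>\<in>Y. act (R \<alpha>) (act (F \<alpha>) (ptw w))) - fscale (of_nat (Suc s)) (ptw w) + 0 =
        (\<Sum>\<alpha>\<in>Y. act (R \<alpha>) (act (F \<alpha>) (pt bs cs)) - (\<Sum>i\<in>{i. i < m \<and> bs ! i = \<alpha>}. pt bs cs))"
      by (simp only: sum_subtractf w' fst_conv snd_conv add_0_right)
    also have "\<dots> \<in> Tlt k"
      by (intro fn.subspace_sum[OF subspace_Tlt] RF)
    finally show "(\<Sum>\<alpha>\<in>Y. act (R \<alpha>) (act (F \<alpha>) (ptw w))) - fscale (of_nat (Suc s)) (ptw w) + 0 \<in> Tlt k" .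
  qed (simp_all add: fn.subspace_0[OF subspace_Tlt] del: of_nat_Suc)
qed

text \<open>As in \<open>red_functional\<close>, but restoring a vector letter also acts on the
  functionals and produces contractions, collected in \<open>?K\<close>. The hypothesis
  \<open>Bs\<close> on the indices of the functionals controls the contractions at positions outside
  the old letters.\<close>

lemma red_vector:
  assumes A: "finite A" "b \<notin> A" and Bs: "\<And>bs i. bs \<in> \<B> \<Longrightarrow> d i \<in> set bs \<Longrightarrow> i \<in> A"
    and nqB: "\<And>bs. bs \<in> \<B> \<Longrightarrow> nq bs \<le> k"
    and C: "set_mset C \<inter> e ` A = {}" "e b \<notin># C"
  shows "red k (wordsV (e ` A) \<B> C (Suc s)) (wordsV (e ` A) \<B> (add_mset (e b) C) s)"
proof -
  let ?F = "\<lambda>a. rank_one (e b) a" and ?R = "\<lambda>a. rank_one (e a) b"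
  \<comment> \<open>Contractions arise only at positions with an old letter, and these depend on the
    word. Summing over all positions gives one linear operator that vanishes on traceless tensors;
    the surplus is absorbed by \<open>Tlt k\<close>.\<close>
  let ?K = "\<lambda>t. \<Sum>i<m. \<Sum>j<n. kop (d b) (e b) i j t"
  have W: "(bs, cs) \<in> words" "nq bs \<le> k" "d b \<notin> set bs" "e b \<notin> set cs"
    if w: "(bs, cs) \<in> wordsV (e ` A) \<B> C (Suc s)" for bs cs
  proof -
    show "(bs, cs) \<in> words" "nq bs \<le> k" "d b \<notin> set bs"
      using that nqB A(2) Bs by (auto simp: wordsV_def)
    obtain R where R: "mset cs = C + R" "set_mset R \<subseteq> e ` A" using w by (auto simp: wordsV_def)
    have "e b \<notin># R" using R(2) A(2) by (auto simp: inj_e)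
    then have "e b \<notin># mset cs" using C(2) R(1) by simp
    then show "e b \<notin> set cs" by simp
  qed
  have W': "(bs, cs[j := e b]) \<in> wordsV (e ` A) \<B> (add_mset (e b) C) s"
    if w: "(bs, cs) \<in> wordsV (e ` A) \<B> C (Suc s)" and j: "j < n" "cs ! j \<in> e ` A" for bs cs j
  proof -
    obtain R where R: "mset cs = C + R" "set_mset R \<subseteq> e ` A" "size R = Suc s"
      using w by (auto simp: wordsV_def)
    have "j < length cs" using j wordD(3)[OF W(1)[OF w]] by simp
    from mset_split_update[OF R(1) this j(2) C(1) R(2,3), of "e b"]
    show ?thesis using word_upd2[OF W(1)[OF w], of "e b"] w by (simp add: wordsV_def)
  qed
  show ?thesis
  proof (rule red_step[where A = A and F = ?F and R = ?R and s = "of_nat (Suc s)" and K = ?K])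
    show "finite A" by fact
  next
    fix a w assume a: "a \<in> A" and w: "w \<in> wordsV (e ` A) \<B> C (Suc s)"
    obtain bs cs where w': "w = (bs, cs)" by (cases w)
    note WW = W[OF w[unfolded w']]
    let ?s = "\<Sum>j\<in>{j. j < n \<and> cs ! j = e a}. pt bs (cs[j := e b])"
    have "act (?F a) (pt bs cs) = (act (?F a) (pt bs cs) - ?s) + ?s" by simp
    also have "\<dots> \<in> spn k (wordsV (e ` A) \<B> (add_mset (e b) C) s)"
      by (intro fn.span_add Tlt_spn replace_vector WW fn.span_sum word_spn W'[OF w[unfolded w']]) (use a in auto)
    finally show "act (?F a) (ptw w) \<in> spn k (wordsV (e ` A) \<B> (add_mset (e b) C) s)" by (simp add: w')
  next
    show "?K (x + y) = ?K x + ?K y" for x y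
      unfolding sum.distrib[symmetric] by (intro sum.cong refl kop_simps) auto
    show "?K (fscale c x) = fscale c (?K x)" for c x
      unfolding fn.scale_sum_right by (intro sum.cong refl kop_simps) auto
    show "?K x \<in> Tlt k" if "x \<in> Tlt k" for x
      by (intro fn.subspace_sum[OF subspace_Tlt] kop_Tlt that d_in_Vs) auto
    show "?K t = 0" if "t \<in> Tl" for t
      by (intro sum.neutral ballI kop_traceless that) auto
  next
    fix w assume w: "w \<in> wordsV (e ` A) \<B> C (Suc s)"
    obtain bs cs where w': "w = (bs, cs)" by (cases w)
    note WW = W[OF w[unfolded w']]
    note lw = wordD[OF WW(1)]
    let ?k = "\<lambda>j. \<Sum>i<m. kop (d b) (e b) i j (pt bs cs)"
    let ?J = "\<lambda>a. {j. j < n \<and> cs ! j = e a}"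
    have 2: "act (?R a) (pt bs (cs[j := e b])) = pt bs cs - ?k j" if j: "j < n" "cs ! j = e a" for a j
    proof -
      \<comment> \<open>Restoring \<open>e a\<close> turns each functional into \<open>d b\<close>,
        weighted by its value at \<open>e a\<close>. As \<open>e a\<close> is the letter that stood
        at \<open>j\<close>, this is the contraction of positions \<open>i\<close> and
        \<open>j\<close>.\<close>
      have 1: "(\<Sum>i<m. fscale (- (bs ! i) (e a)) (pt (bs[i := d b]) (cs[j := e b]))) = - ?k j"
        unfolding sum_negf[symmetric]
        by (intro sum.cong refl) (use kop_pure[OF lw(1) _ j(1), of _ "d b" "e b"] j(2) in simp)
      have z: "d b (cs[j := e b] ! j') = (if j' = j then 1 else 0)" if j': "j' < n" for j'
      proof (cases "j' = j")
        case True
        then show ?thesis using j lw(3) by (simp add: d_e)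
      next
        case False
        obtain i where i: "cs ! j' = e i" using lw(7)[OF j'] by blast
        moreover have "cs ! j' \<in> set cs" using j' lw(3) by simp
        ultimately have "i \<noteq> b" using WW(4) by auto
        then show ?thesis using False i by (simp add: d_e)
      qed
      have "(\<Sum>j'<n. fscale (d b (cs[j := e b] ! j')) (pt bs (cs[j := e b, j' := e a]))) =
          (\<Sum>j'<n. if j' = j then pt bs cs else 0)"
      proof (intro sum.cong refl)
        fix j' assume "j' \<in> {..<n}"
        then show "fscale (d b (cs[j := e b] ! j')) (pt bs (cs[j := e b, j' := e a])) = (if j' = j then pt bs cs else 0)"
          using z[of j'] j(2) by simp (metis list_update_id)
      qed
      then show ?thesis
        unfolding act_rank_one[OF lists_of_upd2[OF lw(1)]] 1 using j by simp
    qed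
    have RF: "act (?R a) (act (?F a) (pt bs cs)) - (\<Sum>j\<in>?J a. pt bs cs - ?k j) \<in> Tlt k" for a
    proof -
      have "act (?R a) (act (?F a) (pt bs cs)) - (\<Sum>j\<in>?J a. pt bs cs - ?k j) =
          act (?R a) (act (?F a) (pt bs cs) - (\<Sum>j\<in>?J a. pt bs (cs[j := e b])))"
        unfolding act_simps[OF rank_one_in_g]
        by (intro arg_cong2[of _ _ _ _ "(-)"] sum.cong refl) (use 2 in simp)
      also have "\<dots> \<in> Tlt k" by (intro Tlt_act rank_one_in_g replace_vector WW)
      finally show ?thesis .
    qed
    \<comment> \<open>At a position without an old letter the contraction with \<open>d q\<close> is
      zero, because \<open>q\<close> lies in \<open>A\<close>, and the contraction with a letter
      from \<open>Q\<close> has lower degree.\<close>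
    have rest: "?k j \<in> Tlt k" if j: "j < n" "cs ! j \<notin> e ` A" for j
    proof (rule fn.subspace_sum[OF subspace_Tlt])
      fix i assume "i \<in> {..<m}"
      then have i: "i < m" by simp
      show "kop (d b) (e b) i j (pt bs cs) \<in> Tlt k"
      proof (cases "bs ! i \<in> Q")
        case True
        have "pt (bs[i := d b]) (cs[j := e b]) \<in> Tlt k"
          by (intro Tlt_upd[OF lists_of_upd2[OF lw(1)] WW(2) i] Q_not_Vs True d_in_Vs)
        then show ?thesis unfolding kop_pure[OF lw(1) i j(1)] by (rule fn.subspace_scale[OF subspace_Tlt])
      next
        case False
        then obtain q where q: "bs ! i = d q" using lw(6)[OF i] by auto
        have "bs ! i \<in> set bs" using i lw(2) by simp
        then have "q \<in> A" using Bs[of bs q] w q by (auto simp: w' wordsV_def)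
        moreover obtain p where p: "cs ! j = e p" using lw(7)[OF j(1)] by blast
        ultimately have "q \<noteq> p" using j(2) by auto
        then show ?thesis
          unfolding kop_pure[OF lw(1) i j(1)] q p using fn.subspace_0[OF subspace_Tlt] by (simp add: d_e)
      qed
    qed
    obtain R0 where CR: "mset cs = C + R0" "set_mset R0 \<subseteq> e ` A" "size R0 = Suc s"
      using w by (auto simp: wordsV_def w')
    have card: "card {j. j < n \<and> cs ! j \<in> e ` A} = Suc s"
      using count_split[OF CR(1) C(1) CR(2)] CR(3) lw(3) by simp
    have "(\<Sum>a\<in>A. \<Sum>j\<in>?J a. pt bs cs - ?k j) = (\<Sum>y\<in>e ` A. \<Sum>j\<in>{j. j < n \<and> cs ! j = y}. pt bs cs - ?k j)"
      by (simp add: sum.reindex inj_on_def inj_e)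
    also have "\<dots> = (\<Sum>j\<in>{j. j < n \<and> cs ! j \<in> e ` A}. pt bs cs - ?k j)"
      by (rule sum_by_letter) (use A in simp)
    also have "\<dots> = fscale (of_nat (Suc s)) (pt bs cs) - (\<Sum>j\<in>{j. j < n \<and> cs ! j \<in> e ` A}. ?k j)"
      unfolding sum_subtractf card[symmetric] by (simp only: fn.sum_constant_scale)
    finally have S: "(\<Sum>a\<in>A. \<Sum>j\<in>?J a. pt bs cs - ?k j) =
        fscale (of_nat (Suc s)) (pt bs cs) - (\<Sum>j\<in>{j. j < n \<and> cs ! j \<in> e ` A}. ?k j)" .
    have "?K (pt bs cs) = (\<Sum>j<n. ?k j)" by (rule sum.swap)
    also have "\<dots> = (\<Sum>j\<in>{j. j < n \<and> cs ! j \<notin> e ` A}. ?k j) + (\<Sum>j\<in>{j. j < n \<and> cs ! j \<in> e ` A}. ?k j)"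
      by (subst sum.union_disjoint[symmetric]) (auto intro!: sum.cong)
    finally have "(\<Sum>a\<in>A. act (?R a) (act (?F a) (ptw w))) - fscale (of_nat (Suc s)) (ptw w) + ?K (ptw w) =
        (\<Sum>a\<in>A. act (?R a) (act (?F a) (pt bs cs)) - (\<Sum>j\<in>?J a. pt bs cs - ?k j)) +
        (\<Sum>j\<in>{j. j < n \<and> cs ! j \<notin> e ` A}. ?k j)"
      unfolding sum_subtractf[of _ "\<lambda>a. \<Sum>j\<in>?J a. pt bs cs - ?k j"] S
      by (simp only: w' fst_conv snd_conv) (simp only: algebra_simps)
    also have "\<dots> \<in> Tlt k"
      by (rule fn.subspace_add[OF subspace_Tlt]; rule fn.subspace_sum[OF subspace_Tlt]) (use RF rest in auto)
    finally show "(\<Sum>a\<in>A. act (?R a) (act (?F a) (ptw w))) - fscale (of_nat (Suc s)) (ptw w) + ?K (ptw w) \<in> Tlt k" .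
  qed (simp_all add: rank_one_in_g del: of_nat_Suc)
qed

end

lemma permuted_position:
  assumes "\<sigma> permutes {..<length ys}" "distinct ys" "q < length ys"
  shows "{i. i < length ys \<and> permute_list \<sigma> ys ! i = ys ! q} = {inv \<sigma> q}"
proof -
  have "permute_list \<sigma> ys ! i = ys ! q \<longleftrightarrow> i = inv \<sigma> q" if "i < length ys" for i
  proof -
    have "\<sigma> i < length ys" using permutes_in_image[OF assms(1), of i] that by simp
    then have "permute_list \<sigma> ys ! i = ys ! q \<longleftrightarrow> \<sigma> i = q"
      using assms that by (simp add: permute_list_nth nth_eq_iff_index_eq)
    also have "\<dots> \<longleftrightarrow> i = inv \<sigma> q" using permutes_inverses[OF assms(1)] by metis
    finally show ?thesis .
  qed
  moreover have "inv \<sigma> q < length ys" using permutes_in_image[OF permutes_inv[OF assms(1)], of q] assms(3) by simp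
  ultimately show ?thesis by auto
qed

section \<open>Fresh letters and generic words\<close>

context mackey_tensors
begin

lemma red_functionals:
  assumes "finite J" "distinct zs" "finite X" "X \<subseteq> B" "Y \<subseteq> X" "set zs \<subseteq> B" "set zs \<inter> X = {}"
    "\<And>\<alpha> b. \<alpha> \<in> Y \<Longrightarrow> b \<in> set zs \<Longrightarrow> \<alpha> \<in> Q \<longleftrightarrow> b \<in> Q"
    "\<And>q. d q \<in> set zs \<union> Y \<Longrightarrow> e q \<notin> J"
    "\<And>C. C \<in> \<C> \<Longrightarrow> set_mset C \<subseteq> X \<and> set_mset C \<inter> Y = {}"
    "\<And>cs. cs \<in> \<D> \<Longrightarrow> set cs \<subseteq> J"
  shows "red k (wordsF k Y \<C> (length zs) \<D>) (wordsF k Y ((+) (mset zs) ` \<C>) 0 \<D>)"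
  using assms(2-10)
proof (induction zs arbitrary: X \<C>)
  case Nil
  have "(+) (mset []) ` \<C> = \<C>" by simp
  then show ?case unfolding red_def by (auto dest: spec[of _ "[]"])
next
  case (Cons b zs)
  have 1: "red k (wordsF k Y \<C> (Suc (length zs)) \<D>) (wordsF k Y (add_mset b ` \<C>) (length zs) \<D>)"
    by (rule red_functional[of X J]) (use Cons.prems assms(1,11) in auto)
  \<comment> \<open>The letter just introduced joins \<open>X\<close>, so that the next fresh letter
    avoids it.\<close>
  have 2: "red k (wordsF k Y (add_mset b ` \<C>) (length zs) \<D>)
      (wordsF k Y ((+) (mset zs) ` add_mset b ` \<C>) 0 \<D>)"
  proof (rule Cons.IH[of "insert b X"])
    fix C assume "C \<in> add_mset b ` \<C>"
    then show "set_mset C \<subseteq> insert b X \<and> set_mset C \<inter> Y = {}"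
      using Cons.prems(6) Cons.prems(9) Cons.prems(4) by fastforce
  qed (use Cons.prems in auto)
  have "(+) (mset zs) ` add_mset b ` \<C> = (+) (mset (b # zs)) ` \<C>"
    by (simp add: image_image)
  with red_trans[OF 1 2] show ?case by (simp only: list.size add_0_right add_Suc_right One_nat_def)
qed

lemma red_vectors:
  assumes A: "finite A" and Bs: "\<And>bs i. bs \<in> \<B> \<Longrightarrow> d i \<in> set bs \<Longrightarrow> i \<in> A"
    and nqB: "\<And>bs. bs \<in> \<B> \<Longrightarrow> nq bs \<le> k"
    and "distinct js" "set js \<inter> A = {}"
    "set_mset C \<inter> e ` A = {}" "set_mset C \<inter> e ` set js = {}"
  shows "red k (wordsV (e ` A) \<B> C (length js)) (wordsV (e ` A) \<B> (mset (map e js) + C) 0)"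
  using assms(4-7)
proof (induction js arbitrary: C)
  case Nil
  then show ?case unfolding red_def by (auto dest: spec[of _ "[]"])
next
  case (Cons b js)
  have 1: "red k (wordsV (e ` A) \<B> C (Suc (length js))) (wordsV (e ` A) \<B> (add_mset (e b) C) (length js))"
    by (rule red_vector[OF A _ Bs nqB]) (use Cons.prems in auto)
  have 2: "red k (wordsV (e ` A) \<B> (add_mset (e b) C) (length js))
      (wordsV (e ` A) \<B> (mset (map e js) + add_mset (e b) C) 0)"
    by (rule Cons.IH) (use Cons.prems in \<open>auto simp: inj_e\<close>)
  from red_trans[OF 1 2] show ?case by simp
qed

text \<open>With the letters from \<open>Q\<close> in the last \<open>k\<close> positions, the
  relabellings that respect the two kinds of letters preserve an initial segment. The last condition
  excludes any pairing between a letter \<open>d i\<close> and a vector of the word.\<close>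

definition generic :: "nat \<Rightarrow> ('a \<Rightarrow> complex) list \<Rightarrow> 'a list \<Rightarrow> bool" where
  "generic k yf yv \<longleftrightarrow> (yf, yv) \<in> words \<and> distinct yf \<and> distinct yv \<and>
     (\<forall>i<m. yf ! i \<in> Q \<longleftrightarrow> m - k \<le> i) \<and> (\<forall>i. d i \<in> set yf \<longrightarrow> e i \<notin> set yv)"

lemma nq_generic:
  assumes "generic k yf yv" "k \<le> m"
  shows "nq yf = k"
proof -
  have w: "(yf, yv) \<in> words" using assms(1) by (simp add: generic_def)
  have "yf ! i \<in> Vs \<longleftrightarrow> \<not> m - k \<le> i" if "i < m" for i
    using Q_iff[OF wordD(6)[OF w that]] assms(1) that by (auto simp: generic_def)
  then have "{i. i < length yf \<and> yf ! i \<notin> Vs} = {m - k..<m}"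
    unfolding wordD(2)[OF w] by auto
  then show ?thesis unfolding nq_def using assms(2) by simp
qed

text \<open>Modulo \<open>Tlt k\<close> only words with exactly \<open>k\<close> letters from
  \<open>Q\<close> matter. The vectors are exchanged first: afterwards no vector pairs with an old
  or new letter \<open>d q\<close>, as \<open>red_functional\<close> demands. The letters
  \<open>d q\<close> and those from \<open>Q\<close> follow separately, each kind being replaced
  within itself. \<open>F0\<close> and \<open>C0\<close> are letters to be avoided.\<close>

lemma polarize_fresh:
  assumes t: "t \<in> Tlt (Suc k)" and k: "k \<le> m" and fin: "finite F0" "finite C0"
  obtains zf zv \<Omega> where "generic k zf zv" "set zf \<inter> F0 = {}" "set zv \<inter> C0 = {}"
    "\<And>i. d i \<in> F0 \<Longrightarrow> e i \<notin> set zv" "\<And>i. e i \<in> C0 \<Longrightarrow> d i \<notin> set zf" "t \<in> spn k \<Omega>"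
    "red k \<Omega> {(bs, cs) \<in> words. mset bs = mset zf \<and> mset cs = mset zv}"
proof -
  obtain \<Omega>0 where \<Omega>0: "finite \<Omega>0" "\<Omega>0 \<subseteq> {w \<in> words. nq (fst w) < Suc k}" "t \<in> fn.span (ptw ` \<Omega>0)"
    using t by (rule Tlt_finite_words)
  define \<Omega> where "\<Omega> = {w \<in> \<Omega>0. nq (fst w) = k}"
  define X where "X = \<Union>(set ` fst ` \<Omega>)"
  define C where "C = \<Union>(set ` snd ` \<Omega>)"
  have finX: "finite X" "finite C" using \<Omega>0(1) by (auto simp: X_def C_def \<Omega>_def)
  obtain N where N: "\<And>i. d i \<in> X \<union> F0 \<Longrightarrow> i < N" "\<And>i. e i \<in> C \<union> C0 \<Longrightarrow> i < N"
    using index_bound[of "X \<union> F0" "C \<union> C0"] finX fin by auto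
  define A where "A = {..<N}"
  define Yd where "Yd = d ` A"
  define YQ where "YQ = X \<inter> Q"
  have fY: "finite Yd" "finite YQ" using finX by (auto simp: Yd_def YQ_def A_def)
  \<comment> \<open>All indices in use lie below \<open>N\<close>; the new vectors and the new
    functionals take disjoint ranges above it. A word of degree \<open>k\<close> has
    \<open>m - k\<close> letters in \<open>range d\<close>.\<close>
  define zi where "zi = [N..<N + n]"
  define zd where "zd = map d [N + n..<N + n + (m - k)]"
  have "infinite (Q - (YQ \<union> F0))" using Q_infinite fY(2) fin(1) by simp
  then obtain Z where Z: "finite Z" "card Z = k" "Z \<subseteq> Q - (YQ \<union> F0)"
    using infinite_arbitrarily_large by blast
  obtain zq where zq: "set zq = Z" "distinct zq" using finite_distinct_list[OF Z(1)] by blast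
  have lzq: "length zq = k" using zq Z(2) distinct_card by fastforce
  define \<B> where "\<B> = {bs. set bs \<subseteq> Yd \<union> YQ \<and> length bs = m \<and> nq bs = k}"
  define \<D> where "\<D> = {cs. mset cs = mset (map e zi)}"
  \<comment> \<open>While the letters \<open>d q\<close> are exchanged, the part from
    \<open>Q\<close> is a spectator that varies with the word; so \<open>wordsF\<close> takes a
    family of spectator multisets.\<close>
  define \<C> where "\<C> = {R. set_mset R \<subseteq> YQ \<and> size R = k}"
  have dQ: "d i \<notin> Q" for i using Q_disj by blast
  have sub1: "\<Omega> \<subseteq> wordsV (e ` A) \<B> {#} n"
  proof
    fix w assume w: "w \<in> \<Omega>"
    obtain bs cs where w': "w = (bs, cs)" by (cases w)
    have W: "(bs, cs) \<in> words" "nq bs = k" using w \<Omega>0(2) by (auto simp: \<Omega>_def w')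
    have bX: "set bs \<subseteq> X" "set cs \<subseteq> C" using w by (force simp: X_def C_def w')+
    have "set bs \<subseteq> Yd \<union> YQ"
    proof
      fix b assume b: "b \<in> set bs"
      then have "b \<in> B" using wordD(4)[OF W(1)] by blast
      then show "b \<in> Yd \<union> YQ" using b bX N(1) by (auto simp: Yd_def YQ_def A_def)
    qed
    moreover have "set_mset (mset cs) \<subseteq> e ` A"
    proof
      fix c assume c: "c \<in> set_mset (mset cs)"
      then obtain i where "c = e i" using wordD(5)[OF W(1)] by auto
      then show "c \<in> e ` A" using c bX N(2) by (auto simp: A_def)
    qed
    moreover have "mset cs = {#} + mset cs" "size (mset cs) = n" using wordD(3)[OF W(1)] by simp_all
    ultimately show "w \<in> wordsV (e ` A) \<B> {#} n"
      unfolding wordsV_def w' using W wordD(2)[OF W(1)] by (auto simp: \<B>_def)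
  qed
  have r1: "red k (wordsV (e ` A) \<B> {#} n) (wordsV (e ` A) \<B> (mset (map e zi)) 0)"
  proof -
    have "red k (wordsV (e ` A) \<B> {#} (length zi)) (wordsV (e ` A) \<B> (mset (map e zi) + {#}) 0)"
    proof (rule red_vectors)
      fix bs i assume "bs \<in> \<B>" "d i \<in> set bs"
      then have "d i \<in> Yd" using dQ by (auto simp: \<B>_def YQ_def)
      then show "i \<in> A" by (auto simp: Yd_def inj_d)
    qed (auto simp: A_def zi_def \<B>_def)
    then show ?thesis by (simp add: zi_def)
  qed
  have sub2: "wordsV (e ` A) \<B> (mset (map e zi)) 0 \<subseteq> wordsF k Yd \<C> (length zd) \<D>"
  proof
    fix w assume w: "w \<in> wordsV (e ` A) \<B> (mset (map e zi)) 0"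
    obtain bs cs where w': "w = (bs, cs)" by (cases w)
    have W: "(bs, cs) \<in> words" "bs \<in> \<B>" "mset cs = mset (map e zi)" using w by (auto simp: wordsV_def w')
    let ?C = "filter_mset (\<lambda>b. b \<in> Q) (mset bs)" and ?R = "filter_mset (\<lambda>b. b \<notin> Q) (mset bs)"
    have split: "mset bs = ?C + ?R" by (rule multiset_partition)
    have "size ?C = k" using W(2) nq_eq[OF wordD(4)[OF W(1)]] by (simp add: \<B>_def)
    moreover have "size ?C + size ?R = m" using split wordD(2)[OF W(1)] by (metis size_mset size_union)
    moreover have "set_mset ?C \<subseteq> YQ" "set_mset ?R \<subseteq> Yd"
      using W(2) dQ by (auto simp: \<B>_def YQ_def Yd_def)
    ultimately have "?C \<in> \<C>" "set_mset ?R \<subseteq> Yd" "size ?R = length zd"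
      by (auto simp: \<C>_def zd_def)
    then have "\<exists>C\<in>\<C>. \<exists>R. mset bs = C + R \<and> set_mset R \<subseteq> Yd \<and> size R = length zd"
      by (intro bexI[of _ ?C] exI[of _ ?R] conjI split)
    then show "w \<in> wordsF k Yd \<C> (length zd) \<D>"
      unfolding wordsF_def w' using W by (simp add: \<B>_def \<D>_def)
  qed
  have YdB: "Yd \<union> YQ \<subseteq> B" by (auto simp: Yd_def YQ_def)
  have disj: "Yd \<inter> YQ = {}" using dQ by (auto simp: Yd_def YQ_def)
  have zdp: "distinct zd" "set zd \<subseteq> range d" "set zd \<inter> Yd = {}" "length zd = m - k"
    by (auto simp: zd_def Yd_def A_def distinct_map inj_on_def inj_d)
  have freshe: "e q \<notin> set (map e zi)" if "d q \<in> set zd \<union> Yd" for q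
    using that by (auto simp: zd_def Yd_def A_def zi_def inj_d inj_e)
  have r2: "red k (wordsF k Yd \<C> (length zd) \<D>) (wordsF k Yd ((+) (mset zd) ` \<C>) 0 \<D>)"
  proof (rule red_functionals[where X = "Yd \<union> YQ" and J = "set (map e zi)"])
    show "set zd \<inter> (Yd \<union> YQ) = {}" using zdp dQ by (auto simp: YQ_def)
    show "\<alpha> \<in> Q \<longleftrightarrow> b \<in> Q" if "\<alpha> \<in> Yd" "b \<in> set zd" for \<alpha> b
      using that dQ by (auto simp: Yd_def zd_def)
    show "set_mset C \<subseteq> Yd \<union> YQ \<and> set_mset C \<inter> Yd = {}" if "C \<in> \<C>" for C
      using that disj by (auto simp: \<C>_def)
    show "set cs \<subseteq> set (map e zi)" if "cs \<in> \<D>" for cs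
      using mset_eq_setD[of cs "map e zi"] that by (simp add: \<D>_def)
  qed (use fY YdB zdp freshe in auto)
  \<comment> \<open>The roles change: the new letters \<open>zd\<close> become the single spectator,
    and the part from \<open>Q\<close> is what remains to be exchanged.\<close>
  have sub3: "wordsF k Yd ((+) (mset zd) ` \<C>) 0 \<D> \<subseteq> wordsF k YQ {mset zd} (length zq) \<D>"
    unfolding wordsF_def \<C>_def lzq by fastforce
  have r3: "red k (wordsF k YQ {mset zd} (length zq) \<D>) (wordsF k YQ ((+) (mset zq) ` {mset zd}) 0 \<D>)"
  proof (rule red_functionals[where X = "set zd \<union> YQ" and J = "set (map e zi)"])
    show "set zq \<inter> (set zd \<union> YQ) = {}" using zq Z zdp(2) dQ by auto
    show "\<alpha> \<in> Q \<longleftrightarrow> b \<in> Q" if "\<alpha> \<in> YQ" "b \<in> set zq" for \<alpha> b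
      using that zq Z by (auto simp: YQ_def)
    show "e q \<notin> set (map e zi)" if "d q \<in> set zq \<union> YQ" for q
      using that zq Z dQ by (auto simp: YQ_def)
    show "set_mset C \<subseteq> set zd \<union> YQ \<and> set_mset C \<inter> YQ = {}" if "C \<in> {mset zd}" for C
      using that zdp(2) dQ by (auto simp: YQ_def)
    show "set cs \<subseteq> set (map e zi)" if "cs \<in> \<D>" for cs
      using mset_eq_setD[of cs "map e zi"] that by (simp add: \<D>_def)
  qed (use fY YdB zdp zq Z in auto)
  let ?zf = "zd @ zq" and ?zv = "map e zi"
  have sub4: "wordsF k YQ ((+) (mset zq) ` {mset zd}) 0 \<D> \<subseteq> {(bs, cs) \<in> words. mset bs = mset ?zf \<and> mset cs = mset ?zv}"
    unfolding wordsF_def \<D>_def by (auto simp: add.commute)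
  have red: "red k \<Omega> {(bs, cs) \<in> words. mset bs = mset ?zf \<and> mset cs = mset ?zv}"
    using red_mono[OF r1 sub1 sub2] red_mono[OF r2 order_refl sub3] red_mono[OF r3 order_refl sub4] red_trans
    by blast
  have gen: "generic k ?zf ?zv"
    unfolding generic_def
  proof (intro conjI allI impI)
    show "(?zf, ?zv) \<in> words"
      by (rule wordI) (use zdp zq Z lzq k in \<open>auto simp: zi_def\<close>)
    show "distinct ?zf" using zdp zq Z dQ by auto
    show "distinct ?zv" by (simp add: distinct_map inj_on_def inj_e zi_def)
    show "?zf ! i \<in> Q \<longleftrightarrow> m - k \<le> i" if i: "i < m" for i
    proof (cases "i < m - k")
      case True
      then have "?zf ! i \<in> set zd" using zdp(4) by (simp add: nth_append)
      then show ?thesis using True zdp(2) dQ by auto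
    next
      case False
      then have "?zf ! i \<in> set zq" using zdp(4) i lzq k by (simp add: nth_append)
      then show ?thesis using False zq Z by auto
    qed
    show "e i \<notin> set ?zv" if "d i \<in> set ?zf" for i
      using that freshe dQ zq Z by auto
  qed
  have t\<Omega>: "t \<in> spn k \<Omega>"
  proof -
    have "ptw ` \<Omega>0 \<subseteq> spn k \<Omega>"
    proof (rule image_subsetI)
      fix w assume w: "w \<in> \<Omega>0"
      then have W: "w \<in> words" "nq (fst w) < Suc k" using \<Omega>0(2) by auto
      show "ptw w \<in> spn k \<Omega>"
      proof (cases "nq (fst w) = k")
        case True
        then have "w \<in> \<Omega>" using w by (simp add: \<Omega>_def)
        then show ?thesis by (intro fn.span_base UnI1 imageI)
      next
        case False
        then have "nq (fst w) < k" using W by simp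
        then show ?thesis by (intro Tlt_spn Tlt_base words_lists_of W)
      qed
    qed
    then have "fn.span (ptw ` \<Omega>0) \<subseteq> spn k \<Omega>" by (intro fn.span_minimal fn.subspace_span)
    then show ?thesis using \<Omega>0(3) by blast
  qed
  show thesis
  proof (rule that[OF gen _ _ _ _ t\<Omega> red])
    show "set ?zf \<inter> F0 = {}" using zq Z N(1) by (fastforce simp: zd_def)
    show "set ?zv \<inter> C0 = {}" using N(2) by (fastforce simp: zi_def)
    show "e i \<notin> set ?zv" if "d i \<in> F0" for i using that N(1)[of i] by (auto simp: zi_def inj_e)
    show "d i \<notin> set ?zf" if "e i \<in> C0" for i using that N(2)[of i] zq Z dQ by (auto simp: zd_def inj_d)
  qed
qed

abbreviation "Idx \<equiv> {\<sigma>. \<sigma> permutes {..<m}} \<times> {\<tau>. \<tau> permutes {..<n}}"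

lemma finite_Idx: "finite Idx"
  by (simp add: finite_permutations)

definition gword :: "('a \<Rightarrow> complex) list \<Rightarrow> 'a list \<Rightarrow> (nat \<Rightarrow> nat) \<times> (nat \<Rightarrow> nat) \<Rightarrow> ('a \<Rightarrow> complex) list \<times> 'a list" where
  "gword yf yv x = (permute_list (fst x) yf, permute_list (snd x) yv)"

text \<open>Coefficients are functions on S_m x S_n, detached from the letters, so that the same
  function can be read at another word; \<open>moves\<close> compares exactly these.\<close>

definition gsum :: "('a \<Rightarrow> complex) list \<Rightarrow> 'a list \<Rightarrow> ((nat \<Rightarrow> nat) \<times> (nat \<Rightarrow> nat) \<Rightarrow> complex) \<Rightarrow> 'a mixed" where
  "gsum yf yv c = (\<Sum>x\<in>Idx. fscale (c x) (ptw (gword yf yv x)))"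

lemma gsum_add: "gsum yf yv (c + c') = gsum yf yv c + gsum yf yv c'"
  unfolding gsum_def by (simp add: fn.scale_left_distrib sum.distrib)

lemma gsum_scale: "gsum yf yv (fscale a c) = fscale a (gsum yf yv c)"
  unfolding gsum_def fn.scale_sum_right by (simp add: fscale_def mult.assoc)

lemma gsum_indicator:
  assumes "x \<in> Idx"
  shows "gsum yf yv (\<lambda>y. if y = x then 1 else 0) = ptw (gword yf yv x)"
proof -
  have "gsum yf yv (\<lambda>y. if y = x then 1 else 0) = (\<Sum>y\<in>Idx. if y = x then ptw (gword yf yv x) else 0)"
    unfolding gsum_def by (rule sum.cong) auto
  also have "\<dots> = ptw (gword yf yv x)" using finite_Idx assms by (simp only: sum.delta if_True)
  finally show ?thesis .
qed

lemma gword_words: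
  assumes "(yf, yv) \<in> words" "x \<in> Idx"
  shows "gword yf yv x \<in> words" "set (fst (gword yf yv x)) = set yf" "set (snd (gword yf yv x)) = set yv"
    "nq (fst (gword yf yv x)) = nq yf"
proof -
  note W = wordD[OF assms(1)]
  have s: "fst x permutes {..<length yf}" "snd x permutes {..<length yv}" using assms(2) W by auto
  show 1: "set (fst (gword yf yv x)) = set yf" "set (snd (gword yf yv x)) = set yv"
    using s by (simp_all add: gword_def set_permute_list)
  show "gword yf yv x \<in> words" using 1 W by (simp add: words_def gword_def)
  have "set (permute_list (fst x) yf) \<subseteq> B" using s(1) W(4) by simp
  then show "nq (fst (gword yf yv x)) = nq yf"
    using nq_eq[of "permute_list (fst x) yf"] nq_eq[OF W(4)] mset_permute_list[OF s(1)] by (simp add: gword_def)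
qed

lemma spn_generic:
  assumes y: "(yf, yv) \<in> words"
    and x: "x \<in> spn k {(bs, cs) \<in> words. mset bs = mset yf \<and> mset cs = mset yv}"
  shows "\<exists>c. x - gsum yf yv c \<in> Tlt k"
  using x
proof (induction rule: fn.span_induct_alt)
  case base
  have "gsum yf yv 0 = 0" by (simp add: gsum_def)
  then have "0 - gsum yf yv 0 \<in> Tlt k" using fn.subspace_0[OF subspace_Tlt] by simp
  show ?case by (rule exI[of _ "0 :: _ \<Rightarrow> complex"]) fact
next
  case (step a x x')
  obtain c' where c': "x' - gsum yf yv c' \<in> Tlt k" using step(2) by blast
  have "\<exists>c. x - gsum yf yv c \<in> Tlt k"
  proof (cases "x \<in> Tlt k")
    case True
    have "gsum yf yv 0 = 0" by (simp add: gsum_def)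
    then have "x - gsum yf yv 0 \<in> Tlt k" using True by simp
    show ?thesis by (rule exI[of _ "0 :: _ \<Rightarrow> complex"]) fact
  next
    case False
    then obtain bs cs where w: "x = pt bs cs" "mset bs = mset yf" "mset cs = mset yv" using step(1) by auto
    obtain \<sigma> where \<sigma>: "\<sigma> permutes {..<length yf}" "permute_list \<sigma> yf = bs"
      using mset_eq_permutation[OF w(2)] by blast
    obtain \<tau> where \<tau>: "\<tau> permutes {..<length yv}" "permute_list \<tau> yv = cs"
      using mset_eq_permutation[OF w(3)] by blast
    have "(\<sigma>, \<tau>) \<in> Idx" using \<sigma> \<tau> wordD(2,3)[OF y] by simp
    then have "x - gsum yf yv (\<lambda>y. if y = (\<sigma>, \<tau>) then 1 else 0) = 0"
      using gsum_indicator[of "(\<sigma>, \<tau>)" yf yv] \<sigma> \<tau> w by (simp add: gword_def)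
    then have "x - gsum yf yv (\<lambda>y. if y = (\<sigma>, \<tau>) then 1 else 0) \<in> Tlt k"
      using fn.subspace_0[OF subspace_Tlt] by simp
    show ?thesis by (rule exI[of _ "\<lambda>y. if y = (\<sigma>, \<tau>) then 1 else 0"]) fact
  qed
  then obtain c where c: "x - gsum yf yv c \<in> Tlt k" by blast
  have "fscale a x + x' - gsum yf yv (fscale a c + c') = fscale a (x - gsum yf yv c) + (x' - gsum yf yv c')"
    unfolding gsum_add gsum_scale fn.scale_right_diff_distrib by simp
  also have "\<dots> \<in> Tlt k"
    by (intro fn.subspace_add[OF subspace_Tlt] fn.subspace_scale[OF subspace_Tlt] c c')
  finally have *: "fscale a x + x' - gsum yf yv (fscale a c + c') \<in> Tlt k" .
  show ?case by (rule exI[of _ "fscale a c + c'"]) (rule *)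
qed

text \<open>\<open>moves k yf yv zf zv\<close>: some element of the enveloping algebra replaces, modulo \<open>Tlt k\<close>, the letters
  \<open>yf, yv\<close> by \<open>zf, zv\<close> in every arrangement at once.\<close>

definition moves where
  "moves k yf yv zf zv \<longleftrightarrow>
    (\<exists>u. set u \<subseteq> g \<and> (\<forall>c. acts u (gsum yf yv c) - gsum zf zv c \<in> Tlt k))"

lemma acts_diff: "set u \<subseteq> g \<Longrightarrow> acts u (x - y) = acts u x - acts u y"
  using acts_simps(1)[of u "x - y" y] by simp

lemma moves_refl: "moves k yf yv yf yv"
  unfolding moves_def using fn.subspace_0[OF subspace_Tlt] by (intro exI[of _ "[]"]) simp

lemma moves_trans:
  assumes "moves k yf yv yf' yv'" "moves k yf' yv' zf zv"
  shows "moves k yf yv zf zv"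
proof -
  obtain u where u: "set u \<subseteq> g" "\<And>c. acts u (gsum yf yv c) - gsum yf' yv' c \<in> Tlt k"
    using assms(1) unfolding moves_def by blast
  obtain u' where u': "set u' \<subseteq> g" "\<And>c. acts u' (gsum yf' yv' c) - gsum zf zv c \<in> Tlt k"
    using assms(2) unfolding moves_def by blast
  have "acts (u @ u') (gsum yf yv c) - gsum zf zv c \<in> Tlt k" for c
  proof -
    have "acts (u @ u') (gsum yf yv c) - gsum zf zv c =
        acts u' (acts u (gsum yf yv c) - gsum yf' yv' c) + (acts u' (gsum yf' yv' c) - gsum zf zv c)"
      unfolding acts_append acts_diff[OF u'(1)] by simp
    also have "\<dots> \<in> Tlt k"
      by (intro fn.subspace_add[OF subspace_Tlt] gstable_acts[OF gstable_Tlt u'(1)] u u')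
    finally show ?thesis .
  qed
  then show ?thesis unfolding moves_def using u u' by (intro exI[of _ "u @ u'"]) auto
qed

lemma movesI:
  assumes a: "a \<in> g" and "\<And>x. x \<in> Idx \<Longrightarrow> act a (ptw (gword yf yv x)) - ptw (gword zf zv x) \<in> Tlt k"
  shows "moves k yf yv zf zv"
  unfolding moves_def
proof (intro exI[of _ "[a]"] conjI allI)
  show "set [a] \<subseteq> g" using a by simp
  fix c
  have "acts [a] (gsum yf yv c) - gsum zf zv c =
      (\<Sum>x\<in>Idx. fscale (c x) (act a (ptw (gword yf yv x)) - ptw (gword zf zv x)))"
    unfolding gsum_def acts.simps by (simp only: act_simps[OF a] fn.scale_right_diff_distrib sum_subtractf)
  also have "\<dots> \<in> Tlt k"
    by (intro fn.subspace_sum[OF subspace_Tlt] fn.subspace_scale[OF subspace_Tlt] assms(2))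
  finally show "acts [a] (gsum yf yv c) - gsum zf zv c \<in> Tlt k" .
qed

text \<open>In every rearrangement of distinct letters the \<open>q\<close>-th letter occurs once,
  so the sum over its occurrences in \<open>replace_vector\<close> has a single term and one
  operator serves all rearrangements.\<close>

lemma moves_vector:
  assumes y: "(yf, yv) \<in> words" "nq yf \<le> k" "distinct yv" "q < n" and b: "d b \<notin> set yf"
  shows "moves k yf yv yf (yv[q := e b])"
proof -
  note W = wordD[OF y(1)]
  obtain p where p: "yv ! q = e p" using W(7)[OF y(4)] by blast
  show ?thesis
  proof (rule movesI[OF rank_one_in_g[of "e b" p]])
    fix x assume x: "x \<in> Idx"
    note G = gword_words[OF y(1) x]
    let ?bs = "fst (gword yf yv x)" and ?cs = "snd (gword yf yv x)"
    have s: "snd x permutes {..<length yv}" using x W(3) by auto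
    have "{j. j < n \<and> snd (gword yf yv x) ! j = e p} = {inv (snd x) q}"
      using permuted_position[OF s y(3), of q] y(4) W(3) by (simp add: gword_def p)
    moreover have "?cs[inv (snd x) q := e b] = permute_list (snd x) (yv[q := e b])"
      using permute_list_update[OF s] y(4) W(3) by (simp add: gword_def)
    ultimately have "(\<Sum>j\<in>{j. j < n \<and> snd (gword yf yv x) ! j = e p}. pt (fst (gword yf yv x)) (?cs[j := e b])) =
        ptw (gword yf (yv[q := e b]) x)" by (simp add: gword_def)
    then show "act (rank_one (e b) p) (ptw (gword yf yv x)) - ptw (gword yf (yv[q := e b]) x) \<in> Tlt k"
      using replace_vector[of "fst (gword yf yv x)" "snd (gword yf yv x)" k b p] G y(2) b by simp
  qed
qed

lemma moves_functional:
  assumes y: "(yf, yv) \<in> words" "nq yf \<le> k" "distinct yf" "q < m"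
    and b: "b \<in> B" "yf ! q \<in> Q \<longleftrightarrow> b \<in> Q" "\<And>i. b = d i \<Longrightarrow> e i \<notin> set yv"
  shows "moves k yf yv (yf[q := b]) yv"
proof -
  note W = wordD[OF y(1)]
  have "yf ! q \<in> set yf" using y(4) W(2) by simp
  from replace_functional[OF finite_set W(4) finite_set this b, of k]
  obtain a where a: "a \<in> g" and rep: "\<forall>bs cs. (bs, cs) \<in> words \<longrightarrow> nq bs \<le> k \<longrightarrow> set bs \<subseteq> set yf \<longrightarrow> set cs \<subseteq> set yv \<longrightarrow>
    act a (pt bs cs) - (\<Sum>i\<in>{i. i < m \<and> bs ! i = yf ! q}. pt (bs[i := b]) cs) \<in> Tlt k" by blast
  show ?thesis
  proof (rule movesI[OF a])
    fix x assume x: "x \<in> Idx"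
    note G = gword_words[OF y(1) x]
    let ?bs = "fst (gword yf yv x)" and ?cs = "snd (gword yf yv x)"
    have s: "fst x permutes {..<length yf}" using x W(2) by auto
    have "{j. j < m \<and> fst (gword yf yv x) ! j = yf ! q} = {inv (fst x) q}"
      using permuted_position[OF s y(3)] y(4) W(2) by (simp add: gword_def)
    moreover have "?bs[inv (fst x) q := b] = permute_list (fst x) (yf[q := b])"
      using permute_list_update[OF s] y(4) W(2) by (simp add: gword_def)
    ultimately have "(\<Sum>i\<in>{i. i < m \<and> fst (gword yf yv x) ! i = yf ! q}. pt (?bs[i := b]) (snd (gword yf yv x))) =
        ptw (gword (yf[q := b]) yv x)" by (simp add: gword_def)
    then show "act a (ptw (gword yf yv x)) - ptw (gword (yf[q := b]) yv x) \<in> Tlt k"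
      using rep[rule_format, of "fst (gword yf yv x)" "snd (gword yf yv x)"] G y(2) by simp
  qed
qed

lemma take_drop_update:
  "q < length zs \<Longrightarrow> length ys = length zs \<Longrightarrow>
    (take q zs @ drop q ys)[q := zs ! q] = take (Suc q) zs @ drop (Suc q) ys"
  by (intro nth_equalityI) (auto simp: nth_append nth_list_update min_def)

text \<open>The letters change one at a time through the hybrids of the two words. Vectors go first:
  \<open>cross\<close> separates the new vectors from the old functionals, and genericity of
  \<open>z\<close> separates them from the new functionals written afterwards.\<close>

lemma moves_generic:
  assumes k: "k \<le> m" and y: "generic k yf yv" and z: "generic k zf zv"
    and disj: "set yf \<inter> set zf = {}" "set yv \<inter> set zv = {}" and cross: "\<And>i. d i \<in> set yf \<Longrightarrow> e i \<notin> set zv"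
  shows "moves k yf yv zf zv"
proof -
  have yw: "(yf, yv) \<in> words" and zw: "(zf, zv) \<in> words" using y z by (auto simp: generic_def)
  note Wy = wordD[OF yw] and Wz = wordD[OF zw]
  have 1: "moves k yf yv yf (take q zv @ drop q yv)" if "q \<le> n" for q
    using that
  proof (induction q)
    case 0
    then show ?case using moves_refl by simp
  next
    case (Suc q)
    obtain b where b: "zv ! q = e b" using Wz(7)[of q] Suc.prems by auto
    have bz: "e b \<in> set zv" using b Suc.prems Wz(3) nth_mem[of q zv] by auto
    have 1: "moves k yf (take q zv @ drop q yv) yf ((take q zv @ drop q yv)[q := e b])"
    proof (rule moves_vector)
      show "(yf, take q zv @ drop q yv) \<in> words"
        using Wy Wz Suc.prems set_take_subset[of q zv] set_drop_subset[of q yv]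
        by (intro wordI) auto
      show "distinct (take q zv @ drop q yv)"
        using y z disj(2) set_take_subset[of q zv] set_drop_subset[of q yv] by (auto simp: generic_def)
      show "d b \<notin> set yf" using cross bz by blast
    qed (use Suc.prems nq_generic[OF y k] in auto)
    have 2: "(take q zv @ drop q yv)[q := e b] = take (Suc q) zv @ drop (Suc q) yv"
      using take_drop_update[of q zv yv] Suc.prems Wy Wz b by simp
    have "q \<le> n" using Suc.prems by simp
    from moves_trans[OF Suc.IH[OF this] 1[unfolded 2]] show ?case .
  qed
  have 2: "moves k yf zv (take q zf @ drop q yf) zv" if "q \<le> m" for q
    using that
  proof (induction q)
    case 0
    then show ?case using moves_refl by simp
  next
    case (Suc q)
    let ?w = "take q zf @ drop q yf"
    have sw: "set ?w \<subseteq> B" "length ?w = m"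
      using Wy Wz Suc.prems set_take_subset[of q zf] set_drop_subset[of q yf] by auto
    have w: "(?w, zv) \<in> words" using sw Wz by (intro wordI) auto
    have bz: "zf ! q \<in> set zf" using Suc.prems Wz(2) by simp
    have wQ: "?w ! i \<in> Q \<longleftrightarrow> m - k \<le> i" if "i < m" for i
      using that y z Suc.prems Wy(2) Wz(2) by (auto simp: generic_def nth_append)
    have dist: "distinct ?w"
      using y z disj(1) set_take_subset[of q zf] set_drop_subset[of q yf] by (auto simp: generic_def)
    have "?w ! i \<in> Vs \<longleftrightarrow> \<not> m - k \<le> i" if "i < m" for i
      using Q_iff[OF wordD(6)[OF w that]] wQ[OF that] by blast
    then have "{i. i < length ?w \<and> ?w ! i \<notin> Vs} = {m - k..<m}" unfolding sw(2) by auto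
    then have nq: "nq ?w \<le> k" unfolding nq_def using k by simp
    have 1: "moves k ?w zv (?w[q := zf ! q]) zv"
    proof (rule moves_functional[OF w nq dist])
      show "?w ! q \<in> Q \<longleftrightarrow> zf ! q \<in> Q" using wQ z Suc.prems by (simp add: generic_def)
      show "zf ! q \<in> B" using Wz(6) Suc.prems by simp
      show "e i \<notin> set zv" if "zf ! q = d i" for i using that bz z by (auto simp: generic_def)
    qed (use Suc.prems in auto)
    have 2: "?w[q := zf ! q] = take (Suc q) zf @ drop (Suc q) yf"
      using take_drop_update[of q zf yf] Suc.prems Wy Wz by simp
    have "q \<le> m" using Suc.prems by simp
    from moves_trans[OF Suc.IH[OF this] 1[unfolded 2]] show ?case .
  qed
  from moves_trans[OF 1[of n] ] 2[of m] Wy Wz show ?thesis by simp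
qed

text \<open>The word \<open>y\<close> is prescribed and may share letters with \<open>t\<close>,
  while replacement needs fresh ones. So \<open>t\<close> is polarized to a fresh word
  \<open>z\<close>, the coefficients are carried to \<open>y\<close>, where \<open>gen\<close>
  applies, and back.\<close>

theorem polarization:
  assumes k: "k \<le> m" and y: "generic k yf yv" and t: "t \<in> Tl" "t \<in> Tlt (Suc k)"
    and M: "gstable M" "Tlt k \<subseteq> M"
    and gen: "\<And>u c. set u \<subseteq> g \<Longrightarrow> acts u t - gsum yf yv c \<in> Tlt k \<Longrightarrow> acts u t \<in> M"
  shows "t \<in> M"
proof -
  obtain zf zv \<Omega> where z: "generic k zf zv" and fresh: "set zf \<inter> set yf = {}" "set zv \<inter> set yv = {}"
    "\<And>i. d i \<in> set yf \<Longrightarrow> e i \<notin> set zv" "\<And>i. e i \<in> set yv \<Longrightarrow> d i \<notin> set zf"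
    and t\<Omega>: "t \<in> spn k \<Omega>" and red: "red k \<Omega> {(bs, cs) \<in> words. mset bs = mset zf \<and> mset cs = mset zv}"
    by (rule polarize_fresh[OF t(2) k finite_set[of yf] finite_set[of yv]]) blast
  have "moves k zf zv yf yv" by (rule moves_generic[OF k z y]) (use fresh in auto)
  then obtain u1 where u1: "set u1 \<subseteq> g" "\<And>c. acts u1 (gsum zf zv c) - gsum yf yv c \<in> Tlt k"
    unfolding moves_def by blast
  have "moves k yf yv zf zv" by (rule moves_generic[OF k y z]) (use fresh in auto)
  then obtain u2 where u2: "set u2 \<subseteq> g" "\<And>c. acts u2 (gsum yf yv c) - gsum zf zv c \<in> Tlt k"
    unfolding moves_def by blast
  note sM = fn.subspace_add[OF gstableD(1)[OF M(1)]] fn.subspace_diff[OF gstableD(1)[OF M(1)]]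
  show ?thesis
  proof (rule redD[OF red t(1) t\<Omega> M])
    fix u assume u: "set u \<subseteq> g" "acts u t \<in> spn k {(bs, cs) \<in> words. mset bs = mset zf \<and> mset cs = mset zv}"
    have "(zf, zv) \<in> words" using z by (simp add: generic_def)
    from spn_generic[OF this u(2)] obtain c where c: "acts u t - gsum zf zv c \<in> Tlt k" by blast
    have "acts (u @ u1) t - gsum yf yv c =
        acts u1 (acts u t - gsum zf zv c) + (acts u1 (gsum zf zv c) - gsum yf yv c)"
      unfolding acts_append acts_diff[OF u1(1)] by simp
    also have "\<dots> \<in> Tlt k"
      by (intro fn.subspace_add[OF subspace_Tlt] gstable_acts[OF gstable_Tlt u1(1)] c u1)
    finally have c1: "acts (u @ u1) t - gsum yf yv c \<in> Tlt k" .
    then have "acts (u @ u1) t \<in> M" using gen[of "u @ u1"] u(1) u1(1) by simp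
    then have "gsum yf yv c \<in> M" using sM(2)[of "acts (u @ u1) t" "acts (u @ u1) t - gsum yf yv c"] c1 M(2) by auto
    then have "acts u2 (gsum yf yv c) \<in> M" by (rule gstable_acts[OF M(1) u2(1)])
    then have "gsum zf zv c \<in> M"
      using sM(2)[of "acts u2 (gsum yf yv c)" "acts u2 (gsum yf yv c) - gsum zf zv c"] u2(2)[of c] M(2) by auto
    then show "acts u t \<in> M" using sM(1)[of "acts u t - gsum zf zv c" "gsum zf zv c"] c M(2) by auto
  qed
qed

end

section \<open>Maschke's theorem for permutation actions\<close>

definition supported :: "'x set \<Rightarrow> ('x \<Rightarrow> complex) set" where
  "supported I = {c. \<forall>x. x \<notin> I \<longrightarrow> c x = 0}"

lemma finite_spanning_supported:
  assumes "finite I"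
  obtains F where "finite F" "supported I \<subseteq> fn.span F"
proof
  let ?F = "(\<lambda>x y. if y = x then 1 else 0) ` I"
  show "finite ?F" using assms by simp
  show "supported I \<subseteq> fn.span ?F"
  proof
    fix c :: "'a \<Rightarrow> complex" assume c: "c \<in> supported I"
    have app: "(\<Sum>x\<in>A. h x) y = (\<Sum>x\<in>A. h x y)" for h :: "'a \<Rightarrow> 'a \<Rightarrow> complex" and A y
      by (induction A rule: infinite_finite_induct) auto
    have "c = (\<Sum>x\<in>I. fscale (c x) (\<lambda>y. if y = x then 1 else 0))"
    proof
      fix y
      have "(\<Sum>x\<in>I. c x * (if y = x then 1 else 0)) = (\<Sum>x\<in>I. if x = y then c y else 0)"
        by (rule sum.cong) auto
      then show "c y = (\<Sum>x\<in>I. fscale (c x) (\<lambda>y. if y = x then 1 else 0)) y"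
        using c assms unfolding app by (auto simp: fscale_def supported_def)
    qed
    also have "\<dots> \<in> fn.span ?F" by (intro fn.span_sum fn.span_scale fn.span_base) auto
    finally show "c \<in> fn.span ?F" .
  qed
qed

text \<open>An infinite basis would have \<open>card\<close> 0 and break monotonicity; the finite
  set \<open>F\<close> excludes this.\<close>

lemma dim_strict_mono:
  assumes F: "finite F" "L \<subseteq> fn.span F" and M: "fn.subspace M" "M \<subset> L"
  shows "fn.dim M < fn.dim L"
proof -
  obtain BM where BM: "BM \<subseteq> M" "fn.independent BM" "M \<subseteq> fn.span BM" "card BM = fn.dim M"
    by (rule fn.basis_exists)
  obtain BL where BL: "BL \<subseteq> L" "fn.independent BL" "L \<subseteq> fn.span BL" "card BL = fn.dim L"
    by (rule fn.basis_exists)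
  have fL: "finite BL" using fn.independent_span_bound[OF F(1) BL(2)] BL(1) F(2) by blast
  obtain x where x: "x \<in> L" "x \<notin> M" using M by blast
  have sM: "fn.span BM = M" using BM M(1) fn.span_minimal by blast
  have ind: "fn.independent (insert x BM)"
    using x sM BM(2) by (simp add: fn.independent_insert)
  have "insert x BM \<subseteq> fn.span BL" using x BM(1) BL(3) M(2) by blast
  from fn.independent_span_bound[OF fL ind this] have "finite (insert x BM)" "card (insert x BM) \<le> card BL"
    by auto
  moreover have "x \<notin> BM" using x BM(1) by blast
  ultimately show ?thesis using BM(4) BL(4) by simp
qed

locale permutation_action =
  fixes H :: "('x \<Rightarrow> 'x) set" and I :: "'x set"
  assumes finite_H: "finite H" and finite_I: "finite I" and H_ne: "H \<noteq> {}"
    and comp: "\<rho> \<in> H \<Longrightarrow> \<rho>' \<in> H \<Longrightarrow> \<rho> \<circ> \<rho>' \<in> H"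
    and bij: "\<rho> \<in> H \<Longrightarrow> bij \<rho>" and inv_H: "\<rho> \<in> H \<Longrightarrow> inv \<rho> \<in> H"
begin

definition invariant :: "('x \<Rightarrow> complex) set \<Rightarrow> bool" where
  "invariant L \<longleftrightarrow> fn.subspace L \<and> (\<forall>\<rho>\<in>H. \<forall>c\<in>L. c \<circ> \<rho> \<in> L)"

definition minimal_invariant :: "('x \<Rightarrow> complex) set \<Rightarrow> bool" where
  "minimal_invariant L \<longleftrightarrow> invariant L \<and> L \<noteq> {0} \<and> (\<forall>L'. invariant L' \<and> L' \<subseteq> L \<longrightarrow> L' = {0} \<or> L' = L)"

lemma invariantD: "invariant L \<Longrightarrow> fn.subspace L" "invariant L \<Longrightarrow> \<rho> \<in> H \<Longrightarrow> c \<in> L \<Longrightarrow> c \<circ> \<rho> \<in> L"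
  by (auto simp: invariant_def)

lemma comp_inv: "\<rho> \<in> H \<Longrightarrow> \<rho> \<circ> inv \<rho> = id" "\<rho> \<in> H \<Longrightarrow> inv \<rho> \<circ> \<rho> = id"
  using bij[of \<rho>] by (auto simp: bij_def surj_iff inj_iff)

text \<open>Averaging an arbitrary linear projection onto \<open>S\<close> over the group makes it
  equivariant; the kernel of the average in \<open>L\<close> is an invariant complement.\<close>

lemma maschke:
  assumes S: "invariant S" and L: "invariant L" and sub: "S \<subset> L"
  obtains S' where "invariant S'" "S' \<subseteq> L" "S' \<inter> S = {0}" "S' \<noteq> {0}"
proof -
  interpret P: vector_space_pair "fscale :: complex \<Rightarrow> ('x \<Rightarrow> complex) \<Rightarrow> _" "fscale :: complex \<Rightarrow> ('x \<Rightarrow> complex) \<Rightarrow> _"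
    by unfold_locales
  have "Vector_Spaces.linear fscale fscale (\<lambda>c :: 'x \<Rightarrow> complex. c)"
    by (simp add: Vector_Spaces.linear_iff fn.vector_space_axioms)
  from P.linear_exists_left_inverse_on[OF this invariantD(1)[OF S]]
  obtain \<pi> where \<pi>: "range \<pi> \<subseteq> S" "Vector_Spaces.linear fscale fscale \<pi>" "\<And>c. c \<in> S \<Longrightarrow> \<pi> c = c"
    by (auto simp: inj_on_def)
  interpret \<pi>: Vector_Spaces.linear fscale fscale \<pi> by (rule \<pi>(2))
  \<comment> \<open>Not divided by the order of the group: \<open>av\<close> is
    \<open>card H\<close> times a projection, and \<open>card H\<close> is invertible in the complex
    numbers.\<close>
  define av where "av c = (\<Sum>\<rho>\<in>H. \<pi> (c \<circ> \<rho>) \<circ> inv \<rho>)" for c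
  have app: "(\<Sum>x\<in>A. h x) y = (\<Sum>x\<in>A. h x y)" for h :: "('x \<Rightarrow> 'x) \<Rightarrow> 'x \<Rightarrow> complex" and A y
    by (induction A rule: infinite_finite_induct) auto
  have comp_add: "(c + c') \<circ> \<rho> = (c \<circ> \<rho>) + (c' \<circ> \<rho>)" and comp_scale: "fscale a c \<circ> \<rho> = fscale a (c \<circ> \<rho>)"
    for c c' :: "'x \<Rightarrow> complex" and \<rho> :: "'x \<Rightarrow> 'x" and a by (auto simp: fscale_def)
  have av_add: "av (c + c') = av c + av c'" for c c'
    unfolding av_def comp_add \<pi>.add sum.distrib ..
  have av_scale: "av (fscale a c) = fscale a (av c)" for a c
    unfolding av_def comp_scale \<pi>.scale fn.scale_sum_right ..
  have avS: "av c \<in> S" for c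
    unfolding av_def using \<pi>(1) by (intro fn.subspace_sum[OF invariantD(1)[OF S]] invariantD(2)[OF S] inv_H) auto
  have av_id: "av c = fscale (of_nat (card H)) c" if c: "c \<in> S" for c
  proof -
    have "\<pi> (c \<circ> \<rho>) \<circ> inv \<rho> = c" if "\<rho> \<in> H" for \<rho>
      using \<pi>(3)[OF invariantD(2)[OF S that c]] comp_inv(1)[OF that] by (simp add: comp_assoc)
    then have "av c = (\<Sum>\<rho>\<in>H. c)" unfolding av_def by simp
    also have "\<dots> = fscale (of_nat (card H)) c" by (rule fn.sum_constant_scale)
    finally show ?thesis .
  qed
  have av_comp: "av (c \<circ> \<eta>) = av c \<circ> \<eta>" if \<eta>: "\<eta> \<in> H" for c \<eta>
  proof -
    have i\<eta>: "inv \<eta> \<in> H" by (rule inv_H[OF \<eta>])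
    have "av (c \<circ> \<eta>) = (\<Sum>\<rho>\<in>H. \<pi> (c \<circ> \<rho>) \<circ> inv \<rho> \<circ> \<eta>)"
      unfolding av_def
    proof (rule sum.reindex_bij_witness[of _ "\<lambda>\<rho>. inv \<eta> \<circ> \<rho>" "\<lambda>\<rho>. \<eta> \<circ> \<rho>"])
      fix \<rho> assume \<rho>: "\<rho> \<in> H"
      show "inv \<eta> \<circ> (\<eta> \<circ> \<rho>) = \<rho>" "\<eta> \<circ> (inv \<eta> \<circ> \<rho>) = \<rho>"
        using comp_inv[OF \<eta>] by (simp_all add: comp_assoc[symmetric])
      show "\<eta> \<circ> \<rho> \<in> H" "inv \<eta> \<circ> \<rho> \<in> H" by (intro comp \<eta> i\<eta> \<rho>)+
      have "inv (\<eta> \<circ> \<rho>) = inv \<rho> \<circ> inv \<eta>" by (rule o_inv_distrib[OF bij[OF \<eta>] bij[OF \<rho>]])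
      then have "inv (\<eta> \<circ> \<rho>) \<circ> \<eta> = inv \<rho>" using comp_inv(2)[OF \<eta>] by (simp add: comp_assoc)
      then show "\<pi> (c \<circ> (\<eta> \<circ> \<rho>)) \<circ> inv (\<eta> \<circ> \<rho>) \<circ> \<eta> = \<pi> (c \<circ> \<eta> \<circ> \<rho>) \<circ> inv \<rho>"
        by (simp add: comp_assoc)
    qed
    also have "\<dots> = av c \<circ> \<eta>" unfolding av_def by (auto simp: app)
    finally show ?thesis .
  qed
  have cH: "of_nat (card H) \<noteq> (0 :: complex)" using finite_H H_ne by simp
  let ?S' = "{c \<in> L. av c = 0}"
  show thesis
  proof (rule that[of ?S'])
    show "invariant ?S'"
      unfolding invariant_def
    proof (intro conjI ballI)
      have "av 0 = 0" using av_scale[of 0 0] by simp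
      then show "fn.subspace ?S'"
        using fn.subspace_0 fn.subspace_add fn.subspace_scale invariantD(1)[OF L]
        by (intro fn.subspaceI) (auto simp: av_add av_scale)
      show "c \<circ> \<rho> \<in> ?S'" if "\<rho> \<in> H" "c \<in> ?S'" for \<rho> c
        using that invariantD(2)[OF L] av_comp by auto
    qed
    show "?S' \<subseteq> L" by blast
    have "c = 0" if c: "c \<in> ?S' \<inter> S" for c
    proof -
      have "fscale (of_nat (card H)) c = 0" using av_id[of c] c by auto
      then show ?thesis using cH by simp
    qed
    moreover have "0 \<in> ?S' \<inter> S"
      using av_scale[of 0 0] fn.subspace_0[OF invariantD(1)[OF L]] fn.subspace_0[OF invariantD(1)[OF S]] by simp
    ultimately show "?S' \<inter> S = {0}" by blast
    obtain x where x: "x \<in> L" "x \<notin> S" using sub by blast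
    \<comment> \<open>The component of \<open>x\<close> in the kernel, scaled by
      \<open>card H\<close>; if it were zero, \<open>x\<close> would lie in
      \<open>S\<close>.\<close>
    define y where "y = fscale (of_nat (card H)) x - av x"
    have "y \<in> L" unfolding y_def using x avS sub
      by (intro fn.subspace_diff[OF invariantD(1)[OF L]] fn.subspace_scale[OF invariantD(1)[OF L]]) auto
    moreover have "av y = 0"
    proof -
      have "av (fscale (of_nat (card H)) x) = av (y + av x)" by (simp add: y_def)
      then show ?thesis unfolding av_add av_scale av_id[OF avS] by simp
    qed
    moreover have "y \<noteq> 0"
    proof
      assume "y = 0"
      then have "fscale (of_nat (card H)) x \<in> S" using avS[of x] by (simp add: y_def)
      then have "fscale (1 / of_nat (card H)) (fscale (of_nat (card H)) x) \<in> S"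
        by (rule fn.subspace_scale[OF invariantD(1)[OF S]])
      then show False using x cH by simp
    qed
    ultimately show "?S' \<noteq> {0}" by blast
  qed
qed

lemma minimal_invariant_exists:
  assumes "invariant L" "L \<noteq> {0}" "L \<subseteq> supported I"
  shows "\<exists>L'. minimal_invariant L' \<and> L' \<subseteq> L"
  using assms
proof (induction "fn.dim L" arbitrary: L rule: less_induct)
  case less
  obtain F :: "('x \<Rightarrow> complex) set" where F: "finite F" "supported I \<subseteq> fn.span F"
    by (rule finite_spanning_supported[OF finite_I])
  show ?case
  proof (cases "minimal_invariant L")
    case False
    then obtain L' where L': "invariant L'" "L' \<subseteq> L" "L' \<noteq> {0}" "L' \<noteq> L"
      using less.prems unfolding minimal_invariant_def by blast
    have "fn.dim L' < fn.dim L"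
      by (rule dim_strict_mono[OF F(1) _ invariantD(1)[OF L'(1)]]) (use L' less.prems(3) F(2) in auto)
    from less.hyps[OF this L'(1,3)] L'(2) less.prems(3) show ?thesis by blast
  qed blast
qed

text \<open>If the span were proper, a nonzero invariant complement would contain a minimal
  invariant subspace by finite dimension, and this one would belong to the span as well.\<close>

lemma span_minimal_invariant:
  assumes L: "invariant L" "L \<subseteq> supported I"
  shows "L \<subseteq> fn.span (\<Union>{L'. minimal_invariant L' \<and> L' \<subseteq> L})"
proof (rule ccontr)
  let ?U = "\<Union>{L'. minimal_invariant L' \<and> L' \<subseteq> L}"
  assume "\<not> L \<subseteq> fn.span ?U"
  moreover have "fn.span ?U \<subseteq> L" by (rule fn.span_minimal[OF _ invariantD(1)[OF L(1)]]) blast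
  ultimately have sub: "fn.span ?U \<subset> L" by blast
  have inv: "invariant (fn.span ?U)"
    unfolding invariant_def
  proof (intro conjI ballI)
    fix \<rho> c assume \<rho>: "\<rho> \<in> H" and c: "c \<in> fn.span ?U"
    show "c \<circ> \<rho> \<in> fn.span ?U"
      using c
    proof (induction rule: fn.span_induct_alt)
      case base
      have "(0 :: 'x \<Rightarrow> complex) \<circ> \<rho> = 0" by auto
      then show ?case using fn.span_zero by metis
    next
      case (step a x y)
      have "(fscale a x + y) \<circ> \<rho> = fscale a (x \<circ> \<rho>) + (y \<circ> \<rho>)" by (auto simp: fscale_def)
      moreover have "x \<circ> \<rho> \<in> ?U"
        using step(1) invariantD(2)[OF _ \<rho>] unfolding minimal_invariant_def by blast
      ultimately show ?case using step(2) by (metis fn.span_add fn.span_base fn.span_scale)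
    qed
  qed (rule fn.subspace_span)
  obtain S' where S': "invariant S'" "S' \<subseteq> L" "S' \<inter> fn.span ?U = {0}" "S' \<noteq> {0}"
    by (rule maschke[OF inv L(1) sub])
  obtain L' where L': "minimal_invariant L'" "L' \<subseteq> S'"
    using minimal_invariant_exists[OF S'(1,4) subset_trans[OF S'(2) L(2)]] by auto
  have "L' \<subseteq> ?U" using L'(1) subset_trans[OF L'(2) S'(2)] by auto
  then have "L' \<subseteq> fn.span ?U" by (rule subset_trans[OF _ fn.span_superset])
  then have "L' \<subseteq> {0}" using L'(2) S'(3) by auto
  moreover have "0 \<in> L'" using L'(1) fn.subspace_0[of L'] by (simp add: minimal_invariant_def invariant_def)
  ultimately have "L' = {0}" by auto
  then show False using L'(1) by (simp add: minimal_invariant_def)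
qed

end

section \<open>The layers of the filtration\<close>

lemma supportedD: "c \<in> supported I \<Longrightarrow> x \<notin> I \<Longrightarrow> c x = 0"
  by (simp add: supported_def)

lemma supportedI: "(\<And>x. x \<notin> I \<Longrightarrow> c x = 0) \<Longrightarrow> c \<in> supported I"
  by (simp add: supported_def)

context mackey_tensors
begin

text \<open>Descent from above: take the least degree, not below \<open>k\<close>, that occurs
  exactly in \<open>N\<close>. If it exceeded \<open>k\<close>, \<open>lower_degree\<close> would
  produce a smaller one.\<close>

lemma layer_essential:
  assumes N: "gstable N" "N \<subseteq> Mix" and t: "t \<in> N" "t \<notin> Tlt k"
  obtains x where "x \<in> N" "x \<in> Tlt (Suc k)" "x \<notin> Tlt k"
proof -
  define P where "P l \<longleftrightarrow> k \<le> l \<and> (\<exists>x\<in>N. x \<in> Tlt (Suc l) \<and> x \<notin> Tlt l)" for l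
  define l0 where "l0 = (LEAST l. t \<in> Tlt (Suc l))"
  have "t \<in> Tlt (Suc m)" using t(1) N(2) Tlt_Suc_m by auto
  then have l0: "t \<in> Tlt (Suc l0)" unfolding l0_def by (rule LeastI)
  have "k \<le> l0"
  proof (rule ccontr)
    assume "\<not> k \<le> l0"
    then show False using l0 t(2) Tlt_mono[of "Suc l0" k] by auto
  qed
  moreover have "t \<notin> Tlt l0"
  proof (cases l0)
    case 0
    then show ?thesis using t(2) Tlt_mono[of 0 k] by auto
  next
    case (Suc l)
    then show ?thesis using not_less_Least[of l "\<lambda>l. t \<in> Tlt (Suc l)"] unfolding l0_def by auto
  qed
  ultimately have "P l0" using l0 t(1) by (auto simp: P_def)
  define l where "l = (LEAST l. P l)"
  have l: "P l" unfolding l_def by (rule LeastI[where P = P, OF \<open>P l0\<close>])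
  then obtain x where x: "k \<le> l" "x \<in> N" "x \<in> Tlt (Suc l)" "x \<notin> Tlt l" by (auto simp: P_def)
  have "l = k"
  proof (rule ccontr)
    assume "l \<noteq> k"
    then obtain l' where l': "l = Suc l'" "k \<le> l'" using x(1) by (cases l) auto
    obtain a where a: "a \<in> g" "act a x \<in> Tlt (Suc l')" "act a x \<notin> Tlt l'"
      using lower_degree[of x l'] x(3,4) l'(1) by auto
    then have "P l'" using l'(2) gstableD(2)[OF N(1) a(1) x(2)] by (auto simp: P_def)
    then have "l \<le> l'" unfolding l_def by (rule Least_le)
    then show False using l'(1) by simp
  qed
  then show thesis using that x by blast
qed

text \<open>The sum of \<open>N\<close> and \<open>Tlt k\<close>. It contains \<open>Tlt k\<close>,
  as \<open>polarization\<close> asks of the submodule in which membership is tested.\<close>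

definition thick :: "nat \<Rightarrow> 'a mixed set \<Rightarrow> 'a mixed set" where
  "thick k N = {z. \<exists>x\<in>N. z - x \<in> Tlt k}"

lemma thickI: "x \<in> N \<Longrightarrow> z - x \<in> Tlt k \<Longrightarrow> z \<in> thick k N"
  by (auto simp: thick_def)

lemma thickE:
  assumes "z \<in> thick k N"
  obtains x where "x \<in> N" "z - x \<in> Tlt k"
  using assms by (auto simp: thick_def)

lemma Tlt_sub_thick: "gstable N \<Longrightarrow> Tlt k \<subseteq> thick k N"
  using thickI[of 0 N] fn.subspace_0[OF gstableD(1)] by auto

lemma gstable_thick:
  assumes N: "gstable N"
  shows "gstable (thick k N)"
  unfolding gstable_def
proof (intro conjI ballI)
  note sN = gstableD(1)[OF N]
  show "fn.subspace (thick k N)"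
  proof (rule fn.subspaceI)
    show "0 \<in> thick k N" using Tlt_sub_thick[OF N] fn.subspace_0[OF subspace_Tlt] by blast
  next
    fix x y assume "x \<in> thick k N" "y \<in> thick k N"
    then obtain x' y' where xy: "x' \<in> N" "x - x' \<in> Tlt k" "y' \<in> N" "y - y' \<in> Tlt k" by (metis thickE)
    have "(x + y) - (x' + y') = (x - x') + (y - y')" by simp
    also have "\<dots> \<in> Tlt k" using xy by (intro fn.subspace_add[OF subspace_Tlt])
    finally show "x + y \<in> thick k N" by (rule thickI[OF fn.subspace_add[OF sN xy(1,3)]])
  next
    fix c x assume "x \<in> thick k N"
    then obtain x' where x: "x' \<in> N" "x - x' \<in> Tlt k" by (rule thickE)
    have "fscale c x - fscale c x' \<in> Tlt k"
      unfolding fn.scale_right_diff_distrib[symmetric] by (rule fn.subspace_scale[OF subspace_Tlt x(2)])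
    then show "fscale c x \<in> thick k N" by (rule thickI[OF fn.subspace_scale[OF sN x(1)]])
  qed
  fix a x assume a: "a \<in> g" and "x \<in> thick k N"
  then obtain x' where x: "x' \<in> N" "x - x' \<in> Tlt k" by (meson thickE)
  have "act a x - act a x' \<in> Tlt k"
    unfolding act_simps(4)[OF a, symmetric] by (rule Tlt_act[OF a x(2)])
  then show "act a x \<in> thick k N" by (rule thickI[OF gstableD(2)[OF N a x(1)]])
qed

text \<open>The preimages of simple submodules of the quotient by \<open>F\<close>; this keeps
  cosets out of the argument until socles are compared.\<close>

definition minimal_over :: "'a mixed set \<Rightarrow> 'a mixed set \<Rightarrow> bool" where
  "minimal_over F N \<longleftrightarrow> gstable N \<and> F \<subset> N \<and> (\<forall>N'. gstable N' \<and> F \<subseteq> N' \<and> N' \<subseteq> N \<longrightarrow> N' = F \<or> N' = N)"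

lemma acts_ppos:
  assumes "t \<in> Mix" "set u \<subseteq> g" "\<sigma> permutes {..<m}" "\<tau> permutes {..<n}"
  shows "acts u (ppos \<sigma> \<tau> t) = ppos \<sigma> \<tau> (acts u t)"
  using assms(1,2)
proof (induction u arbitrary: t)
  case (Cons a u)
  then show ?case using act_ppos[OF Cons.prems(1) _ assms(3,4), of a] Mix_act[of a t] by simp
qed simp

lemma gstable_Mix: "gstable Mix"
  using gstable_Tlt[of "Suc m"] by (simp add: Tlt_Suc_m)

text \<open>Left multiplication in S_m x S_n. It describes relabelling of letters, see
  \<open>gword_rho\<close>, and commutes with permutations of positions, which multiply on the
  right.\<close>

definition rho :: "(nat \<Rightarrow> nat) \<times> (nat \<Rightarrow> nat) \<Rightarrow> (nat \<Rightarrow> nat) \<times> (nat \<Rightarrow> nat) \<Rightarrow> (nat \<Rightarrow> nat) \<times> (nat \<Rightarrow> nat)" where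
  "rho h x = (fst h \<circ> fst x, snd h \<circ> snd x)"

definition pinv :: "(nat \<Rightarrow> nat) \<times> (nat \<Rightarrow> nat) \<Rightarrow> (nat \<Rightarrow> nat) \<times> (nat \<Rightarrow> nat)" where
  "pinv h = (inv (fst h), inv (snd h))"

lemma rho_rho: "rho h (rho h' x) = rho (rho h h') x"
  by (simp add: rho_def comp_assoc)

lemma rho_Idx: "h \<in> Idx \<Longrightarrow> x \<in> Idx \<Longrightarrow> rho h x \<in> Idx"
  by (auto simp: rho_def intro: permutes_compose)

lemma pinv_Idx: "h \<in> Idx \<Longrightarrow> pinv h \<in> Idx"
  by (auto simp: pinv_def intro: permutes_inv)

lemma pinv_pinv: "h \<in> Idx \<Longrightarrow> pinv (pinv h) = h"
  by (auto simp: pinv_def inv_inv_eq permutes_bij)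

lemma rho_pinv: "h \<in> Idx \<Longrightarrow> rho h (pinv h) = (id, id)" "h \<in> Idx \<Longrightarrow> rho (pinv h) h = (id, id)"
  by (auto simp: rho_def pinv_def permutes_inv_o)

lemma rho_id: "rho (id, id) x = x" "rho x (id, id) = x"
  by (simp_all add: rho_def)

lemma rho_cancel: "h \<in> Idx \<Longrightarrow> rho h (rho (pinv h) x) = x" "h \<in> Idx \<Longrightarrow> rho (pinv h) (rho h x) = x"
  by (simp_all only: rho_rho rho_pinv rho_id)

lemma rho_Idx_iff: "h \<in> Idx \<Longrightarrow> rho h x \<in> Idx \<longleftrightarrow> x \<in> Idx"
  using rho_Idx[of h x] rho_Idx[OF pinv_Idx, of h "rho h x"] rho_cancel(2)[of h x] by auto

text \<open>The group S_(m-k) x S_k x S_n of relabellings that preserve the kinds of letters of a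
  generic word.\<close>

definition Hk :: "nat \<Rightarrow> ((nat \<Rightarrow> nat) \<times> (nat \<Rightarrow> nat)) set" where
  "Hk k = {h \<in> Idx. \<forall>i<m - k. fst h i < m - k}"

lemma Hk_Idx: "h \<in> Hk k \<Longrightarrow> h \<in> Idx"
  by (simp add: Hk_def)

lemma Hk_iff:
  assumes "h \<in> Hk k"
  shows "fst h i < m - k \<longleftrightarrow> i < m - k"
proof
  have p: "fst h permutes {..<m}" using assms by (auto simp: Hk_def)
  have "fst h ` {..<m - k} \<subseteq> {..<m - k}" using assms by (auto simp: Hk_def)
  then have "fst h ` {..<m - k} = {..<m - k}"
    by (rule endo_inj_surj[OF finite_lessThan]) (use permutes_inj_on[OF p] inj_on_subset in blast)
  moreover assume "fst h i < m - k"
  ultimately obtain j where "j < m - k" "fst h j = fst h i" by (metis imageE lessThan_iff)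
  then show "i < m - k" using permutes_inj[OF p] by (simp add: inj_eq)
next
  assume "i < m - k" then show "fst h i < m - k" using assms by (simp add: Hk_def)
qed

lemma Hk_pinv: "h \<in> Hk k \<Longrightarrow> pinv h \<in> Hk k"
proof -
  assume h: "h \<in> Hk k"
  then have p: "fst h permutes {..<m}" by (auto simp: Hk_def)
  have "fst h (inv (fst h) i) = i" for i using permutes_inverses[OF p] by simp
  then have "inv (fst h) i < m - k" if "i < m - k" for i using Hk_iff[OF h, of "inv (fst h) i"] that by simp
  then show ?thesis using pinv_Idx[OF Hk_Idx[OF h]] by (simp add: Hk_def pinv_def)
qed

lemma permutation_action_Hk: "permutation_action (rho ` Hk k) Idx"
proof
  have inv: "inv (rho h) = rho (pinv h)" "bij (rho h)" if "h \<in> Hk k" for h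
  proof -
    have "rho h \<circ> rho (pinv h) = id" "rho (pinv h) \<circ> rho h = id"
      using rho_cancel[OF Hk_Idx[OF that]] by (auto simp: fun_eq_iff)
    then show "inv (rho h) = rho (pinv h)" "bij (rho h)" by (auto intro: inv_unique_comp o_bij)
  qed
  show "finite (rho ` Hk k)" using finite_Idx by (simp add: Hk_def)
  show "finite Idx" by (rule finite_Idx)
  have "(id, id) \<in> Hk k" by (simp add: Hk_def permutes_id)
  then show "rho ` Hk k \<noteq> {}" by blast
  show "\<rho> \<circ> \<rho>' \<in> rho ` Hk k" if \<rho>: "\<rho> \<in> rho ` Hk k" "\<rho>' \<in> rho ` Hk k" for \<rho> \<rho>'
  proof -
    obtain h h' where h: "\<rho> = rho h" "\<rho>' = rho h'" "h \<in> Hk k" "h' \<in> Hk k" using \<rho> by blast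
    have "rho h h' \<in> Hk k" using h(3,4) rho_Idx[of h h'] by (auto simp: Hk_def rho_def)
    moreover have "\<rho> \<circ> \<rho>' = rho (rho h h')" by (auto simp: h rho_rho fun_eq_iff)
    ultimately show ?thesis by blast
  qed
  show "bij \<rho>" if "\<rho> \<in> rho ` Hk k" for \<rho> using that inv(2) by blast
  show "inv \<rho> \<in> rho ` Hk k" if "\<rho> \<in> rho ` Hk k" for \<rho> using that inv(1) Hk_pinv by blast
qed

lemma gword_rho:
  assumes "length yf = m" "length yv = n" "x \<in> Idx"
  shows "gword (permute_list (fst h) yf) (permute_list (snd h) yv) x = gword yf yv (rho h x)"
proof -
  have "fst x permutes {..<length yf}" "snd x permutes {..<length yv}" using assms by auto
  then show ?thesis unfolding gword_def rho_def by (simp add: permute_list_compose)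
qed

lemma gsum_cong: "(\<And>x. x \<in> Idx \<Longrightarrow> c x = c' x) \<Longrightarrow> gsum yf yv c = gsum yf yv c'"
  unfolding gsum_def by (rule sum.cong) auto

end

section \<open>Coefficient spaces of submodules at a generic word\<close>

locale mackey_generic = mackey_tensors +
  fixes k :: nat and yf :: "('a \<Rightarrow> complex) list" and yv :: "'a list"
  assumes k_le: "k \<le> m" and y: "generic k yf yv"
begin

sublocale H: permutation_action "rho ` Hk k" Idx
  by (rule permutation_action_Hk)

lemma yw: "(yf, yv) \<in> words"
  using y by (simp add: generic_def)

lemma ylen: "length yf = m" "length yv = n"
  using wordD(2,3)[OF yw] by auto

lemma gword_inj:
  assumes "x \<in> Idx" "x' \<in> Idx" "gword yf yv x = gword yf yv x'"
  shows "x = x'"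
proof -
  have eq: "\<sigma> = \<sigma>'" if "\<sigma> permutes {..<length ys}" "\<sigma>' permutes {..<length ys}" "distinct ys"
    "permute_list \<sigma> ys = permute_list \<sigma>' ys" for \<sigma> \<sigma>' and ys :: "'b list"
  proof
    fix i
    show "\<sigma> i = \<sigma>' i"
    proof (cases "i < length ys")
      case True
      then have "\<sigma> i < length ys" "\<sigma>' i < length ys"
        using permutes_in_image[OF that(1), of i] permutes_in_image[OF that(2), of i] by auto
      moreover have "ys ! \<sigma> i = ys ! \<sigma>' i" 
      proof -
        have "permute_list \<sigma> ys ! i = permute_list \<sigma>' ys ! i" by (simp only: that(4))
        then show ?thesis using that(1,2) True by (simp add: permute_list_nth)
      qed
      ultimately show ?thesis using that(3) by (simp add: nth_eq_iff_index_eq)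
    next
      case False
      then show ?thesis using that(1,2) by (simp add: permutes_def)
    qed
  qed
  have "fst x = fst x'" by (rule eq[of _ yf]) (use assms y ylen in \<open>auto simp: gword_def generic_def\<close>)
  moreover have "snd x = snd x'" by (rule eq[of _ yv]) (use assms y ylen in \<open>auto simp: gword_def generic_def\<close>)
  ultimately show ?thesis by (simp add: prod_eq_iff)
qed

definition cy :: "'a mixed \<Rightarrow> (nat \<Rightarrow> nat) \<times> (nat \<Rightarrow> nat) \<Rightarrow> complex" where
  "cy t = (\<lambda>x. if x \<in> Idx then crd t (gword yf yv x) else 0)"

lemma cy_simps: "cy (s + t) = cy s + cy t" "cy (fscale c t) = fscale c (cy t)" "cy 0 = 0" "cy (s - t) = cy s - cy t"
  unfolding cy_def crd_simps by (auto simp: fscale_def)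

lemma cy_supported: "cy t \<in> supported Idx"
  by (simp add: cy_def supported_def)

lemma cy_Tlt: "t \<in> Tlt k \<Longrightarrow> cy t = 0"
proof
  fix x assume t: "t \<in> Tlt k"
  show "cy t x = 0 x"
  proof (cases "x \<in> Idx")
    case True
    then have "nq (fst (gword yf yv x)) = k" using gword_words(4)[OF yw] nq_generic[OF y k_le] by simp
    then show ?thesis using crd_Tlt[OF t, of "gword yf yv x"] by (simp add: cy_def)
  qed (simp add: cy_def)
qed

lemma crd_gword:
  assumes "x \<in> Idx" "x' \<in> Idx"
  shows "crd (ptw (gword yf yv x)) (gword yf yv x') = (if x' = x then 1 else 0)"
  using crd_word[OF gword_words(1)[OF yw assms(1)]] gword_inj[OF assms(2,1)] by auto

lemma cy_gsum: "x \<in> Idx \<Longrightarrow> cy (gsum yf yv c) x = c x"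
proof -
  assume x: "x \<in> Idx"
  have "cy (gsum yf yv c) x = (\<Sum>x'\<in>Idx. c x' * crd (ptw (gword yf yv x')) (gword yf yv x))"
    unfolding cy_def gsum_def crd_simps using x by simp
  also have "\<dots> = (\<Sum>x'\<in>Idx. if x' = x then c x else 0)"
    by (rule sum.cong) (auto simp: crd_gword x)
  also have "\<dots> = c x" using x finite_Idx by (simp only: sum.delta if_True)
  finally show ?thesis .
qed

lemma cy_gsum_supported: "c \<in> supported Idx \<Longrightarrow> cy (gsum yf yv c) = c"
proof
  fix x assume c: "c \<in> supported Idx"
  show "cy (gsum yf yv c) x = c x"
  proof (cases "x \<in> Idx")
    case False
    then show ?thesis using supportedD[OF c False] by (simp only: cy_def if_False)
  qed (rule cy_gsum)
qed

lemma cy_eq: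
  assumes "t - gsum yf yv c \<in> Tlt k" "c \<in> supported Idx"
  shows "cy t = c"
proof -
  have "cy t - cy (gsum yf yv c) = 0" using cy_Tlt[OF assms(1)] by (simp only: cy_simps)
  then show ?thesis using cy_gsum_supported[OF assms(2)] by simp
qed

lemma gsum_cy:
  assumes "t - gsum yf yv c \<in> Tlt k"
  shows "t - gsum yf yv (cy t) \<in> Tlt k"
proof -
  have "cy t = cy (t - gsum yf yv c) + cy (gsum yf yv c)" by (simp only: cy_simps) simp
  then have "cy t = cy (gsum yf yv c)" using cy_Tlt[OF assms] by simp
  then have "gsum yf yv (cy t) = gsum yf yv c" by (intro gsum_cong) (simp add: cy_gsum)
  then show ?thesis using assms by simp
qed

definition symb :: "'a mixed set \<Rightarrow> ((nat \<Rightarrow> nat) \<times> (nat \<Rightarrow> nat) \<Rightarrow> complex) set" where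
  "symb N = {c \<in> supported Idx. \<exists>x\<in>N. x - gsum yf yv c \<in> Tlt k}"

lemma symb_thick:
  assumes "gstable N" "c \<in> supported Idx"
  shows "c \<in> symb N \<longleftrightarrow> gsum yf yv c \<in> thick k N"
proof -
  have "x - gsum yf yv c \<in> Tlt k \<longleftrightarrow> gsum yf yv c - x \<in> Tlt k" for x
    using fn.subspace_neg[OF subspace_Tlt, of "x - gsum yf yv c"]
      fn.subspace_neg[OF subspace_Tlt, of "gsum yf yv c - x"] by (auto simp only: minus_diff_eq)
  then show ?thesis using assms(2) by (simp add: symb_def thick_def)
qed

lemma supported_rho: "c \<in> supported Idx \<Longrightarrow> h \<in> Idx \<Longrightarrow> c \<circ> rho h \<in> supported Idx"
  using supportedD[of c Idx] rho_Idx_iff[of h] by (intro supportedI) (simp del: mem_Sigma_iff)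

text \<open>Moving the letters of \<open>y\<close> away and back onto their permuted positions shows that the symbols of a
  submodule are stable under relabelling.\<close>

lemma symb_invariant:
  assumes N: "gstable N"
  shows "H.invariant (symb N)"
  unfolding H.invariant_def
proof (intro conjI ballI)
  note gT = gstable_thick[OF N, of k]
  note sT = gstableD(1)[OF gT]
  have ss: "fn.subspace (supported Idx)"
    by (rule fn.subspaceI) (auto simp: supported_def fscale_def)
  show "fn.subspace (symb N)"
  proof (rule fn.subspaceI)
    have "gsum yf yv 0 = 0" by (simp add: gsum_def)
    then show "0 \<in> symb N" using symb_thick[OF N fn.subspace_0[OF ss]] fn.subspace_0[OF sT] by simp
  next
    fix c c' assume c: "c \<in> symb N" "c' \<in> symb N"
    then have s: "c \<in> supported Idx" "c' \<in> supported Idx" by (auto simp: symb_def)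
    show "c + c' \<in> symb N"
      using c symb_thick[OF N] s fn.subspace_add[OF ss s] fn.subspace_add[OF sT] by (simp add: gsum_add)
  next
    fix a c assume c: "c \<in> symb N"
    then have s: "c \<in> supported Idx" by (auto simp: symb_def)
    show "fscale a c \<in> symb N"
      using c symb_thick[OF N] s fn.subspace_scale[OF ss s] fn.subspace_scale[OF sT] by (simp add: gsum_scale)
  qed
  fix \<rho> c assume "\<rho> \<in> rho ` Hk k" and c: "c \<in> symb N"
  then obtain h where h: "h \<in> Hk k" "\<rho> = rho h" by blast
  note hI = Hk_Idx[OF h(1)]
  \<comment> \<open>Coefficients \<open>c\<close> at the word relabelled by the inverse of
    \<open>h\<close> are the coefficients \<open>c \<circ> rho h\<close> at the original
    word.\<close>
  let ?h = "pinv h"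
  have h'I: "?h \<in> Idx" by (rule pinv_Idx[OF hI])
  let ?yf = "permute_list (fst ?h) yf" and ?yv = "permute_list (snd ?h) yv"
  have perm: "fst ?h permutes {..<length yf}" "snd ?h permutes {..<length yv}" using h'I ylen by auto
  have sets: "set ?yf = set yf" "set ?yv = set yv" using perm by (simp_all add: set_permute_list)
  have hy: "generic k ?yf ?yv"
    unfolding generic_def
  proof (intro conjI allI impI)
    show "(?yf, ?yv) \<in> words" using wordD[OF yw] sets by (intro wordI) simp_all
    show "distinct ?yf" "distinct ?yv" using y perm by (simp_all add: generic_def)
    show "?yf ! i \<in> Q \<longleftrightarrow> m - k \<le> i" if i: "i < m" for i
    proof -
      have "fst ?h i < m" using permutes_in_image[OF perm(1), of i] i ylen by simp
      then have "?yf ! i \<in> Q \<longleftrightarrow> m - k \<le> fst ?h i"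
        using y i perm ylen by (simp add: permute_list_nth generic_def)
      then show ?thesis using Hk_iff[OF Hk_pinv[OF h(1)], of i] by (simp add: not_less[symmetric])
    qed
    show "e i \<notin> set ?yv" if "d i \<in> set ?yf" for i using that y unfolding sets by (simp add: generic_def)
  qed
  \<comment> \<open>The relabelled word has the same letters as \<open>y\<close>, so
    \<open>moves_generic\<close> cannot connect the two directly. Applied to the zero tensor,
    \<open>polarize_fresh\<close> supplies a disjoint generic word in between.\<close>
  have zero: "(0 :: 'a mixed) \<in> Tlt (Suc k)" by (rule fn.subspace_0[OF subspace_Tlt])
  obtain zf zv where z: "generic k zf zv" "set zf \<inter> set yf = {}" "set zv \<inter> set yv = {}"
    "\<And>i. d i \<in> set yf \<Longrightarrow> e i \<notin> set zv" "\<And>i. e i \<in> set yv \<Longrightarrow> d i \<notin> set zf"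
    by (rule polarize_fresh[OF zero k_le finite_set[of yf] finite_set[of yv]]) blast
  have "moves k yf yv zf zv" by (rule moves_generic[OF k_le y z(1)]) (use z in auto)
  moreover have "moves k zf zv ?yf ?yv"
    by (rule moves_generic[OF k_le z(1) hy]) (use z in \<open>auto simp: sets\<close>)
  ultimately have "moves k yf yv ?yf ?yv" by (rule moves_trans)
  then obtain u where u: "set u \<subseteq> g" "acts u (gsum yf yv c) - gsum ?yf ?yv c \<in> Tlt k"
    unfolding moves_def by blast
  have cs: "c \<in> supported Idx" using c by (simp add: symb_def)
  have "gsum yf yv c \<in> thick k N" using c symb_thick[OF N cs] by simp
  then have "acts u (gsum yf yv c) \<in> thick k N" by (rule gstable_acts[OF gT u(1)])
  then have "acts u (gsum yf yv c) - (acts u (gsum yf yv c) - gsum ?yf ?yv c) \<in> thick k N"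
    by (rule fn.subspace_diff[OF sT]) (use Tlt_sub_thick[OF N] u(2) in blast)
  then have "gsum ?yf ?yv c \<in> thick k N" by simp
  moreover have "gsum ?yf ?yv c = gsum yf yv (c \<circ> rho h)"
    unfolding gsum_def
  proof (rule sum.reindex_bij_witness[of _ "rho h" "rho ?h"])
    fix x assume x: "x \<in> Idx"
    show "rho h (rho ?h x) = x" "rho ?h (rho h x) = x" by (rule rho_cancel[OF hI])+
    show "rho ?h x \<in> Idx" "rho h x \<in> Idx" by (rule rho_Idx[OF h'I x] rho_Idx[OF hI x])+
    show "fscale ((c \<circ> rho h) (rho ?h x)) (ptw (gword yf yv (rho ?h x))) = fscale (c x) (ptw (gword ?yf ?yv x))"
      unfolding gword_rho[OF ylen x] by (simp only: comp_apply rho_cancel[OF hI])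
  qed
  ultimately show "c \<circ> \<rho> \<in> symb N" unfolding h(2) using symb_thick[OF N supported_rho[OF cs hI]] by simp
qed

text \<open>Permuting the positions is a right translation of the index. The inverses compensate
  that \<open>ppos\<close> permutes arguments, hence factors by the inverse permutation.\<close>

lemma crd_ppos:
  assumes s: "s \<in> Mix" and x: "x \<in> Idx" and x': "x' \<in> Idx"
  shows "crd (ppos (inv (fst x)) (inv (snd x)) s) (gword yf yv x') = crd s (gword yf yv (rho x' (pinv x)))"
proof -
  have p: "fst x permutes {..<m}" "snd x permutes {..<n}" using x by auto
  note p' = permutes_inv[OF p(1)] permutes_inv[OF p(2)]
  have "s \<in> fn.span (ptw ` {w \<in> words. nq (fst w) < Suc m})" using s Tlt_Suc_m Tlt_words by metis
  then show ?thesis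
  proof (induction rule: fn.span_induct_alt)
    case base
    show ?case unfolding ppos_simps crd_simps ..
  next
    case (step c a b)
    then obtain w where w: "w \<in> words" "a = ptw w" by blast
    obtain bs cs where w': "w = (bs, cs)" by (cases w)
    note W = wordD[OF w(1)[unfolded w']]
    have len: "length bs = m" "length cs = n" by (rule W)+
    have P: "ppos (inv (fst x)) (inv (snd x)) a = pt (permute_list (fst x) bs) (permute_list (snd x) cs)"
      using ppos_pure[OF W(1) p'] p by (simp add: w(2) w' permutes_bij inv_inv_eq)
    have "(permute_list (fst x) bs, permute_list (snd x) cs) \<in> words"
      by (rule wordI) (use W p in \<open>simp_all add: set_permute_list\<close>)
    then have 1: "crd (ppos (inv (fst x)) (inv (snd x)) a) (gword yf yv x') =
        (if gword yf yv x' = (permute_list (fst x) bs, permute_list (snd x) cs) then 1 else 0)"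
      unfolding P using crd_word[of "(permute_list (fst x) bs, permute_list (snd x) cs)"] by simp
    have swap: "permute_list \<sigma>' ys = permute_list \<sigma> us \<longleftrightarrow> permute_list (\<sigma>' \<circ> inv \<sigma>) ys = us"
      if "\<sigma> permutes {..<length us}" "length ys = length us" for \<sigma> \<sigma>' and ys us :: "'z list"
    proof -
      note pi = permutes_inv[OF that(1)]
      have 1: "permute_list (\<sigma>' \<circ> inv \<sigma>) ys = permute_list (inv \<sigma>) (permute_list \<sigma>' ys)"
        by (rule permute_list_compose) (use pi that in simp)
      have 2: "permute_list (inv \<sigma>) (permute_list \<sigma> us) = us"
        using permute_list_compose[of "inv \<sigma>" us \<sigma>] pi permutes_inv_o[OF that(1)] by simp
      have 3: "permute_list \<sigma> (permute_list (inv \<sigma>) zs) = zs" if "length zs = length us" for zs :: "'z list"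
        using permute_list_compose[of \<sigma> zs "inv \<sigma>"] \<open>\<sigma> permutes {..<length us}\<close> that
          permutes_inv_o[OF \<open>\<sigma> permutes {..<length us}\<close>] by simp
      show ?thesis unfolding 1 using 2 3[of "permute_list \<sigma>' ys"] that(2) by auto
    qed
    have "gword yf yv x' = (permute_list (fst x) bs, permute_list (snd x) cs) \<longleftrightarrow>
        gword yf yv (rho x' (pinv x)) = w"
      unfolding gword_def rho_def pinv_def w' using swap[of "fst x" bs yf] swap[of "snd x" cs yv] p len ylen by simp
    then have "crd (ppos (inv (fst x)) (inv (snd x)) a) (gword yf yv x') = crd a (gword yf yv (rho x' (pinv x)))"
      unfolding 1 using crd_word[OF w(1)] by (simp add: w(2))
    then show ?case unfolding ppos_simps crd_simps step(2) by simp
  qed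
qed

text \<open>On combinations of arrangements of \<open>y\<close> the enveloping algebra acts on coordinates through the
  relabellings in \<open>Hk k\<close>, because it commutes with permutations of the factors and preserves
  the positions filled from \<open>Vs\<close>.\<close>

lemma cy_acts:
  assumes L: "H.invariant L" "L \<subseteq> supported Idx" and c: "c \<in> L" and u: "set u \<subseteq> g"
  shows "cy (acts u (gsum yf yv c)) \<in> L"
proof -
  let ?R = "fn.span {pt fs vs |fs vs. lists_of fs vs \<and> (\<forall>i<m - k. fs ! i \<in> Vs)}"
  define s where "s = acts u (pt yf yv)"
  have y0: "pt yf yv \<in> ?R"
  proof (rule fn.span_base)
    have "yf ! i \<in> Vs" if "i < m - k" for i
    proof -
      have "yf ! i \<notin> Q" "yf ! i \<in> B" using y that wordD(6)[OF yw, of i] by (auto simp: generic_def)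
      then show ?thesis using d_in_Vs by auto
    qed
    then show "pt yf yv \<in> {pt fs vs |fs vs. lists_of fs vs \<and> (\<forall>i<m - k. fs ! i \<in> Vs)}"
      using wordD(1)[OF yw] by blast
  qed
  have "gstable ?R"
    unfolding gstable_def
  proof (intro conjI ballI fn.subspace_span)
    fix a t assume a: "a \<in> g" and t: "t \<in> ?R"
    show "act a t \<in> ?R"
      by (rule span_pure_act[OF _ a t]) (metis (no_types, lifting) length_list_update nth_list_update_eq nth_list_update_neq list_update_beyond not_le)
  qed
  then have sR: "s \<in> ?R" unfolding s_def by (rule gstable_acts[OF _ u y0])
  have y1: "pt yf yv \<in> Mix" unfolding Mix_eq using wordD(1)[OF yw] by (intro fn.span_base) blast
  have sM: "s \<in> Mix" unfolding s_def by (rule gstable_acts[OF gstable_Mix u y1])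
  define E where "E \<eta> = crd s (gword yf yv \<eta>)" for \<eta>
  \<comment> \<open>The words in \<open>s\<close> have letters from \<open>range d\<close> in the
    first \<open>m - k\<close> positions; an index outside \<open>Hk k\<close> would bring a letter
    from \<open>Q\<close> there.\<close>
  have E0: "E \<eta> = 0" if \<eta>: "\<eta> \<in> Idx" "\<eta> \<notin> Hk k" for \<eta>
  proof (rule ccontr)
    assume nz: "E \<eta> \<noteq> 0"
    let ?\<Omega> = "{w \<in> words. \<forall>i<m - k. fst w ! i \<in> range d}"
    have "?R \<subseteq> fn.span (ptw ` ?\<Omega>)"
    proof (rule fn.span_minimal[OF _ fn.subspace_span], safe)
      fix fs vs assume l: "lists_of fs vs" and fs: "\<forall>i<m - k. fs ! i \<in> Vs"
      have "{w \<in> words. \<forall>i<m. fs ! i \<in> Vs \<longrightarrow> fst w ! i \<in> range d} \<subseteq> ?\<Omega>" using fs by auto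
      then show "pt fs vs \<in> fn.span (ptw ` ?\<Omega>)"
        using pt_expand[OF l] fn.span_mono[OF image_mono] by blast
    qed
    then have "s \<in> fn.span (ptw ` ?\<Omega>)" using sR by blast
    from crd_support[OF nz[unfolded E_def] this] have "gword yf yv \<eta> \<in> ?\<Omega>" by blast
    then have "permute_list (fst \<eta>) yf ! i \<in> range d" if "i < m - k" for i using that by (simp add: gword_def)
    moreover obtain i where i: "i < m - k" "\<not> fst \<eta> i < m - k" using \<eta> by (auto simp: Hk_def)
    moreover have p: "fst \<eta> permutes {..<m}" using \<eta>(1) by auto
    ultimately have "yf ! (fst \<eta> i) \<in> range d" using ylen by (simp add: permute_list_nth)
    moreover have "fst \<eta> i < m" using permutes_in_image[OF p, of i] i(1) by simp
    then have "yf ! (fst \<eta> i) \<in> Q" using y i(2) by (simp add: generic_def)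
    ultimately show False using Q_disj by blast
  qed
  have gy: "ptw (gword yf yv x) = ppos (inv (fst x)) (inv (snd x)) (pt yf yv)" if x: "x \<in> Idx" for x
  proof -
    have p: "fst x permutes {..<m}" "snd x permutes {..<n}" using x by auto
    show ?thesis
      using ppos_pure[OF wordD(1)[OF yw] permutes_inv[OF p(1)] permutes_inv[OF p(2)]] p
      by (simp add: gword_def permutes_bij inv_inv_eq)
  qed
  have A: "acts u (gsum yf yv c) = (\<Sum>x\<in>Idx. fscale (c x) (ppos (inv (fst x)) (inv (snd x)) s))"
    unfolding gsum_def acts_simps[OF u]
  proof (rule sum.cong[OF refl])
    fix x assume x: "x \<in> Idx"
    then have p: "inv (fst x) permutes {..<m}" "inv (snd x) permutes {..<n}" by (auto intro: permutes_inv)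
    show "fscale (c x) (acts u (ptw (gword yf yv x))) = fscale (c x) (ppos (inv (fst x)) (inv (snd x)) s)"
      unfolding gy[OF x] acts_ppos[OF y1 u p] s_def ..
  qed
  have app: "(\<Sum>\<eta>\<in>Hk k. fscale (E \<eta>) (c \<circ> rho (pinv \<eta>))) x = (\<Sum>\<eta>\<in>Hk k. E \<eta> * c (rho (pinv \<eta>) x))" for x
    by (simp add: fun_sum_apply fscale_def)
  have cs: "c \<in> supported Idx" using c L by blast
  have "cy (acts u (gsum yf yv c)) = (\<Sum>\<eta>\<in>Hk k. fscale (E \<eta>) (c \<circ> rho (pinv \<eta>)))"
  proof
    fix x'
    show "cy (acts u (gsum yf yv c)) x' = (\<Sum>\<eta>\<in>Hk k. fscale (E \<eta>) (c \<circ> rho (pinv \<eta>))) x'"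
    proof (cases "x' \<in> Idx")
      case False
      then have "c (rho (pinv \<eta>) x') = 0" if "\<eta> \<in> Hk k" for \<eta>
        using rho_Idx_iff[OF pinv_Idx[OF Hk_Idx[OF that]], of x'] by (intro supportedD[OF cs]) simp
      then have "(\<Sum>\<eta>\<in>Hk k. E \<eta> * c (rho (pinv \<eta>) x')) = 0" by (intro sum.neutral) simp
      then show ?thesis using False unfolding app by (simp add: cy_def)
    next
      case True
      \<comment> \<open>A convolution on S_m x S_n. Summing over \<eta> in place of
        \<open>rho x' (pinv x)\<close> exhibits it as a combination of left translates of
        \<open>c\<close>.\<close>
      have "cy (acts u (gsum yf yv c)) x' = (\<Sum>x\<in>Idx. c x * E (rho x' (pinv x)))"
        unfolding A cy_def crd_simps using True crd_ppos[OF sM _ True] by (simp add: E_def)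
      also have "\<dots> = (\<Sum>\<eta>\<in>Idx. E \<eta> * c (rho (pinv \<eta>) x'))"
      proof (rule sum.reindex_bij_witness[of _ "\<lambda>\<eta>. rho (pinv \<eta>) x'" "\<lambda>x. rho x' (pinv x)"])
        have pr: "pinv (rho x x'') = rho (pinv x'') (pinv x)" if "x \<in> Idx" "x'' \<in> Idx" for x x''
          using that by (auto simp: pinv_def rho_def o_inv_distrib permutes_bij)
        fix x assume x: "x \<in> Idx"
        show "rho (pinv (rho x' (pinv x))) x' = x"
          by (simp only: pr[OF True pinv_Idx[OF x]] pinv_pinv[OF x] rho_rho[symmetric] rho_pinv[OF True] rho_id)
        show "rho x' (pinv x) \<in> Idx" by (rule rho_Idx[OF True pinv_Idx[OF x]])
        show "rho x' (pinv (rho (pinv x) x')) = x"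
          by (simp only: pr[OF pinv_Idx[OF x] True] pinv_pinv[OF x] rho_rho rho_pinv[OF True] rho_id)
        show "rho (pinv x) x' \<in> Idx" by (rule rho_Idx[OF pinv_Idx[OF x] True])
        show "E (rho x' (pinv x)) * c (rho (pinv (rho x' (pinv x))) x') = c x * E (rho x' (pinv x))"
          by (simp only: pr[OF True pinv_Idx[OF x]] pinv_pinv[OF x] rho_rho[symmetric] rho_pinv[OF True] rho_id mult.commute)
      qed
      also have "\<dots> = (\<Sum>\<eta>\<in>Hk k. E \<eta> * c (rho (pinv \<eta>) x'))"
        by (rule sum.mono_neutral_right[OF finite_Idx]) (auto simp: E0 dest: Hk_Idx)
      finally show ?thesis unfolding app .
    qed
  qed
  also have "\<dots> \<in> L"
    by (intro fn.subspace_sum[OF H.invariantD(1)[OF L(1)]] fn.subspace_scale[OF H.invariantD(1)[OF L(1)]]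
        H.invariantD(2)[OF L(1)] c imageI Hk_pinv)
  finally show ?thesis .
qed

text \<open>The largest submodule of \<open>W \<inter> Tlt (Suc k)\<close> on which
  \<open>cy\<close> takes values in \<open>L\<close>; quantifying over all monomials builds the
  stability in.\<close>

definition sub_of :: "'a mixed set \<Rightarrow> ((nat \<Rightarrow> nat) \<times> (nat \<Rightarrow> nat) \<Rightarrow> complex) set \<Rightarrow> 'a mixed set" where
  "sub_of W L = {x \<in> W \<inter> Tlt (Suc k). \<forall>u. set u \<subseteq> g \<longrightarrow> cy (acts u x) \<in> L}"

lemma gstable_Int: "gstable N \<Longrightarrow> gstable N' \<Longrightarrow> gstable (N \<inter> N')"
  by (auto simp: gstable_def intro: fn.subspace_inter)

lemma sub_of_gstable:
  assumes W: "gstable W" and L: "fn.subspace L"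
  shows "gstable (sub_of W L)"
proof -
  have g: "gstable (W \<inter> Tlt (Suc k))" by (intro gstable_Int W gstable_Tlt)
  note s = gstableD(1)[OF g]
  show ?thesis
    unfolding gstable_def
  proof (intro conjI ballI)
    show "fn.subspace (sub_of W L)"
    proof (rule fn.subspaceI)
      show "0 \<in> sub_of W L" using fn.subspace_0[OF s] fn.subspace_0[OF L] by (simp add: sub_of_def acts_simps cy_simps)
      show "x + y \<in> sub_of W L" if "x \<in> sub_of W L" "y \<in> sub_of W L" for x y
        using that fn.subspace_add[OF s, of x y] fn.subspace_add[OF L] unfolding sub_of_def by (auto simp: acts_simps cy_simps)
      show "fscale c x \<in> sub_of W L" if "x \<in> sub_of W L" for c x
        using that fn.subspace_scale[OF s, of x c] fn.subspace_scale[OF L] unfolding sub_of_def by (auto simp: acts_simps cy_simps)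
    qed
    fix a x assume a: "a \<in> g" and x: "x \<in> sub_of W L"
    have "cy (acts u (act a x)) \<in> L" if "set u \<subseteq> g" for u
    proof -
      have "\<forall>u. set u \<subseteq> g \<longrightarrow> cy (acts u x) \<in> L" using x by (simp add: sub_of_def)
      from this[rule_format, of "a # u"] show ?thesis using a that by simp
    qed
    then show "act a x \<in> sub_of W L" using gstableD(2)[OF g a] x by (simp add: sub_of_def)
  qed
qed

text \<open>By \<open>cy_acts\<close> the condition on \<open>c\<close> propagates to all monomials.
  Thus \<open>sub_of\<close> reaches all coefficients in \<open>L\<close> that \<open>W\<close>
  offers.\<close>

lemma sub_of_base:
  assumes L: "H.invariant L" "L \<subseteq> supported Idx" "c \<in> L"
    and x: "x \<in> W \<inter> Tlt (Suc k)" "x - gsum yf yv c \<in> Tlt k"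
  shows "x \<in> sub_of W L"
  unfolding sub_of_def
proof (intro CollectI conjI allI impI x(1))
  fix u assume u: "set u \<subseteq> g"
  have "cy (acts u (x - gsum yf yv c)) = 0" by (rule cy_Tlt[OF gstable_acts[OF gstable_Tlt u x(2)]])
  then have "cy (acts u x) = cy (acts u (gsum yf yv c))" by (simp add: acts_diff[OF u] cy_simps)
  then show "cy (acts u x) \<in> L" using cy_acts[OF L u] by simp
qed

text \<open>The symbols of an intermediate submodule form an invariant subspace of \<open>L\<close>,
  hence are zero or everything. By \<open>polarization\<close>, applied with \<open>Tlt k\<close>
  and with \<open>thick k N'\<close>, they determine the submodule.\<close>

lemma sub_of_minimal:
  assumes W: "gstable W" "W \<subseteq> Tl" and L: "H.minimal_invariant L" "L \<subseteq> symb (W \<inter> Tlt (Suc k))"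
  shows "minimal_over (W \<inter> Tlt k) (sub_of W L)"
proof -
  let ?F = "W \<inter> Tlt k" and ?N = "sub_of W L"
  have inv: "H.invariant L" using L(1) by (simp add: H.minimal_invariant_def)
  note sL = H.invariantD(1)[OF inv]
  have supp: "L \<subseteq> supported Idx" using L(2) by (auto simp: symb_def)
  have FN: "?F \<subseteq> ?N"
  proof
    fix x assume x: "x \<in> ?F"
    then have "cy (acts u x) \<in> L" if "set u \<subseteq> g" for u
      using cy_Tlt[OF gstable_acts[OF gstable_Tlt that]] fn.subspace_0[OF sL] by simp
    then show "x \<in> ?N" using x Tlt_mono[of k "Suc k"] by (auto simp: sub_of_def)
  qed
  have "L \<noteq> {0}" using L(1) by (simp add: H.minimal_invariant_def)
  then obtain c where c: "c \<in> L" "c \<noteq> 0" using fn.subspace_0[OF sL] by auto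
  then obtain x where x: "x \<in> W \<inter> Tlt (Suc k)" "x - gsum yf yv c \<in> Tlt k" using L(2) by (auto simp: symb_def)
  have "x \<in> ?N" by (rule sub_of_base[OF inv supp c(1) x])
  moreover have "x \<notin> Tlt k" using cy_eq[OF x(2)] c supp cy_Tlt[of x] by auto
  ultimately have ne: "?F \<noteq> ?N" by blast
  have "N' = ?F \<or> N' = ?N" if N': "gstable N'" "?F \<subseteq> N'" "N' \<subseteq> ?N" for N'
  proof (rule disjCI)
    assume neq: "N' \<noteq> ?N"
    show "N' = ?F"
    proof (rule ccontr)
      assume "N' \<noteq> ?F"
      then obtain t where t: "t \<in> N'" "t \<notin> ?F" using N'(2) by blast
      then have tW: "t \<in> W" "t \<in> Tlt (Suc k)" "t \<notin> Tlt k" using N'(3) by (auto simp: sub_of_def)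
      have "symb N' \<subseteq> L"
      proof
        fix c assume "c \<in> symb N'"
        then obtain x where x: "x \<in> N'" "x - gsum yf yv c \<in> Tlt k" "c \<in> supported Idx" by (auto simp: symb_def)
        then have "\<forall>u. set u \<subseteq> g \<longrightarrow> cy (acts u x) \<in> L" using N'(3) by (auto simp: sub_of_def)
        from this[rule_format, of "[]"] have "cy x \<in> L" by simp
        then show "c \<in> L" using cy_eq[OF x(2,3)] by simp
      qed
      \<comment> \<open>Otherwise every polarized image of \<open>t\<close> would lie in
        \<open>Tlt k\<close>, and so would \<open>t\<close>.\<close>
      moreover have "symb N' \<noteq> {0}"
      proof
        assume s0: "symb N' = {0}"
        have "t \<in> Tlt k"
        proof (rule polarization[OF k_le y _ tW(2) gstable_Tlt order_refl])
          show "t \<in> Tl" using tW(1) W(2) by blast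
          fix u c assume u: "set u \<subseteq> g" "acts u t - gsum yf yv c \<in> Tlt k"
          have "acts u t \<in> N'" by (rule gstable_acts[OF N'(1) u(1) t(1)])
          then have "cy (acts u t) \<in> symb N'" using gsum_cy[OF u(2)] cy_supported by (auto simp: symb_def)
          then have "cy (acts u t) = 0" using s0 by simp
          moreover have "gsum yf yv 0 = 0" by (simp add: gsum_def)
          ultimately show "acts u t \<in> Tlt k" using gsum_cy[OF u(2)] by simp
        qed
        then show False using tW(3) by simp
      qed
      ultimately have sN: "symb N' = L"
        using L(1) symb_invariant[OF N'(1)] unfolding H.minimal_invariant_def by blast
      have "?N \<subseteq> N'"
      proof
        fix x assume x: "x \<in> ?N"
        then have xW: "x \<in> W" "x \<in> Tlt (Suc k)" by (auto simp: sub_of_def)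
        have "x \<in> thick k N'"
        proof (rule polarization[OF k_le y _ xW(2) gstable_thick[OF N'(1)] Tlt_sub_thick[OF N'(1)]])
          show "x \<in> Tl" using xW(1) W(2) by blast
          fix u c assume u: "set u \<subseteq> g" "acts u x - gsum yf yv c \<in> Tlt k"
          have "cy (acts u x) \<in> symb N'" unfolding sN using x u(1) by (simp add: sub_of_def)
          then have "gsum yf yv (cy (acts u x)) \<in> thick k N'" using symb_thick[OF N'(1) cy_supported] by simp
          moreover have "acts u x - gsum yf yv (cy (acts u x)) \<in> thick k N'"
            using gsum_cy[OF u(2)] Tlt_sub_thick[OF N'(1)] by blast
          ultimately show "acts u x \<in> thick k N'"
            using fn.subspace_add[OF gstableD(1)[OF gstable_thick[OF N'(1), of k]]] by fastforce
        qed
        then obtain x' where x': "x' \<in> N'" "x - x' \<in> Tlt k" by (rule thickE)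
        then have "x' \<in> W" using N'(3) by (auto simp: sub_of_def)
        \<comment> \<open>The error in \<open>Tlt k\<close> is a difference of elements of
          \<open>W\<close>, and \<open>N'\<close> contains \<open>W \<inter> Tlt k\<close>.\<close>
        then have "x - x' \<in> ?F" using x' xW fn.subspace_diff[OF gstableD(1)[OF W(1)]] by blast
        then have "(x - x') + x' \<in> N'" using N'(2) x'(1) by (intro fn.subspace_add[OF gstableD(1)[OF N'(1)]]) auto
        then show "x \<in> N'" by simp
      qed
      then show False using neq N'(3) by blast
    qed
  qed
  then show ?thesis
    unfolding minimal_over_def using sub_of_gstable[OF W(1) sL] FN ne by blast
qed

text \<open>By Maschke the symbols of the layer are spanned by minimal invariant subspaces
  \<open>L'\<close>, and \<open>S\<close> contains each \<open>sub_of W L'\<close>. So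
  \<open>S\<close> realizes all symbols modulo \<open>Tlt k\<close>, and \<open>polarization\<close>
  lifts this to the layer.\<close>

lemma layer_semisimple:
  assumes W: "gstable W" "W \<subseteq> Tl" and S: "gstable S" "S \<subseteq> W" "W \<inter> Tlt k \<subseteq> S"
    and min: "\<And>N. minimal_over (W \<inter> Tlt k) N \<Longrightarrow> N \<subseteq> W \<Longrightarrow> N \<subseteq> S"
  shows "W \<inter> Tlt (Suc k) \<subseteq> S"
proof
  fix t assume t: "t \<in> W \<inter> Tlt (Suc k)"
  have gW: "gstable (W \<inter> Tlt (Suc k))" by (intro gstable_Int W gstable_Tlt)
  note sT = gstableD(1)[OF gstable_thick[OF S(1), of k]]
  have gs: "gsum yf yv c \<in> thick k S" if c: "c \<in> symb (W \<inter> Tlt (Suc k))" for c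
  proof -
    have "c \<in> fn.span (\<Union>{L'. H.minimal_invariant L' \<and> L' \<subseteq> symb (W \<inter> Tlt (Suc k))})"
      using H.span_minimal_invariant[OF symb_invariant[OF gW]] c by (auto simp: symb_def)
    then show ?thesis
    proof (induction rule: fn.span_induct_alt)
      case base
      have z0: "gsum yf yv 0 = 0" by (simp add: gsum_def)
      show ?case unfolding z0 by (rule fn.subspace_0[OF sT])
    next
      case (step a x z)
      then obtain L' where L': "H.minimal_invariant L'" "L' \<subseteq> symb (W \<inter> Tlt (Suc k))" "x \<in> L'" by blast
      have inv: "H.invariant L'" "L' \<subseteq> supported Idx"
        using L' by (auto simp: H.minimal_invariant_def symb_def)
      obtain x' where x': "x' \<in> W \<inter> Tlt (Suc k)" "x' - gsum yf yv x \<in> Tlt k" using L'(2,3) by (auto simp: symb_def)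
      have "x' \<in> sub_of W L'" by (rule sub_of_base[OF inv L'(3) x'])
      moreover have "sub_of W L' \<subseteq> S"
        by (rule min[OF sub_of_minimal[OF W L'(1,2)]]) (auto simp: sub_of_def)
      ultimately have "x \<in> symb S" using x'(2) inv(2) L'(3) by (auto simp: symb_def)
      then have "gsum yf yv x \<in> thick k S" using symb_thick[OF S(1)] inv(2) L'(3) by blast
      then show ?case
        unfolding gsum_add gsum_scale by (intro fn.subspace_add[OF sT] fn.subspace_scale[OF sT] step(2))
    qed
  qed
  have "t \<in> thick k S"
  proof (rule polarization[OF k_le y _ _ gstable_thick[OF S(1)] Tlt_sub_thick[OF S(1)]])
    show "t \<in> Tl" "t \<in> Tlt (Suc k)" using t W(2) by auto
    fix u c assume u: "set u \<subseteq> g" "acts u t - gsum yf yv c \<in> Tlt k"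
    have "acts u t \<in> W \<inter> Tlt (Suc k)" by (rule gstable_acts[OF gW u(1) t])
    then have "cy (acts u t) \<in> symb (W \<inter> Tlt (Suc k))"
      using gsum_cy[OF u(2)] cy_supported by (auto simp: symb_def)
    then have "gsum yf yv (cy (acts u t)) \<in> thick k S" by (rule gs)
    moreover have "acts u t - gsum yf yv (cy (acts u t)) \<in> thick k S"
      using gsum_cy[OF u(2)] Tlt_sub_thick[OF S(1)] by blast
    ultimately show "acts u t \<in> thick k S" using fn.subspace_add[OF sT] by fastforce
  qed
  then obtain x where x: "x \<in> S" "t - x \<in> Tlt k" by (rule thickE)
  then have "t - x \<in> W \<inter> Tlt k" using t S(2) fn.subspace_diff[OF gstableD(1)[OF W(1)]] by blast
  then have "(t - x) + x \<in> S" using S(3) x(1) by (intro fn.subspace_add[OF gstableD(1)[OF S(1)]]) auto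
  then show "t \<in> S" by simp
qed

end

section \<open>Schur functors and the socle filtration\<close>

lemma outer_zero: "outer 0 t = 0" "outer s 0 = 0"
  by (auto simp: outer_def)

lemma outer_sum_left: "outer (\<Sum>a\<in>A. h a) t = (\<Sum>a\<in>A. outer (h a) t)"
  by (induction A rule: infinite_finite_induct)
    (simp_all only: outer_zero outer_add sum.infinite sum.empty sum.insert not_False_eq_True)

lemma outer_sum_right: "outer s (\<Sum>a\<in>A. h a) = (\<Sum>a\<in>A. outer s (h a))"
  by (induction A rule: infinite_finite_induct)
    (simp_all only: outer_zero outer_add sum.infinite sum.empty sum.insert not_False_eq_True)

context mackey_tensors
begin

lemma ppos_outer: "ppos \<sigma> \<tau> (outer s t) = outer (permute_tensor \<sigma> s) (permute_tensor \<tau> t)"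
  by (auto simp: ppos_def outer_def permute_tensor_def)

lemma ppos_Mix:
  assumes t: "t \<in> Mix" and p: "\<sigma> permutes {..<m}" "\<tau> permutes {..<n}"
  shows "ppos \<sigma> \<tau> t \<in> Mix"
  using t[unfolded Mix_eq]
proof (induction rule: fn.span_induct_alt)
  case base
  show ?case unfolding ppos_simps Mix_eq by (rule fn.span_zero)
next
  case (step c x y)
  then obtain fs vs where x: "x = pt fs vs" "lists_of fs vs" by blast
  have "ppos \<sigma> \<tau> x \<in> Mix"
    unfolding x(1) ppos_pure[OF x(2) p] Mix_eq
    using lists_of_permute[OF x(2) permutes_inv[OF p(1)] permutes_inv[OF p(2)]] by (intro fn.span_base) blast
  then show ?case using step(2) unfolding ppos_simps Mix_eq by (intro fn.span_add fn.span_scale)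
qed

text \<open>The tensor product of the two Young symmetrizers, written through \<open>ppos\<close> so
  that \<open>act_ppos\<close> makes it commute with the action.\<close>

definition young2 where
  "young2 lam S mu T x = (\<Sum>\<sigma>\<in>row_group lam S. \<Sum>\<tau>\<in>column_group lam S.
     \<Sum>\<sigma>'\<in>row_group mu T. \<Sum>\<tau>'\<in>column_group mu T.
       fscale (of_int (sign \<tau>) * of_int (sign \<tau>')) (ppos \<sigma> \<sigma>' (ppos \<tau> \<tau>' x)))"

lemma young2_outer:
  "young2 lam S mu T (outer s t) = outer (young_symmetrizer lam S s) (young_symmetrizer mu T t)"
  unfolding young2_def young_symmetrizer_def ppos_outer outer_sum_left outer_scale(1)
  unfolding outer_sum_right outer_scale(2) fn.scale_sum_right fn.scale_scale ..

lemma young2_simps: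
  "young2 lam S mu T (x + y) = young2 lam S mu T x + young2 lam S mu T y"
  "young2 lam S mu T (fscale c x) = fscale c (young2 lam S mu T x)"
  "young2 lam S mu T 0 = 0"
  unfolding young2_def ppos_simps fn.scale_right_distrib sum.distrib fn.scale_sum_right fn.scale_scale
  by (simp_all add: mult.commute mult.left_commute)

lemma young2_act:
  assumes m: "m = sum_list lam" "n = sum_list mu" and a: "a \<in> g" and x: "x \<in> Mix"
  shows "act a (young2 lam S mu T x) = young2 lam S mu T (act a x)"
  unfolding young2_def act_simps[OF a]
proof (intro sum.cong refl)
  fix \<sigma> \<tau> \<sigma>' \<tau>'
  assume "\<sigma> \<in> row_group lam S" "\<tau> \<in> column_group lam S" "\<sigma>' \<in> row_group mu T" "\<tau>' \<in> column_group mu T"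
  then have p: "\<sigma> permutes {..<m}" "\<tau> permutes {..<m}" "\<sigma>' permutes {..<n}" "\<tau>' permutes {..<n}"
    by (simp_all add: row_group_def column_group_def m)
  show "fscale (of_int (sign \<tau>) * of_int (sign \<tau>')) (act a (ppos \<sigma> \<sigma>' (ppos \<tau> \<tau>' x))) =
      fscale (of_int (sign \<tau>) * of_int (sign \<tau>')) (ppos \<sigma> \<sigma>' (ppos \<tau> \<tau>' (act a x)))"
    unfolding act_ppos[OF ppos_Mix[OF x p(2,4)] a p(1,3)] act_ppos[OF x a p(2,4)] ..
qed

lemma outer_Mix:
  assumes s: "s \<in> tensor_power ev_covector UNIV D m" and t: "t \<in> tensor_power ev_vector D UNIV n"
  shows "outer s t \<in> Mix"
  using s[unfolded tensor_power_def]
proof (induction rule: fn.span_induct_alt)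
  case base
  show ?case unfolding outer_zero Mix_eq by (rule fn.span_zero)
next
  case (step c x y)
  then obtain fs where fs: "x = decomposable ev_covector UNIV fs" "length fs = m" "set fs \<subseteq> D" by blast
  have "outer x t \<in> Mix"
    using t[unfolded tensor_power_def]
  proof (induction rule: fn.span_induct_alt)
    case base
    show ?case unfolding outer_zero Mix_eq by (rule fn.span_zero)
  next
    case (step c x' y')
    then obtain vs where vs: "x' = decomposable ev_vector D vs" "length vs = n" by blast
    have "outer x x' = pt fs vs" by (simp add: pure_tensor_def fs(1) vs(1))
    moreover have "lists_of fs vs" using fs vs by (simp add: lists_of_def)
    ultimately have "outer x x' \<in> Mix" unfolding Mix_eq by (intro fn.span_base) blast
    then show ?case using step(2) unfolding outer_add outer_scale Mix_eq by (intro fn.span_add fn.span_scale)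
  qed
  then show ?case using step(2) unfolding outer_add outer_scale Mix_eq by (intro fn.span_add fn.span_scale)
qed

text \<open>Every generator is \<open>young2\<close> of a mixed tensor. As \<open>young2\<close>
  commutes with the action and maps \<open>Mix\<close> into the span of the generators, this span is
  stable.\<close>

lemma gstable_W_space:
  assumes m: "m = sum_list lam" "n = sum_list mu"
  shows "gstable (W_space sV lam S mu T)"
proof -
  let ?G = "{outer s t | s t. s \<in> schur lam S ev_covector UNIV D \<and> t \<in> schur mu T ev_vector D UNIV}"
  have YG: "young2 lam S mu T x \<in> fn.span ?G" if "x \<in> Mix" for x
    using that[unfolded Mix_eq]
  proof (induction rule: fn.span_induct_alt)
    case base
    show ?case unfolding young2_simps by (rule fn.span_zero)
  next
    case (step c x z)
    then obtain fs vs where x: "x = pt fs vs" "lists_of fs vs" by blast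
    have "decomposable ev_covector UNIV fs \<in> tensor_power ev_covector UNIV D m"
      "decomposable ev_vector D vs \<in> tensor_power ev_vector D UNIV n"
      using x(2) by (auto simp: tensor_power_def lists_of_def intro!: fn.span_base)
    then have "young2 lam S mu T x \<in> ?G"
      unfolding x(1) pure_tensor_def young2_outer schur_def m by blast
    then show ?case unfolding young2_simps by (intro fn.span_add fn.span_scale fn.span_base step(2))
  qed
  have "act a x \<in> fn.span ?G" if a: "a \<in> g" and "x \<in> fn.span ?G" for a x
    using that(2)
  proof (induction rule: fn.span_induct_alt)
    case base
    show ?case unfolding act_simps[OF a] by (rule fn.span_zero)
  next
    case (step c x z)
    then obtain s t where st: "s \<in> tensor_power ev_covector UNIV D m" "t \<in> tensor_power ev_vector D UNIV n"
      "x = outer (young_symmetrizer lam S s) (young_symmetrizer mu T t)"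
      unfolding schur_def m by blast
    note M = outer_Mix[OF st(1,2)]
    have "act a x = young2 lam S mu T (act a (outer s t))"
      unfolding st(3) young2_outer[symmetric] by (rule young2_act[OF m a M])
    then have "act a x \<in> fn.span ?G" using YG[OF Mix_act[OF a M]] by simp
    then show ?case unfolding act_simps[OF a] by (intro fn.span_add fn.span_scale step(2))
  qed
  then have "gstable (fn.span ?G)" unfolding gstable_def by (intro conjI ballI fn.subspace_span)
  moreover have "gstable (traceless sV (sum_list lam) (sum_list mu))" using gstable_Tl unfolding m .
  ultimately show ?thesis
    unfolding W_space_def by (auto simp: gstable_def intro: fn.subspace_inter)
qed

text \<open>A binary word only permits factors to leave \<open>Vs\<close> at its ones; for the
  converse it is chosen to record where they do. The bound \<open>k\<close> on the word is the
  strict bound \<open>Suc k\<close> on \<open>nq\<close>.\<close>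

lemma word_tensors_span:
  "fn.span (\<Union>r \<in> {r. length r = m \<and> set r \<subseteq> {0, 1} \<and> sum_list r \<le> k}. word_tensors sV Vs r n) = Tlt (Suc k)"
  (is "fn.span ?U = _")
proof
  show "fn.span ?U \<subseteq> Tlt (Suc k)"
  proof (rule fn.span_minimal[OF _ subspace_Tlt], rule UN_least)
    fix r assume r: "r \<in> {r. length r = m \<and> set r \<subseteq> {0, 1} \<and> sum_list r \<le> k}"
    show "word_tensors sV Vs r n \<subseteq> Tlt (Suc k)"
      unfolding word_tensors_def
    proof (rule fn.span_minimal[OF _ subspace_Tlt], rule subsetI)
      fix t assume "t \<in> {pt fs vs |fs vs. length fs = length r \<and>
        (\<forall>i<length r. fs ! i \<in> (if r ! i = 0 then Vs else D)) \<and> length vs = n}"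
      then obtain fs vs where t: "t = pt fs vs" and fs: "length fs = length r"
        "\<And>i. i < length r \<Longrightarrow> fs ! i \<in> (if r ! i = 0 then Vs else D)" "length vs = n" by blast
      have "fs ! i \<in> D" if "i < length fs" for i
        using fs(2)[of i] that fs(1) Vs_sub by (auto split: if_splits)
      then have "set fs \<subseteq> D" by (auto simp: in_set_conv_nth)
      then have l: "lists_of fs vs" using fs r by (simp add: lists_of_def)
      have "nq fs \<le> card {i \<in> {..<length r}. r ! i \<noteq> 0}"
        unfolding nq_def
      proof (rule card_mono)
        show "{i. i < length fs \<and> fs ! i \<notin> Vs} \<subseteq> {i \<in> {..<length r}. r ! i \<noteq> 0}"
        proof
          fix i assume i: "i \<in> {i. i < length fs \<and> fs ! i \<notin> Vs}"
          then have "r ! i \<noteq> 0" using fs(2)[of i] fs(1) by (auto simp: split: if_splits)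
          then show "i \<in> {i \<in> {..<length r}. r ! i \<noteq> 0}" using i fs(1) by simp
        qed
      qed simp
      also have "\<dots> = (\<Sum>i<length r. if r ! i \<noteq> 0 then 1 else 0)" by (simp add: sum.If_cases Int_def)
      also have "\<dots> \<le> (\<Sum>i<length r. r ! i)" by (rule sum_mono) auto
      also have "\<dots> = sum_list r" by (simp add: sum_list_sum_nth atLeast0LessThan)
      finally have "nq fs < Suc k" using r by simp
      then show "t \<in> Tlt (Suc k)" unfolding t by (rule Tlt_base[OF l])
    qed
  qed
  show "Tlt (Suc k) \<subseteq> fn.span ?U"
    unfolding Tlt_def
  proof (rule fn.span_mono, rule subsetI)
    fix t assume "t \<in> {pt fs vs |fs vs. lists_of fs vs \<and> nq fs < Suc k}"
    then obtain fs vs where t: "t = pt fs vs" and l: "lists_of fs vs" "nq fs < Suc k" by blast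
    define r :: "nat list" where "r = map (\<lambda>f. if f \<in> Vs then 0 else 1) fs"
    have "sum_list r = (\<Sum>i<length fs. r ! i)" by (simp add: sum_list_sum_nth atLeast0LessThan r_def)
    also have "\<dots> = (\<Sum>i<length fs. if fs ! i \<notin> Vs then 1 else 0)" by (rule sum.cong) (auto simp: r_def)
    also have "\<dots> = nq fs" by (simp add: nq_def sum.If_cases Int_def)
    finally have "sum_list r \<le> k" using l(2) by simp
    then have "r \<in> {r. length r = m \<and> set r \<subseteq> {0, 1} \<and> sum_list r \<le> k}"
      using l(1) by (auto simp: r_def lists_of_def)
    moreover have "t \<in> word_tensors sV Vs r n"
      unfolding word_tensors_def t
    proof (rule fn.span_base, intro CollectI exI conjI allI impI refl)
      fix i assume "i < length r"
      then show "fs ! i \<in> (if r ! i = 0 then Vs else D)"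
        using lists_of_nth[OF l(1), of i] l(1) by (auto simp: r_def lists_of_def)
    qed (use l(1) in \<open>auto simp: r_def lists_of_def\<close>)
    ultimately show "t \<in> ?U" by blast
  qed
qed

section \<open>Socles of quotients in terms of stable subspaces\<close>

lemma mixed_module_simps [simp]:
  "lm_carrier (mixed_module sV m n W) = W" "lm_zero (mixed_module sV m n W) = 0"
  "lm_add (mixed_module sV m n W) = (+)" "lm_scale (mixed_module sV m n W) = fscale"
  "lm_act (mixed_module sV m n W) = act"
  by (simp_all add: mixed_module_def)

lemma submodule_iff: "lm_submodule g (mixed_module sV m n W) N \<longleftrightarrow> N \<subseteq> W \<and> gstable N"
  unfolding lm_submodule_def gstable_def fn.subspace_def by auto

lemma simple_iff: "simple_submodule g (mixed_module sV m n W) N \<longleftrightarrow> N \<subseteq> W \<and> minimal_over {0} N"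
proof -
  have "0 \<in> N'" if "gstable N'" for N' by (rule fn.subspace_0[OF gstableD(1)[OF that]])
  then have "{0} \<subset> N \<longleftrightarrow> N \<noteq> {0}" "{0} \<subseteq> N" if "gstable N" for N using that by blast+
  then show ?thesis unfolding simple_submodule_def submodule_iff minimal_over_def mixed_module_simps
    by (meson subset_trans)
qed

context
  fixes W F :: "'a mixed set"
  assumes W: "gstable W" and F: "gstable F" "F \<subseteq> W"
begin

abbreviation (input) "Mod \<equiv> mixed_module sV m n W"
abbreviation (input) "Quo \<equiv> lm_quotient Mod F"
abbreviation (input) "cs x \<equiv> lm_coset Mod F x"

lemma coset_iff: "y \<in> lm_coset (mixed_module sV m n W) F x \<longleftrightarrow> y - x \<in> F"
proof
  show "y \<in> lm_coset (mixed_module sV m n W) F x \<Longrightarrow> y - x \<in> F" by (auto simp: lm_coset_def)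
  assume "y - x \<in> F"
  then have "x + (y - x) \<in> (+) x ` F" by (rule imageI)
  then show "y \<in> lm_coset (mixed_module sV m n W) F x" by (simp add: lm_coset_def)
qed

lemma coset_eq_iff:
  "lm_coset (mixed_module sV m n W) F x = lm_coset (mixed_module sV m n W) F y \<longleftrightarrow> x - y \<in> F"
proof
  note sF = gstableD(1)[OF F(1)]
  assume "lm_coset (mixed_module sV m n W) F x = lm_coset (mixed_module sV m n W) F y"
  moreover have "x \<in> lm_coset (mixed_module sV m n W) F x" unfolding coset_iff using fn.subspace_0[OF sF] by simp
  ultimately have "x \<in> lm_coset (mixed_module sV m n W) F y" by simp
  then show "x - y \<in> F" by (simp only: coset_iff)
next
  note sF = gstableD(1)[OF F(1)]
  assume xy: "x - y \<in> F"
  have "z - x \<in> F \<longleftrightarrow> z - y \<in> F" for z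
  proof
    assume "z - x \<in> F"
    then have "(z - x) + (x - y) \<in> F" using xy by (intro fn.subspace_add[OF sF])
    then show "z - y \<in> F" by simp
  next
    assume "z - y \<in> F"
    then have "(z - y) - (x - y) \<in> F" using xy by (rule fn.subspace_diff[OF sF])
    then show "z - x \<in> F" by simp
  qed
  then show "lm_coset (mixed_module sV m n W) F x = lm_coset (mixed_module sV m n W) F y"
    unfolding set_eq_iff coset_iff by simp
qed

lemma coset_self: "x \<in> lm_coset (mixed_module sV m n W) F x"
  unfolding coset_iff using fn.subspace_0[OF gstableD(1)[OF F(1)]] by simp

text \<open>The operations of \<open>lm_quotient\<close> are unions over all representatives;
  well-definedness makes these families constant.\<close>

lemma UN_const: "(\<And>x. x \<in> A \<Longrightarrow> h x = Z) \<Longrightarrow> a \<in> A \<Longrightarrow> (\<Union>x\<in>A. h x) = Z"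
  by auto

lemma quotient_simps:
  "lm_carrier Quo = cs ` W" "lm_zero Quo = cs 0" "lm_add Quo (cs x) (cs y) = cs (x + y)"
  "lm_scale Quo c (cs x) = cs (fscale c x)" "a \<in> g \<Longrightarrow> lm_act Quo a (cs x) = cs (act a x)"
proof -
  note sF = gstableD(1)[OF F(1)]
  show "lm_carrier Quo = cs ` W" "lm_zero Quo = cs 0" by (simp_all add: lm_quotient_def)
  have "(\<Union>x'\<in>cs x. \<Union>y'\<in>cs y. cs (x' + y')) = cs (x + y)"
  proof (rule UN_const[OF UN_const[OF _ coset_self] coset_self])
    fix x' y' assume "x' \<in> cs x" "y' \<in> cs y"
    then have "(x' - x) + (y' - y) \<in> F" unfolding coset_iff by (intro fn.subspace_add[OF sF])
    moreover have "(x' - x) + (y' - y) = (x' + y') - (x + y)" by simp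
    ultimately show "cs (x' + y') = cs (x + y)" by (simp only: coset_eq_iff)
  qed
  then show "lm_add Quo (cs x) (cs y) = cs (x + y)" by (simp add: lm_quotient_def)
  have "(\<Union>x'\<in>cs x. cs (fscale c x')) = cs (fscale c x)"
  proof (rule UN_const[OF _ coset_self])
    fix x' assume "x' \<in> cs x"
    then have "fscale c (x' - x) \<in> F" unfolding coset_iff by (intro fn.subspace_scale[OF sF])
    then show "cs (fscale c x') = cs (fscale c x)" by (simp only: coset_eq_iff fn.scale_right_diff_distrib)
  qed
  then show "lm_scale Quo c (cs x) = cs (fscale c x)" by (simp add: lm_quotient_def)
  have "(\<Union>x'\<in>cs x. cs (act a x')) = cs (act a x)" if a: "a \<in> g"
  proof (rule UN_const[OF _ coset_self])
    fix x' assume "x' \<in> cs x"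
    then have "act a (x' - x) \<in> F" unfolding coset_iff by (intro gstableD(2)[OF F(1) a])
    then show "cs (act a x') = cs (act a x)" by (simp only: coset_eq_iff act_simps[OF a])
  qed
  then show "a \<in> g \<Longrightarrow> lm_act Quo a (cs x) = cs (act a x)" by (simp add: lm_quotient_def)
qed

definition "preimage N = {x \<in> W. lm_coset (mixed_module sV m n W) F x \<in> N}"

lemma coset_image_mem:
  assumes "gstable N" "F \<subseteq> N"
  shows "cs x \<in> cs ` N \<longleftrightarrow> x \<in> N"
proof
  assume "cs x \<in> cs ` N"
  then obtain x' where x': "x' \<in> N" "x - x' \<in> F" by (auto simp: coset_eq_iff)
  then have "(x - x') + x' \<in> N" using assms by (intro fn.subspace_add[OF gstableD(1)]) auto
  then show "x \<in> N" by simp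
qed simp

lemma submodule_image:
  assumes N: "gstable N" "N \<subseteq> W"
  shows "lm_submodule g Quo (cs ` N)"
proof -
  note sN = gstableD(1)[OF N(1)]
  show ?thesis
    unfolding lm_submodule_def
  proof (intro conjI ballI allI)
    show "cs ` N \<subseteq> lm_carrier Quo" unfolding quotient_simps using N(2) by blast
    show "lm_zero Quo \<in> cs ` N" unfolding quotient_simps by (intro imageI fn.subspace_0[OF sN])
    show "lm_add Quo x z \<in> cs ` N" if "x \<in> cs ` N" "z \<in> cs ` N" for x z
      using that by (auto simp only: quotient_simps intro!: imageI fn.subspace_add[OF sN])
    show "lm_scale Quo c x \<in> cs ` N" if "x \<in> cs ` N" for c x
      using that by (auto simp only: quotient_simps intro!: imageI fn.subspace_scale[OF sN])
    show "lm_act Quo a x \<in> cs ` N" if "a \<in> g" "x \<in> cs ` N" for a x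
      using that by (auto simp only: quotient_simps intro!: imageI gstableD(2)[OF N(1)])
  qed
qed

lemma submodule_preimage:
  assumes N: "lm_submodule g Quo N"
  shows "gstable (preimage N)" "F \<subseteq> preimage N" "preimage N \<subseteq> W" "cs ` preimage N = N"
proof -
  note sW = gstableD(1)[OF W]
  have N0: "cs 0 \<in> N" and Nadd: "\<And>x z. cs x \<in> N \<Longrightarrow> cs z \<in> N \<Longrightarrow> cs (x + z) \<in> N"
    and Nsc: "\<And>c x. cs x \<in> N \<Longrightarrow> cs (fscale c x) \<in> N"
    and Nact: "\<And>a x. a \<in> g \<Longrightarrow> cs x \<in> N \<Longrightarrow> cs (act a x) \<in> N" and Nsub: "N \<subseteq> cs ` W"
    using N unfolding lm_submodule_def by (metis quotient_simps)+
  show "gstable (preimage N)"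
    unfolding gstable_def
  proof (intro conjI ballI fn.subspaceI)
    show "0 \<in> preimage N" using N0 fn.subspace_0[OF sW] by (simp add: preimage_def)
    show "x + z \<in> preimage N" if "x \<in> preimage N" "z \<in> preimage N" for x z
      using that Nadd fn.subspace_add[OF sW] by (simp add: preimage_def)
    show "fscale c x \<in> preimage N" if "x \<in> preimage N" for c x
      using that Nsc fn.subspace_scale[OF sW] by (simp add: preimage_def)
    show "act a x \<in> preimage N" if "a \<in> g" "x \<in> preimage N" for a x
      using that Nact gstableD(2)[OF W] by (simp add: preimage_def)
  qed
  show "F \<subseteq> preimage N"
  proof
    fix x assume x: "x \<in> F"
    then have "cs x = cs 0" by (simp add: coset_eq_iff)
    then show "x \<in> preimage N" using x F(2) N0 by (auto simp: preimage_def)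
  qed
  show "preimage N \<subseteq> W" by (auto simp: preimage_def)
  show "cs ` preimage N = N" using Nsub by (auto simp: preimage_def)
qed

lemma preimage_image: "gstable N \<Longrightarrow> F \<subseteq> N \<Longrightarrow> N \<subseteq> W \<Longrightarrow> preimage (cs ` N) = N"
  unfolding preimage_def using coset_image_mem by blast

lemma image_F: "cs ` F = {cs 0}"
proof -
  have "cs x = cs 0" if "x \<in> F" for x using that by (simp add: coset_eq_iff)
  moreover have "0 \<in> F" by (rule fn.subspace_0[OF gstableD(1)[OF F(1)]])
  ultimately show ?thesis by blast
qed

lemma simple_image:
  assumes N: "minimal_over F N" "N \<subseteq> W"
  shows "simple_submodule g Quo (cs ` N)"
proof -
  have gN: "gstable N" "F \<subseteq> N" "F \<noteq> N"
    and min: "\<And>N'. gstable N' \<Longrightarrow> F \<subseteq> N' \<Longrightarrow> N' \<subseteq> N \<Longrightarrow> N' = F \<or> N' = N"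
    using N(1) by (auto simp: minimal_over_def)
  show ?thesis
    unfolding simple_submodule_def quotient_simps
  proof (intro conjI allI impI)
    show "lm_submodule g Quo (cs ` N)" by (rule submodule_image[OF gN(1) N(2)])
    show "cs ` N \<noteq> {cs 0}"
    proof
      assume "cs ` N = {cs 0}"
      then have "preimage (cs ` N) = preimage (cs ` F)" by (simp only: image_F)
      then show False using gN preimage_image[OF gN(1,2) N(2)] preimage_image[OF F(1) order_refl F(2)] by simp
    qed
    fix N' assume N': "lm_submodule g Quo N' \<and> N' \<subseteq> cs ` N"
    then have "preimage N' \<subseteq> preimage (cs ` N)" by (auto simp: preimage_def)
    then have "preimage N' \<subseteq> N" by (simp only: preimage_image[OF gN(1,2) N(2)])
    have "lm_submodule g Quo N'" using N' by simp
    note P = submodule_preimage[OF this]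
    have "preimage N' = F \<or> preimage N' = N" by (rule min[OF P(1,2) \<open>preimage N' \<subseteq> N\<close>])
    then have "cs ` preimage N' = cs ` F \<or> cs ` preimage N' = cs ` N" by auto
    then show "N' = {cs 0} \<or> N' = cs ` N" unfolding P(4) image_F .
  qed
qed

lemma simple_preimage:
  assumes N: "simple_submodule g Quo N"
  shows "minimal_over F (preimage N)"
proof -
  have sub: "lm_submodule g Quo N" and ne: "N \<noteq> {cs 0}"
    and min: "\<And>N'. lm_submodule g Quo N' \<Longrightarrow> N' \<subseteq> N \<Longrightarrow> N' = {cs 0} \<or> N' = N"
    using N unfolding simple_submodule_def quotient_simps by blast+
  note P = submodule_preimage[OF sub]
  show ?thesis
    unfolding minimal_over_def
  proof (intro conjI allI impI)
    show "gstable (preimage N)" by (rule P)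
    have "F \<noteq> preimage N" using ne P(4) image_F by auto
    then show "F \<subset> preimage N" using P(2) by blast
    fix N' assume N': "gstable N' \<and> F \<subseteq> N' \<and> N' \<subseteq> preimage N"
    then have NW: "N' \<subseteq> W" using P(3) by blast
    have "cs ` N' \<subseteq> N" using N' P(4) by blast
    then have "cs ` N' = cs ` F \<or> cs ` N' = N"
      unfolding image_F using min submodule_image[OF conjunct1[OF N'] NW] by simp
    then have "preimage (cs ` N') = preimage (cs ` F) \<or> preimage (cs ` N') = preimage N" by auto
    moreover have "preimage (cs ` N') = N'" using preimage_image N' NW by simp
    ultimately show "N' = F \<or> N' = preimage N"
      by (simp only: preimage_image[OF F(1) order_refl F(2)])
  qed
qed

text \<open>Taking preimages turns simple submodules into submodules minimal over \<open>F\<close>.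
  The socle is an intersection: by \<open>B\<close> the image of \<open>F'\<close> is among the sets
  intersected, and by \<open>A\<close> it lies in all of them.\<close>

lemma socle_quotient:
  assumes F': "gstable F'" "F \<subseteq> F'" "F' \<subseteq> W"
    and A: "\<And>S. gstable S \<Longrightarrow> F \<subseteq> S \<Longrightarrow> S \<subseteq> W \<Longrightarrow> (\<And>N. minimal_over F N \<Longrightarrow> N \<subseteq> W \<Longrightarrow> N \<subseteq> S) \<Longrightarrow> F' \<subseteq> S"
    and B: "\<And>N. minimal_over F N \<Longrightarrow> N \<subseteq> W \<Longrightarrow> N \<subseteq> F'"
  shows "{x \<in> W. cs x \<in> socle g Quo} = F'"
proof
  show "{x \<in> W. cs x \<in> socle g Quo} \<subseteq> F'"
  proof
    fix x assume "x \<in> {x \<in> W. cs x \<in> socle g Quo}"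
    then have x: "cs x \<in> socle g Quo" by simp
    have "N \<subseteq> cs ` F'" if N: "simple_submodule g Quo N" for N
    proof -
      have "lm_submodule g Quo N" using N by (simp add: simple_submodule_def)
      note P = submodule_preimage[OF this]
      have "preimage N \<subseteq> F'" by (rule B[OF simple_preimage[OF N] P(3)])
      then show ?thesis using P(4) by blast
    qed
    then have "cs x \<in> cs ` F'" using x submodule_image[OF F'(1,3)] unfolding socle_def by blast
    then show "x \<in> F'" by (simp only: coset_image_mem[OF F'(1,2)])
  qed
  show "F' \<subseteq> {x \<in> W. cs x \<in> socle g Quo}"
  proof
    fix x assume x: "x \<in> F'"
    have "cs x \<in> S" if S: "lm_submodule g Quo S" "\<forall>N. simple_submodule g Quo N \<longrightarrow> N \<subseteq> S" for S
    proof -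
      note P = submodule_preimage[OF S(1)]
      have "F' \<subseteq> preimage S"
      proof (rule A[OF P(1-3)])
        fix N assume N: "minimal_over F N" "N \<subseteq> W"
        have "cs ` N \<subseteq> S" using S(2) simple_image[OF N] by blast
        then show "N \<subseteq> preimage S" using N(2) by (auto simp: preimage_def)
      qed
      then show ?thesis using x by (auto simp: preimage_def)
    qed
    then show "x \<in> {x \<in> W. cs x \<in> socle g Quo}" using x F'(3) unfolding socle_def by blast
  qed
qed

end

text \<open>The bottom step, where the socle is that of the module itself and no cosets
  occur.\<close>

lemma socle_module:
  assumes W: "gstable W" and F': "gstable F'" "F' \<subseteq> W"
    and A: "\<And>S. gstable S \<Longrightarrow> S \<subseteq> W \<Longrightarrow> (\<And>N. minimal_over {0} N \<Longrightarrow> N \<subseteq> W \<Longrightarrow> N \<subseteq> S) \<Longrightarrow> F' \<subseteq> S"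
    and B: "\<And>N. minimal_over {0} N \<Longrightarrow> N \<subseteq> W \<Longrightarrow> N \<subseteq> F'"
  shows "socle g (mixed_module sV m n W) = F'"
  unfolding socle_def submodule_iff simple_iff
proof
  show "\<Inter> {S. (S \<subseteq> W \<and> gstable S) \<and> (\<forall>N. N \<subseteq> W \<and> minimal_over {0} N \<longrightarrow> N \<subseteq> S)} \<subseteq> F'"
    using F' B by (intro Inter_lower) auto
  show "F' \<subseteq> \<Inter> {S. (S \<subseteq> W \<and> gstable S) \<and> (\<forall>N. N \<subseteq> W \<and> minimal_over {0} N \<longrightarrow> N \<subseteq> S)}"
    using A by (intro Inter_greatest) auto
qed

text \<open>By \<open>layer_essential\<close>, \<open>N\<close> meets the next step in more than
  \<open>W \<inter> Tlt k\<close>; minimality then makes the intersection all of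
  \<open>N\<close>.\<close>

lemma minimal_over_layer:
  assumes W: "gstable W" "W \<subseteq> Tl" and N: "minimal_over (W \<inter> Tlt k) N" "N \<subseteq> W"
  shows "N \<subseteq> W \<inter> Tlt (Suc k)"
proof -
  have gN: "gstable N" "W \<inter> Tlt k \<subset> N" using N(1) by (auto simp: minimal_over_def)
  then obtain t where t: "t \<in> N" "t \<notin> Tlt k" using N(2) by blast
  have "N \<subseteq> Mix" using N(2) W(2) Tl_Mix by blast
  then obtain x where x: "x \<in> N" "x \<in> Tlt (Suc k)" "x \<notin> Tlt k"
    by (rule layer_essential[OF gN(1) _ t])
  let ?N = "N \<inter> Tlt (Suc k)"
  have "gstable ?N" using gN(1) gstable_Tlt by (auto simp: gstable_def intro: fn.subspace_inter)
  moreover have "W \<inter> Tlt k \<subseteq> ?N" using gN(2) Tlt_mono[of k "Suc k"] by auto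
  ultimately have "?N = W \<inter> Tlt k \<or> ?N = N" using N(1) by (auto simp: minimal_over_def)
  then have "?N = N" using x by blast
  then show ?thesis using N(2) by blast
qed

lemma layer_sum:
  assumes k: "k \<le> m" and W: "gstable W" "W \<subseteq> Tl" and S: "gstable S" "S \<subseteq> W" "W \<inter> Tlt k \<subseteq> S"
    and min: "\<And>N. minimal_over (W \<inter> Tlt k) N \<Longrightarrow> N \<subseteq> W \<Longrightarrow> N \<subseteq> S"
  shows "W \<inter> Tlt (Suc k) \<subseteq> S"
proof -
  \<comment> \<open>The zero tensor serves only to obtain some generic word of degree
    \<open>k\<close>.\<close>
  have "(0 :: 'a mixed) \<in> Tlt (Suc k)" by (rule fn.subspace_0[OF subspace_Tlt])
  then obtain yf yv where "generic k yf yv"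
    by (rule polarize_fresh[OF _ k finite.emptyI finite.emptyI]) blast
  then interpret mackey_generic sV e d Q m n k yf yv
    by unfold_locales (use k in auto)
  show ?thesis by (rule layer_semisimple[OF W S min])
qed

theorem socle_filtration_traceless:
  assumes W: "gstable W" "W \<subseteq> Tl" and k: "k \<le> m"
  shows "soc_filtration g (mixed_module sV m n W) k = W \<inter> Tlt (Suc k)"
  using k
proof (induction k)
  case 0
  \<comment> \<open>With this the socle itself becomes the layer over \<open>Tlt 0\<close>, and the
    same two lemmas apply.\<close>
  have z: "W \<inter> Tlt 0 = {0}" using fn.subspace_0[OF gstableD(1)[OF W(1)]] by (auto simp: Tlt_0)
  have "socle g (mixed_module sV m n W) = W \<inter> Tlt (Suc 0)"
  proof (rule socle_module[OF W(1)])
    show "gstable (W \<inter> Tlt (Suc 0))" using W(1) gstable_Tlt by (auto simp: gstable_def intro: fn.subspace_inter)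
    show "N \<subseteq> W \<inter> Tlt (Suc 0)" if "minimal_over {0} N" "N \<subseteq> W" for N
      by (rule minimal_over_layer[OF W, of 0 N, unfolded z, OF that])
    show "W \<inter> Tlt (Suc 0) \<subseteq> S" if S: "gstable S" "S \<subseteq> W"
      and min: "\<And>N. minimal_over {0} N \<Longrightarrow> N \<subseteq> W \<Longrightarrow> N \<subseteq> S" for S
    proof (rule layer_sum[OF 0 W S, unfolded z])
      show "{0} \<subseteq> S" using fn.subspace_0[OF gstableD(1)[OF S(1)]] by simp
    qed (rule min)
  qed simp
  then show ?case by simp
next
  case (Suc k)
  let ?F = "W \<inter> Tlt (Suc k)" and ?F' = "W \<inter> Tlt (Suc (Suc k))"
  have IH: "soc_filtration g (mixed_module sV m n W) k = ?F" using Suc by simp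
  have gF: "gstable ?F" "gstable ?F'" using W(1) gstable_Tlt by (auto simp: gstable_def intro: fn.subspace_inter)
  have "{x \<in> W. lm_coset (mixed_module sV m n W) ?F x \<in> socle g (lm_quotient (mixed_module sV m n W) ?F)} = ?F'"
  proof (rule socle_quotient[OF W(1) gF(1) _ gF(2)])
    show "?F \<subseteq> ?F'" using Tlt_mono[of "Suc k" "Suc (Suc k)"] by auto
    show "?F' \<subseteq> S" if "gstable S" "?F \<subseteq> S" "S \<subseteq> W" "\<And>N. minimal_over ?F N \<Longrightarrow> N \<subseteq> W \<Longrightarrow> N \<subseteq> S" for S
      by (rule layer_sum[OF Suc.prems W that(1,3,2,4)])
    show "N \<subseteq> ?F'" if "minimal_over ?F N" "N \<subseteq> W" for N
      by (rule minimal_over_layer[OF W that])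
  qed auto
  then show ?case by (simp add: IH)
qed

end

theorem theorem3p5:
  fixes sV :: "complex \<Rightarrow> 'v::ab_group_add \<Rightarrow> 'v"
    and sW :: "complex \<Rightarrow> 'w::ab_group_add \<Rightarrow> 'w"
    and p :: "'w \<Rightarrow> 'v \<Rightarrow> complex"
    and lam mu :: "nat list"
    and S T :: "nat \<times> nat \<Rightarrow> nat"
  assumes "vector_space sV" and "vector_space sW"
    and "countably_infinite_dim sV" and "countably_infinite_dim sW"
    and "nondegenerate_pairing sW sV p"
    and "is_partition lam" and "is_partition mu"
    and "is_tableau lam S" and "is_tableau mu T"
  shows "let m = sum_list lam; n = sum_list mu;
             g = mackey_algebra sV (range p);
             W = W_space sV lam S mu T;
             Wf = W_filtration sV (range p) lam S mu T
         in lm_submodule g (mixed_module sV m n (mixed_tensors sV m n)) W \<and>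
            (\<forall>k<m. Wf k \<subseteq> Wf (Suc k)) \<and>
            Wf m = W \<and>
            (\<forall>k\<le>m. Wf k = soc_filtration g (mixed_module sV m n W) k)"
proof -
  obtain e :: "nat \<Rightarrow> 'v" and d :: "nat \<Rightarrow> 'v \<Rightarrow> complex"
    where ed: "\<And>i j. d i (e j) = (if i = j then 1 else 0)" "module.span sV (range e) = UNIV"
      "\<And>i. d i \<in> alg_dual sV" and range_p: "fn.span (range d) = range p"
    by (rule dual_bases_exist[OF assms(1-5)]) blast
  interpret dual_bases sV e d
    by (intro dual_bases.intro assms(1) ed)
  obtain Q where "range d \<inter> Q = {}" "infinite Q" "\<not> fn.dependent (range d \<union> Q)"
    "fn.span (range d \<union> Q) = alg_dual sV"
    by (rule exists_independent_mod_Vs)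
  then interpret mackey_tensors sV e d Q "sum_list lam" "sum_list mu"
    by unfold_locales
  let ?W = "W_space sV lam S mu T"
  have W: "gstable ?W" by (rule gstable_W_space[OF refl refl])
  have WT: "?W \<subseteq> Tl" by (simp add: W_space_def)
  then have WM: "?W \<subseteq> Mix" using Tl_Mix by blast
  have Wf: "W_filtration sV (range p) lam S mu T k = ?W \<inter> Tlt (Suc k)" for k
    unfolding W_filtration_def range_p[symmetric] word_tensors_span ..
  have "lm_submodule g (mixed_module sV (sum_list lam) (sum_list mu) Mix) ?W"
    unfolding submodule_iff using W WM by blast
  moreover have "?W \<inter> Tlt (Suc k) \<subseteq> ?W \<inter> Tlt (Suc (Suc k))" for k
    using Tlt_mono[of "Suc k" "Suc (Suc k)"] by auto
  moreover have "?W \<inter> Tlt (Suc (sum_list lam)) = ?W" using WM by (auto simp: Tlt_Suc_m)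
  ultimately show ?thesis
    using socle_filtration_traceless[OF W WT] by (simp add: Let_def Wf range_p)
qed

end
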